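(* Let $n\ge 1$ and let $H_1,H_2$ be any two $n\times n$ Hadamard matrices. Then the Hadamard graphs of order $4n$ constructed from $H_1$ and from $H_2$ are quantum isomorphic.
   Context: A Hadamard matrix is an $n\times n$ matrix $H$ with entries in $\{\pm1\}$ satisfying $HH^\top=nI$. The Hadamard graph of $H$ (of order $4n$) has vertex set $\{r_1^+,r_1^-,\dots,r_n^+,r_n^-,c_1^+,c_1^-,\dots,c_n^+,c_n^-\}$; if $H_{ij}=1$ then $r_i^+\sim c_j^+$ and $r_i^-\sim c_j^-$, and if $H_{ij}=-1$ then $r_i^+\sim c_j^-$ and $r_i^-\sim c_j^+$; there are no other edges. Quantum isomorphism: graphs $G,H$ on $N$ vertices with adjacency matrices $A_G,A_H$ are quantum isomorphic if there exist a unital $C^*$-algebra $\mathcal A$ and an $N\times N$ matrix $\mathcal U=(u_{ij})$ over $\mathcal A$ whose entries are self-adjoint projections ($u_{ij}=u_{ij}^*=u_{ij}^2$) with every row and every column summing to $\mathbf 1$, such that $\mathcal U A_G=A_H\mathcal U$. By a theorem of Mančinska and Roberson, $G$ and $H$ are quantum isomorphic if and only if $\hom(F,G)=\hom(F,H)$ for every planar graph $F$, where $\hom(F,G)$ is the number of graph homomorphisms from $F$ to $G$. *)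

theory Defs
  imports Complex_Main
begin

definition is_hadamard :: "nat \<Rightarrow> (nat \<Rightarrow> nat \<Rightarrow> int) \<Rightarrow> bool" where
  "is_hadamard n H \<longleftrightarrow>
     (\<forall>i<n. \<forall>j<n. H i j = 1 \<or> H i j = -1) \<and>
     (\<forall>i<n. \<forall>j<n. (\<Sum>k<n. H i k * H j k) = (if i = j then int n else 0))"

text \<open>Vertex r_i^+ is HR i True, r_i^- is HR i False, similarly HC for columns.\<close>
datatype hvert = HR nat bool | HC nat bool

definition hadamard_vertices :: "nat \<Rightarrow> hvert set" where
  "hadamard_vertices n = {HR i s | i s. i < n} \<union> {HC j s | j s. j < n}"

fun hadamard_adj :: "nat \<Rightarrow> (nat \<Rightarrow> nat \<Rightarrow> int) \<Rightarrow> hvert \<Rightarrow> hvert \<Rightarrow> bool" where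
  "hadamard_adj n H (HR i s) (HC j t) =
     (i < n \<and> j < n \<and> ((H i j = 1 \<and> s = t) \<or> (H i j = -1 \<and> s \<noteq> t)))"
| "hadamard_adj n H (HC j t) (HR i s) =
     (i < n \<and> j < n \<and> ((H i j = 1 \<and> s = t) \<or> (H i j = -1 \<and> s \<noteq> t)))"
| "hadamard_adj n H _ _ = False"

record 'a cstar =
  carrier :: "'a set"
  zero :: 'a
  one :: 'a
  add :: "'a \<Rightarrow> 'a \<Rightarrow> 'a"
  smult :: "complex \<Rightarrow> 'a \<Rightarrow> 'a"
  mult :: "'a \<Rightarrow> 'a \<Rightarrow> 'a"
  star :: "'a \<Rightarrow> 'a"
  nrm :: "'a \<Rightarrow> real"

definition csub :: "('a, 'b) cstar_scheme \<Rightarrow> 'a \<Rightarrow> 'a \<Rightarrow> 'a" where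
  "csub A x y = add A x (smult A (-1) y)"

definition unital_cstar_algebra :: "('a, 'b) cstar_scheme \<Rightarrow> bool" where
  "unital_cstar_algebra A \<longleftrightarrow>
     \<comment> \<open>closure\<close>
     zero A \<in> carrier A \<and> one A \<in> carrier A \<and>
     (\<forall>x\<in>carrier A. \<forall>y\<in>carrier A. add A x y \<in> carrier A \<and> mult A x y \<in> carrier A) \<and>
     (\<forall>c. \<forall>x\<in>carrier A. smult A c x \<in> carrier A) \<and>
     (\<forall>x\<in>carrier A. star A x \<in> carrier A) \<and>
     \<comment> \<open>complex vector space\<close>
     (\<forall>x\<in>carrier A. \<forall>y\<in>carrier A. \<forall>z\<in>carrier A. add A (add A x y) z = add A x (add A y z)) \<and>
     (\<forall>x\<in>carrier A. \<forall>y\<in>carrier A. add A x y = add A y x) \<and>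
     (\<forall>x\<in>carrier A. add A (zero A) x = x) \<and>
     (\<forall>x\<in>carrier A. add A x (smult A (-1) x) = zero A) \<and>
     (\<forall>x\<in>carrier A. smult A 1 x = x) \<and>
     (\<forall>a b. \<forall>x\<in>carrier A. smult A a (smult A b x) = smult A (a * b) x) \<and>
     (\<forall>a b. \<forall>x\<in>carrier A. smult A (a + b) x = add A (smult A a x) (smult A b x)) \<and>
     (\<forall>a. \<forall>x\<in>carrier A. \<forall>y\<in>carrier A. smult A a (add A x y) = add A (smult A a x) (smult A a y)) \<and>
     \<comment> \<open>unital associative algebra\<close>
     (\<forall>x\<in>carrier A. \<forall>y\<in>carrier A. \<forall>z\<in>carrier A. mult A (mult A x y) z = mult A x (mult A y z)) \<and>
     (\<forall>x\<in>carrier A. \<forall>y\<in>carrier A. \<forall>z\<in>carrier A.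
        mult A x (add A y z) = add A (mult A x y) (mult A x z) \<and>
        mult A (add A x y) z = add A (mult A x z) (mult A y z)) \<and>
     (\<forall>a. \<forall>x\<in>carrier A. \<forall>y\<in>carrier A.
        mult A (smult A a x) y = smult A a (mult A x y) \<and> mult A x (smult A a y) = smult A a (mult A x y)) \<and>
     (\<forall>x\<in>carrier A. mult A (one A) x = x \<and> mult A x (one A) = x) \<and>
     one A \<noteq> zero A \<and>
     \<comment> \<open>involution\<close>
     (\<forall>x\<in>carrier A. star A (star A x) = x) \<and>
     (\<forall>x\<in>carrier A. \<forall>y\<in>carrier A. star A (add A x y) = add A (star A x) (star A y)) \<and>
     (\<forall>a. \<forall>x\<in>carrier A. star A (smult A a x) = smult A (cnj a) (star A x)) \<and>
     (\<forall>x\<in>carrier A. \<forall>y\<in>carrier A. star A (mult A x y) = mult A (star A y) (star A x)) \<and>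
     \<comment> \<open>norm\<close>
     (\<forall>x\<in>carrier A. nrm A x \<ge> 0 \<and> (nrm A x = 0 \<longleftrightarrow> x = zero A)) \<and>
     (\<forall>x\<in>carrier A. \<forall>y\<in>carrier A. nrm A (add A x y) \<le> nrm A x + nrm A y) \<and>
     (\<forall>a. \<forall>x\<in>carrier A. nrm A (smult A a x) = cmod a * nrm A x) \<and>
     (\<forall>x\<in>carrier A. \<forall>y\<in>carrier A. nrm A (mult A x y) \<le> nrm A x * nrm A y) \<and>
     \<comment> \<open>C*-identity\<close>
     (\<forall>x\<in>carrier A. nrm A (mult A (star A x) x) = (nrm A x)\<^sup>2) \<and>
     \<comment> \<open>completeness\<close>
     (\<forall>f :: nat \<Rightarrow> _. (\<forall>k. f k \<in> carrier A) \<longrightarrow>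
        (\<forall>e>0. \<exists>N. \<forall>m\<ge>N. \<forall>k\<ge>N. nrm A (csub A (f m) (f k)) < e) \<longrightarrow>
        (\<exists>x\<in>carrier A. \<forall>e>0. \<exists>N. \<forall>k\<ge>N. nrm A (csub A (f k) x) < e))"

definition csum :: "('a, 'b) cstar_scheme \<Rightarrow> ('c \<Rightarrow> 'a) \<Rightarrow> 'c set \<Rightarrow> 'a" where
  "csum A f S = Finite_Set.fold (\<lambda>x acc. add A (f x) acc) (zero A) S"

definition is_projection :: "('a, 'b) cstar_scheme \<Rightarrow> 'a \<Rightarrow> bool" where
  "is_projection A p \<longleftrightarrow> p \<in> carrier A \<and> star A p = p \<and> mult A p p = p"

text \<open>Fixed ambient type for carriers; it has cardinality 2^continuum, which is
  enough to hold (an isomorphic copy of) any C*-algebra generated by finitely many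
  elements (those have cardinality continuum).\<close>
type_synonym cstar_universe = "complex \<Rightarrow> complex"

text \<open>Quantum isomorphism of finite graphs G = (V, EG) and H = (W, EH):
  a matrix u with rows indexed by W and columns by V (so that U A_G = A_H U).\<close>
definition quantum_isomorphic ::
  "'v set \<Rightarrow> ('v \<Rightarrow> 'v \<Rightarrow> bool) \<Rightarrow> 'w set \<Rightarrow> ('w \<Rightarrow> 'w \<Rightarrow> bool) \<Rightarrow> bool" where
  "quantum_isomorphic V EG W EH \<longleftrightarrow>
     finite V \<and> finite W \<and> card V = card W \<and>
     (\<exists>A :: cstar_universe cstar. \<exists>u :: 'w \<Rightarrow> 'v \<Rightarrow> cstar_universe.
        unital_cstar_algebra A \<and>
        (\<forall>i\<in>W. \<forall>j\<in>V. is_projection A (u i j)) \<and>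
        (\<forall>i\<in>W. csum A (\<lambda>j. u i j) V = one A) \<and>
        (\<forall>j\<in>V. csum A (\<lambda>i. u i j) W = one A) \<and>
        (\<forall>i\<in>W. \<forall>j\<in>V.
           csum A (\<lambda>k. u i k) {k\<in>V. EG k j} = csum A (\<lambda>k. u k j) {k\<in>W. EH i k}))"

end

theory Submission
  imports Defs "HOL-Library.Poly_Mapping" "HOL-Library.Countable"
begin

text \<open>
  A quantum isomorphism of the two Hadamard graphs amounts to an orthogonal matrix \<open>x\<close> with
  self-adjoint entries in a C*-algebra such that distinct entries in a row of \<open>x\<close> have product
  zero and the same holds for \<open>v = (1/n) H\<^sub>2\<^sup>T x H\<^sub>1\<close>; the magic unitary consists of the spectral
  projections \<open>(y\<^sup>2 \<plusminus> y)/2\<close> of these entries. In other words, \<open>x\<close> intertwines, for \<open>H\<^sub>1\<close> and \<open>H\<^sub>2\<close>,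
  the projections \<open>\<Sum>\<^sub>k e\<^sub>k e\<^sub>k\<^sup>T \<otimes> e\<^sub>k e\<^sub>k\<^sup>T\<close> attached to two mutually unbiased bases: the standard basis
  and the normalised columns of the Hadamard matrix.

  On tensor powers of \<open>\<real>\<^sup>n\<close> these projections, acting on neighbouring legs, generate two commuting
  Temperley--Lieb algebras with parameter \<open>1/n\<close>, and the matrix trace is a Markov trace on them.
  Hence the trace of every word, and with it the inner product of any two vectors obtained from
  such words by cups and caps, depends on \<open>n\<close> only. Corresponding invariant vectors \<open>\<xi>\<^sub>a\<close> for \<open>H\<^sub>2\<close>
  and \<open>\<eta>\<^sub>a\<close> for \<open>H\<^sub>1\<close> are therefore related by an isometry, and for orthonormal bases the formula
  \<open>h(x\<^bsub>i\<^sub>1j\<^sub>1\<^esub> \<cdots> x\<^bsub>i\<^sub>mj\<^sub>m\<^esub>) = \<Sum>\<^sub>a \<xi>\<^sub>a(i\<^sub>1,\<dots>,i\<^sub>m) \<eta>\<^sub>a(j\<^sub>1,\<dots>,j\<^sub>m)\<close> defines a functional on the free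
  algebra which satisfies all relations and is positive. Its GNS representation yields the
  C*-algebra.
\<close>

section \<open>Tensors and local projections\<close>

text \<open>The obstacle is nontriviality: the relations for the generators are easy to write down,
  but two unrelated Hadamard matrices offer no visible model of them, so the algebra they present
  might collapse. A positive functional with value 1 at the unit excludes this. Its kernel is the
  analogue of the Haar integral of matrix coefficients, which is the orthogonal projection onto
  fixed vectors; with two different matrices the projection becomes a partial isometry from one
  space of fixed vectors to the other. Positivity is derived directly from the closure of
  corresponding pairs under cups, caps, reversal and tensor products. The parameter 1/n is the
  squared inner product of vectors from the two bases. The edge condition of the graphs splits into
  two parts: the projections for the signs + and - have sum y^2 and difference y; the squares add up
  to 1 on both sides, and the signed part is x H1 = H2 v, which holds by the definition of
  v.\<close>

type_synonym tensor = "nat list \<Rightarrow> real"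

text \<open>In \<open>E c k i\<close> the flag \<open>c\<close> selects one of two bases,
  \<open>k\<close> the vector and \<open>i\<close> its coordinate.\<close>

type_synonym bases = "bool \<Rightarrow> nat \<Rightarrow> nat \<Rightarrow> real"

definition tuples :: "nat \<Rightarrow> nat \<Rightarrow> nat list set" where
  "tuples n m = {I. length I = m \<and> set I \<subseteq> {..<n}}"

text \<open>A tensor is a function on lists of all lengths. Forcing the value 0 off the index set
  makes equations between tensors plain equations between functions.\<close>

definition tensors :: "nat \<Rightarrow> nat \<Rightarrow> tensor set" where
  "tensors n m = {T. \<forall>I. I \<notin> tuples n m \<longrightarrow> T I = 0}"

definition slice :: "nat \<Rightarrow> tensor \<Rightarrow> tensor" where
  "slice i T = (\<lambda>J. T (i # J))"

definition contract :: "nat \<Rightarrow> (nat \<Rightarrow> real) \<Rightarrow> tensor \<Rightarrow> tensor" where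
  "contract n v T = (\<lambda>J. \<Sum>a<n. v a * T (a # J))"

definition outer :: "(nat \<Rightarrow> real) \<Rightarrow> tensor \<Rightarrow> tensor" where
  "outer v T = (\<lambda>I. case I of [] \<Rightarrow> 0 | i # J \<Rightarrow> v i * T J)"

definition head_cup :: "nat \<Rightarrow> tensor \<Rightarrow> tensor" where
  "head_cup n T = (\<lambda>I. case I of i # j # J \<Rightarrow> if i = j \<and> i < n then T J else 0 | _ \<Rightarrow> 0)"

definition head_cap :: "nat \<Rightarrow> tensor \<Rightarrow> tensor" where
  "head_cap n T = (\<lambda>J. \<Sum>i<n. T (i # i # J))"

definition head_proj :: "nat \<Rightarrow> (nat \<Rightarrow> nat \<Rightarrow> real) \<Rightarrow> tensor \<Rightarrow> tensor" where
  "head_proj n e T = (\<lambda>I. \<Sum>k<n. outer (e k) (outer (e k) (contract n (e k) (contract n (e k) T))) I)"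

text \<open>The position \<open>p\<close> is the number of legs to the right of the pair acted on. Counting from the tail
  makes the operators independent of legs added at the head of the index list.\<close>

fun proj :: "nat \<Rightarrow> (nat \<Rightarrow> nat \<Rightarrow> real) \<Rightarrow> nat \<Rightarrow> tensor \<Rightarrow> tensor" where
  "proj n e p T [] = 0"
| "proj n e p T (i # J) =
     (if length J = Suc p then head_proj n e T (i # J) else proj n e p (slice i T) J)"

lemma tuples_0 [simp]: "tuples n 0 = {[]}"
  by (auto simp: tuples_def)

lemma Cons_in_tuples [simp]: "i # J \<in> tuples n m \<longleftrightarrow> i < n \<and> (\<exists>m'. m = Suc m' \<and> J \<in> tuples n m')"
  by (auto simp: tuples_def)

lemma finite_tuples [simp]: "finite (tuples n m)"
  using finite_lists_length_eq[of "{..<n}" m] by (simp add: tuples_def conj_commute)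

lemma sum_tuples_Suc:
  "(\<Sum>I\<in>tuples n (Suc m). f I) = (\<Sum>i<n. \<Sum>J\<in>tuples n m. f (i # J))"
proof -
  have "tuples n (Suc m) = (\<lambda>(i, J). i # J) ` ({..<n} \<times> tuples n m)"
    by (force simp: tuples_def length_Suc_conv image_iff)
  moreover have "inj_on (\<lambda>(i, J). i # J) ({..<n} \<times> tuples n m)"
    by (auto simp: inj_on_def)
  ultimately show ?thesis
    by (simp add: sum.reindex sum.cartesian_product case_prod_unfold)
qed

lemma tensorsD: "T \<in> tensors n m \<Longrightarrow> I \<notin> tuples n m \<Longrightarrow> T I = 0"
  by (simp add: tensors_def)

lemma tensors_eqI:
  assumes "T \<in> tensors n (Suc m)" "T' \<in> tensors n (Suc m)"
    and "\<And>i. i < n \<Longrightarrow> slice i T = slice i T'"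
  shows "T = T'"
proof
  fix I
  show "T I = T' I"
  proof (cases "I \<in> tuples n (Suc m)")
    case True
    then obtain i J where "I = i # J" "i < n" by (auto simp: tuples_def length_Suc_conv)
    then show ?thesis using fun_cong[OF assms(3)[of i], of J] by (simp add: slice_def)
  next
    case False
    then show ?thesis using assms by (simp add: tensorsD)
  qed
qed

lemma slice_tensors: "T \<in> tensors n (Suc m) \<Longrightarrow> slice i T \<in> tensors n m"
  by (auto simp: tensors_def slice_def)

lemma slice_eq_0: "T \<in> tensors n m \<Longrightarrow> \<not> i < n \<Longrightarrow> slice i T = (\<lambda>J. 0)"
  by (auto simp: tensors_def slice_def)

lemma contract_tensors: "T \<in> tensors n (Suc m) \<Longrightarrow> contract n v T \<in> tensors n m"
  by (auto simp: tensors_def contract_def)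

lemma outer_tensors:
  "T \<in> tensors n m \<Longrightarrow> (\<And>i. i \<ge> n \<Longrightarrow> v i = 0) \<Longrightarrow> outer v T \<in> tensors n (Suc m)"
  by (auto simp: tensors_def outer_def not_less split: list.splits)

lemma sum_tensors: "(\<And>k. k \<in> A \<Longrightarrow> T k \<in> tensors n m) \<Longrightarrow> (\<lambda>I. \<Sum>k\<in>A. T k I) \<in> tensors n m"
  by (auto simp: tensors_def)

lemma scale_tensors: "T \<in> tensors n m \<Longrightarrow> (\<lambda>I. c * T I) \<in> tensors n m"
  by (auto simp: tensors_def)

lemma head_cup_tensors: "T \<in> tensors n m \<Longrightarrow> head_cup n T \<in> tensors n (Suc (Suc m))"
  by (auto simp: tensors_def head_cup_def split: list.splits)

lemma head_cap_tensors: "T \<in> tensors n (Suc (Suc m)) \<Longrightarrow> head_cap n T \<in> tensors n m"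
  by (auto simp: tensors_def head_cap_def)

lemma contract_sum:
  "contract n v (\<lambda>I. \<Sum>k\<in>A. T k I) = (\<lambda>I. \<Sum>k\<in>A. contract n v (T k) I)"
  by (rule ext) (simp add: contract_def sum_distrib_left sum.swap[of _ A])

lemma contract_scale: "contract n v (\<lambda>I. c * T I) = (\<lambda>I. c * contract n v T I)"
  by (rule ext) (simp add: contract_def sum_distrib_left mult_ac)

lemma outer_sum: "outer v (\<lambda>I. \<Sum>k\<in>A. T k I) = (\<lambda>I. \<Sum>k\<in>A. outer v (T k) I)"
  by (rule ext) (simp add: outer_def sum_distrib_left split: list.splits)

lemma outer_scale: "outer v (\<lambda>I. c * T I) = (\<lambda>I. c * outer v T I)"
  by (rule ext) (simp add: outer_def mult_ac split: list.splits)

lemma contract_outer: "contract n v (outer u T) = (\<lambda>I. (\<Sum>a<n. v a * u a) * T I)"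
  by (rule ext) (simp add: contract_def outer_def sum_distrib_right mult.assoc)

lemma slice_sum: "slice i (\<lambda>I. \<Sum>k\<in>A. T k I) = (\<lambda>I. \<Sum>k\<in>A. slice i (T k) I)"
  by (simp add: slice_def)

lemma slice_scale: "slice i (\<lambda>I. c * T I) = (\<lambda>I. c * slice i T I)"
  by (simp add: slice_def)

lemma slice_outer: "slice i (outer v T) = (\<lambda>J. v i * T J)"
  by (simp add: slice_def outer_def)

lemma contract_eq_slices: "contract n v T = (\<lambda>J. \<Sum>a<n. v a * slice a T J)"
  by (simp add: contract_def slice_def)

lemma head_proj_sum: "head_proj n e (\<lambda>I. \<Sum>k\<in>A. T k I) = (\<lambda>I. \<Sum>k\<in>A. head_proj n e (T k) I)"
  by (rule ext) (simp add: head_proj_def contract_sum outer_sum sum.swap[of _ A])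

lemma head_proj_scale: "head_proj n e (\<lambda>I. c * T I) = (\<lambda>I. c * head_proj n e T I)"
  by (rule ext) (simp add: head_proj_def contract_scale outer_scale sum_distrib_left)

lemma proj_sum_apply:
  "proj n e p (\<lambda>I. \<Sum>k\<in>A. T k I) I = (\<Sum>k\<in>A. proj n e p (T k) I)"
  by (induction I arbitrary: T) (simp_all add: head_proj_sum slice_sum)

lemma proj_sum: "proj n e p (\<lambda>I. \<Sum>k\<in>A. T k I) = (\<lambda>I. \<Sum>k\<in>A. proj n e p (T k) I)"
  by (rule ext) (rule proj_sum_apply)

lemma proj_scale_apply: "proj n e p (\<lambda>I. c * T I) I = c * proj n e p T I"
  by (induction I arbitrary: T) (simp_all add: head_proj_scale slice_scale)

lemma proj_scale: "proj n e p (\<lambda>I. c * T I) = (\<lambda>I. c * proj n e p T I)"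
  by (rule ext) (rule proj_scale_apply)

lemma proj_zero: "proj n e p (\<lambda>I. 0) = (\<lambda>I. 0)"
  using proj_scale[of n e p 0 "\<lambda>I. 0"] by simp

lemma proj_short: "length I < Suc (Suc p) \<Longrightarrow> proj n e p T I = 0"
  by (induction I arbitrary: T) auto

lemma proj_eq_0: "(\<And>I'. length I' = length I \<Longrightarrow> T I' = 0) \<Longrightarrow> proj n e p T I = 0"
  by (induction I arbitrary: T)
    (auto simp: head_proj_def outer_def contract_def slice_def split: list.splits intro!: sum.neutral)

text \<open>\<open>orth\<close> and \<open>compl\<close> are the two forms of orthogonality of the
  square matrix \<open>E c\<close>, one for contractions and one for resolutions of the identity.
  Extension by zero keeps \<open>outer\<close> inside \<open>tensors\<close>.\<close>

locale unbiased_bases =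
  fixes n :: nat and E :: bases
  assumes n_pos: "n > 0"
    and supp: "k \<ge> n \<or> i \<ge> n \<Longrightarrow> E c k i = 0"
    and orth: "k < n \<Longrightarrow> l < n \<Longrightarrow> (\<Sum>i<n. E c k i * E c l i) = of_bool (k = l)"
    and compl: "i < n \<Longrightarrow> j < n \<Longrightarrow> (\<Sum>k<n. E c k i * E c k j) = of_bool (i = j)"
    and unbiased: "k < n \<Longrightarrow> l < n \<Longrightarrow> (\<Sum>i<n. E c k i * E (\<not> c) l i) ^ 2 = inverse (real n)"
begin

lemma head_proj_tensors:
  "T \<in> tensors n (Suc (Suc m)) \<Longrightarrow> head_proj n (E c) T \<in> tensors n (Suc (Suc m))"
  unfolding head_proj_def
  by (intro sum_tensors outer_tensors contract_tensors) (auto simp: supp)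

lemma head_proj_length: "T \<in> tensors n m \<Longrightarrow> length I \<noteq> m \<Longrightarrow> head_proj n e T I = 0"
  by (auto simp: head_proj_def outer_def contract_def tensors_def tuples_def split: list.splits
      intro!: sum.neutral)

text \<open>On \<open>Suc m\<close> legs the projection touches the first leg exactly when
  \<open>m = Suc p\<close>; if there are too few legs both sides vanish. Through slicing, identities
  at arbitrary positions reduce to the case of a pair at the head.\<close>

lemma slice_proj:
  assumes "T \<in> tensors n (Suc m)" "m \<noteq> Suc p"
  shows "slice i (proj n e p T) = proj n e p (slice i T)"
proof
  fix J
  show "slice i (proj n e p T) J = proj n e p (slice i T) J"
  proof (cases "length J = Suc p")
    case True
    then show ?thesis using assms head_proj_length[OF assms(1), of "i # J"]
      by (simp add: slice_def proj_short)
  qed (simp add: slice_def)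
qed

lemma proj_head:
  assumes "T \<in> tensors n (Suc (Suc p))"
  shows "proj n e p T = head_proj n e T"
proof
  fix I
  show "proj n e p T I = head_proj n e T I"
  proof (cases I)
    case (Cons i J)
    show ?thesis
    proof (cases "length J = Suc p")
      case False
      then have "proj n e p (slice i T) J = 0"
        using assms by (intro proj_eq_0) (auto simp: tensors_def tuples_def slice_def)
      then show ?thesis using False assms head_proj_length[OF assms, of I] Cons by simp
    qed (simp add: Cons)
  qed (simp add: head_proj_def outer_def)
qed

lemma proj_tensors: "T \<in> tensors n m \<Longrightarrow> proj n (E c) p T \<in> tensors n m"
proof (induction m arbitrary: T)
  case 0
  then have "proj n (E c) p T I = 0" if "I \<noteq> []" for I
    using that by (intro proj_eq_0) (metis length_0_conv singletonD tensorsD tuples_0)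
  then show ?case by (simp add: tensors_def)
next
  case (Suc m)
  show ?case
  proof (cases "m = Suc p")
    case True
    then show ?thesis using Suc.prems proj_head head_proj_tensors by simp
  next
    case False
    have "proj n (E c) p T I = 0" if "I \<notin> tuples n (Suc m)" for I
    proof (cases I)
      case (Cons i J)
      have *: "proj n (E c) p T I = proj n (E c) p (slice i T) J"
        using slice_proj[OF Suc.prems False, of i "E c"] Cons by (metis slice_def)
      have "slice i T \<in> tensors n m" using Suc.prems by (rule slice_tensors)
      then have **: "proj n (E c) p (slice i T) \<in> tensors n m" by (rule Suc.IH)
      show ?thesis
      proof (cases "i < n")
        case True then show ?thesis using * ** that Cons by (auto simp: tensors_def)
      next
        case False then show ?thesis using * slice_eq_0[OF Suc.prems False] by (simp add: proj_zero)
      qed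
    qed simp
    then show ?thesis by (simp add: tensors_def)
  qed
qed

lemma contract_proj:
  assumes "T \<in> tensors n (Suc m)" "m \<noteq> Suc p"
  shows "contract n v (proj n e p T) = proj n e p (contract n v T)"
  unfolding contract_eq_slices slice_proj[OF assms] proj_sum proj_scale ..

lemma proj_outer:
  assumes "T \<in> tensors n m" "m \<noteq> Suc p" and v: "\<And>i. i \<ge> n \<Longrightarrow> v i = 0"
  shows "proj n (E c) p (outer v T) = outer v (proj n (E c) p T)"
proof (rule tensors_eqI)
  have o: "outer v T \<in> tensors n (Suc m)" using assms by (intro outer_tensors) auto
  then show "proj n (E c) p (outer v T) \<in> tensors n (Suc m)" by (rule proj_tensors)
  show "outer v (proj n (E c) p T) \<in> tensors n (Suc m)"
    using assms by (intro outer_tensors proj_tensors) auto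
  show "slice i (proj n (E c) p (outer v T)) = slice i (outer v (proj n (E c) p T))" for i
    by (simp add: slice_proj[OF o assms(2)] slice_outer proj_scale)
qed

lemma contract_outer_E:
  "k < n \<Longrightarrow> l < n \<Longrightarrow> contract n (E c k) (outer (E c l) T) = (\<lambda>I. of_bool (k = l) * T I)"
  by (simp add: contract_outer orth)

lemma resolution:
  assumes "T \<in> tensors n (Suc m)"
  shows "(\<lambda>I. \<Sum>k<n. outer (E c k) (contract n (E c k) T) I) = T"
proof
  fix I
  show "(\<Sum>k<n. outer (E c k) (contract n (E c k) T) I) = T I"
  proof (cases I)
    case Nil
    then show ?thesis using assms by (simp add: outer_def tensors_def tuples_def)
  next
    case (Cons i J)
    have "(\<Sum>k<n. outer (E c k) (contract n (E c k) T) I) = (\<Sum>a<n. (\<Sum>k<n. E c k i * E c k a) * T (a # J))"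
      by (simp add: Cons outer_def contract_def sum_distrib_left sum_distrib_right mult_ac)
        (rule sum.swap)
    also have "\<dots> = T I"
    proof (cases "i < n")
      case True
      then show ?thesis by (simp add: compl Cons)
    next
      case False
      then show ?thesis using assms by (simp add: supp Cons tensorsD)
    qed
    finally show ?thesis .
  qed
qed

lemma sum_delta_scale:
  "l < n \<Longrightarrow> (\<Sum>k<n. of_bool (l = k) * f k) = (f l :: real)"
  "l < n \<Longrightarrow> (\<Sum>k<n. of_bool (k = l) * f k) = (f l :: real)"
  by (simp_all add: of_bool_def if_distrib[of "\<lambda>x. x * _"] sum.delta sum.delta' cong: if_cong)

lemma contract_head_proj:
  assumes "k < n"
  shows "contract n (E c k) (head_proj n (E c) T) =
    outer (E c k) (contract n (E c k) (contract n (E c k) T))"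
  unfolding head_proj_def contract_sum
  using assms by (simp add: contract_outer_E sum_delta_scale)

lemma head_proj_outer:
  assumes "k < n"
  shows "head_proj n (E c) (outer (E c k) T) = outer (E c k) (outer (E c k) (contract n (E c k) T))"
proof -
  have "outer (E c l) (outer (E c l) (contract n (E c l) (contract n (E c l) (outer (E c k) T)))) I
     = of_bool (l = k) * outer (E c l) (outer (E c l) (contract n (E c l) T)) I" if "l < n" for l I
    using assms that by (simp add: contract_outer_E contract_scale outer_scale)
  then show ?thesis
    unfolding head_proj_def using assms by (simp add: sum_delta_scale)
qed

lemma unbiased': "k < n \<Longrightarrow> l < n \<Longrightarrow>
  (\<Sum>i<n. E c k i * E (\<not> c) l i) * (\<Sum>i<n. E (\<not> c) l i * E c k i) = inverse (real n)"
  using unbiased[of k l c] by (simp add: power2_eq_square mult.commute)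

text \<open>Compressing the projection of the other basis by \<open>E c k\<close> gives every
  summand the factor 1/n, a squared inner product; what remains of the sum resolves the
  identity.\<close>

lemma contract_head_proj_outer:
  assumes "T \<in> tensors n (Suc m)" "k < n"
  shows "contract n (E c k) (head_proj n (E (\<not> c)) (outer (E c k) T)) = (\<lambda>I. inverse (real n) * T I)"
proof -
  let ?e = "E (\<not> c)"
  have *: "contract n (E c k) (outer (?e l) (outer (?e l) (contract n (?e l) (contract n (?e l) (outer (E c k) T))))) I
      = inverse (real n) * outer (?e l) (contract n (?e l) T) I" if "l < n" for l I
    using unbiased'[OF assms(2) that, of c]
    by (simp add: contract_outer contract_scale outer_scale mult.assoc[symmetric])
      (simp add: mult.commute)
  have "contract n (E c k) (head_proj n ?e (outer (E c k) T)) = (\<lambda>I. \<Sum>l<n. inverse (real n) * outer (?e l) (contract n (?e l) T) I)"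
    unfolding head_proj_def contract_sum using * by simp
  then show ?thesis
    using resolution[OF assms(1), of "\<not> c"] by (simp add: sum_distrib_left[symmetric] fun_eq_iff)
qed

end

section \<open>Cups, caps and the inner product of tensors\<close>

fun cup :: "nat \<Rightarrow> nat \<Rightarrow> tensor \<Rightarrow> tensor" where
  "cup n p T [] = 0"
| "cup n p T (i # J) =
     (if length J = Suc p then head_cup n T (i # J) else cup n p (slice i T) J)"

text \<open>\<open>p\<close> counts the legs to the right of the contracted pair. The pair is absent
  from the result, so the recursion stops at a remaining list of length \<open>p\<close>, which is
  empty for \<open>p = 0\<close>.\<close>

fun cap :: "nat \<Rightarrow> nat \<Rightarrow> tensor \<Rightarrow> tensor" where
  "cap n p T [] = (if p = 0 then head_cap n T [] else 0)"
| "cap n p T (i # J) =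
     (if Suc (length J) = p then head_cap n T (i # J) else cap n p (slice i T) J)"

definition ip :: "nat \<Rightarrow> nat \<Rightarrow> tensor \<Rightarrow> tensor \<Rightarrow> real" where
  "ip n m T T' = (\<Sum>I\<in>tuples n m. T I * T' I)"

lemma cup_short: "length I < Suc (Suc p) \<Longrightarrow> cup n p T I = 0"
  by (induction I arbitrary: T) auto

lemma cap_short: "length I < p \<Longrightarrow> cap n p T I = 0"
  by (induction I arbitrary: T) auto

lemma cup_eq_0: "(\<And>I'. Suc (Suc (length I')) = length I \<Longrightarrow> T I' = 0) \<Longrightarrow> cup n p T I = 0"
  by (induction I arbitrary: T)
    (auto simp: head_cup_def slice_def split: list.splits)

lemma cap_eq_0: "(\<And>I'. length I' = Suc (Suc (length I)) \<Longrightarrow> T I' = 0) \<Longrightarrow> cap n p T I = 0"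
  by (induction I arbitrary: T) (auto simp: head_cap_def slice_def)

lemma cup_sum: "cup n p (\<lambda>I. \<Sum>k\<in>A. T k I) = (\<lambda>I. \<Sum>k\<in>A. cup n p (T k) I)"
proof
  show "cup n p (\<lambda>I. \<Sum>k\<in>A. T k I) I = (\<Sum>k\<in>A. cup n p (T k) I)" for I
    by (induction I arbitrary: T) (auto simp: slice_sum head_cup_def split: list.splits intro!: sum.neutral)
qed

lemma cup_scale: "cup n p (\<lambda>I. c * T I) = (\<lambda>I. c * cup n p T I)"
proof
  show "cup n p (\<lambda>I. c * T I) I = c * cup n p T I" for I
    by (induction I arbitrary: T) (auto simp: slice_scale head_cup_def split: list.splits)
qed

lemma cap_scale: "cap n p (\<lambda>I. c * T I) = (\<lambda>I. c * cap n p T I)"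
proof
  show "cap n p (\<lambda>I. c * T I) I = c * cap n p T I" for I
    by (induction I arbitrary: T) (auto simp: slice_scale head_cap_def sum_distrib_left)
qed

lemma slice_cup:
  assumes "T \<in> tensors n (Suc m)" "p \<le> m"
  shows "slice i (cup n p T) = cup n p (slice i T)"
proof
  fix J
  show "slice i (cup n p T) J = cup n p (slice i T) J"
  proof (cases "length J = Suc p")
    case True
    then have "head_cup n T (i # J) = 0"
      using assms by (auto simp: head_cup_def tensors_def tuples_def split: list.splits)
    then show ?thesis using True by (simp add: slice_def cup_short)
  qed (simp add: slice_def)
qed

lemma slice_cap:
  assumes "T \<in> tensors n (Suc (Suc (Suc m)))" "p \<le> m"
  shows "slice i (cap n p T) = cap n p (slice i T)"
proof
  fix J
  show "slice i (cap n p T) J = cap n p (slice i T) J"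
  proof (cases "Suc (length J) = p")
    case True
    then have "head_cap n T (i # J) = 0"
      using assms by (auto simp: head_cap_def tensors_def tuples_def intro!: sum.neutral)
    then show ?thesis using True by (simp add: slice_def cap_short)
  qed (simp add: slice_def)
qed

lemma cup_head:
  assumes "T \<in> tensors n m"
  shows "cup n m T = head_cup n T"
proof
  fix I
  show "cup n m T I = head_cup n T I"
  proof (cases "length I = Suc (Suc m)")
    case True
    then show ?thesis by (cases I) auto
  next
    case False
    then have "cup n m T I = 0"
      using assms by (intro cup_eq_0) (auto simp: tensors_def tuples_def)
    moreover have "head_cup n T I = 0"
      using False assms by (auto simp: head_cup_def tensors_def tuples_def split: list.splits)
    ultimately show ?thesis by simp
  qed
qed

lemma cap_head:
  assumes "T \<in> tensors n (Suc (Suc m))"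
  shows "cap n m T = head_cap n T"
proof
  fix I
  show "cap n m T I = head_cap n T I"
  proof (cases "length I = m")
    case True
    then show ?thesis by (cases I) auto
  next
    case False
    then have "cap n m T I = 0"
      using assms by (intro cap_eq_0) (auto simp: tensors_def tuples_def)
    moreover have "head_cap n T I = 0"
      using False assms by (auto simp: head_cap_def tensors_def tuples_def intro!: sum.neutral)
    ultimately show ?thesis by simp
  qed
qed

lemma tensors_SucI:
  assumes "T [] = 0" "\<And>i. i < n \<Longrightarrow> slice i T \<in> tensors n m" "\<And>i. i \<ge> n \<Longrightarrow> slice i T = (\<lambda>J. 0)"
  shows "T \<in> tensors n (Suc m)"
proof -
  have "T I = 0" if "I \<notin> tuples n (Suc m)" for I
  proof (cases I)
    case (Cons i J)
    then show ?thesis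
      using that assms(2)[of i] fun_cong[OF assms(3)[of i], of J]
      by (cases "i < n") (auto simp: slice_def tensors_def)
  qed (use assms in simp)
  then show ?thesis by (simp add: tensors_def)
qed

lemma cup_zero: "cup n p (\<lambda>I. 0) = (\<lambda>I. 0)"
  using cup_scale[of n p 0 "\<lambda>I. 0"] by simp

lemma cap_zero: "cap n p (\<lambda>I. 0) = (\<lambda>I. 0)"
  using cap_scale[of n p 0 "\<lambda>I. 0"] by simp

lemma cup_tensors:
  assumes "p \<le> m" "T \<in> tensors n m"
  shows "cup n p T \<in> tensors n (Suc (Suc m))"
  using assms
proof (induction m arbitrary: T rule: nat_induct_at_least)
  case base
  then show ?case by (simp add: cup_head head_cup_tensors)
next
  case (Suc m)
  show ?case
  proof (rule tensors_SucI)
    show "slice i (cup n p T) \<in> tensors n (Suc (Suc m))" for i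
      using Suc by (simp add: slice_cup[of _ n m] slice_tensors)
    show "slice i (cup n p T) = (\<lambda>J. 0)" if "i \<ge> n" for i
      using Suc that by (simp add: slice_cup[of _ n m] slice_eq_0 cup_zero)
  qed simp
qed

lemma cap_tensors:
  assumes "p \<le> m" "T \<in> tensors n (Suc (Suc m))"
  shows "cap n p T \<in> tensors n m"
  using assms
proof (induction m arbitrary: T rule: nat_induct_at_least)
  case base
  then show ?case by (simp add: cap_head head_cap_tensors)
next
  case (Suc m)
  show ?case
  proof (rule tensors_SucI)
    show "cap n p T [] = 0"
      using Suc by (auto simp: head_cap_def tensors_def tuples_def intro!: sum.neutral)
    show "slice i (cap n p T) \<in> tensors n m" for i
      using Suc by (simp add: slice_cap[of _ n m] slice_tensors)
    show "slice i (cap n p T) = (\<lambda>J. 0)" if "i \<ge> n" for i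
      using Suc that by (simp add: slice_cap[of _ n m] slice_eq_0 cap_zero)
  qed
qed

lemma cup_append:
  assumes "T \<in> tensors n m" "A @ i # j # B \<in> tuples n (Suc (Suc m))"
  shows "cup n (length B) T (A @ i # j # B) = of_bool (i = j) * T (A @ B)"
  using assms
proof (induction A arbitrary: T m)
  case Nil
  then show ?case by (auto simp: head_cup_def)
next
  case (Cons a A)
  then obtain m' where m': "m = Suc m'" by (auto simp: tuples_def)
  then have "slice a T \<in> tensors n m'" using Cons.prems by (simp add: slice_tensors)
  from Cons.IH[OF this] show ?case using Cons.prems m' by (auto simp: slice_def)
qed

lemma cap_append:
  assumes "T \<in> tensors n (Suc (Suc m))" "A @ B \<in> tuples n m"
  shows "cap n (length B) T (A @ B) = (\<Sum>i<n. T (A @ i # i # B))"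
  using assms
proof (induction A arbitrary: T m)
  case Nil
  then show ?case by (cases B) (auto simp: head_cap_def)
next
  case (Cons a A)
  then obtain m' where m': "m = Suc m'" by (auto simp: tuples_def)
  then have "slice a T \<in> tensors n (Suc (Suc m'))" using Cons.prems by (simp add: slice_tensors)
  from Cons.IH[OF this] show ?case using Cons.prems m' by (auto simp: slice_def)
qed

lemma ip_Suc: "ip n (Suc m) T T' = (\<Sum>i<n. ip n m (slice i T) (slice i T'))"
  by (simp add: ip_def sum_tuples_Suc slice_def)

lemma ip_sym: "ip n m T T' = ip n m T' T"
  by (simp add: ip_def mult.commute)

lemma ip_sum_left: "ip n m (\<lambda>I. \<Sum>k\<in>A. T k I) T' = (\<Sum>k\<in>A. ip n m (T k) T')"
  by (simp add: ip_def sum_distrib_right sum.swap[of _ A])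

lemma ip_scale_left: "ip n m (\<lambda>I. c * T I) T' = c * ip n m T T'"
  by (simp add: ip_def sum_distrib_left mult_ac)

lemma ip_diff_left: "ip n m (\<lambda>I. T I - S I) T' = ip n m T T' - ip n m S T'"
  by (simp add: ip_def algebra_simps sum_subtractf)

lemma ip_sum_right: "ip n m T (\<lambda>I. \<Sum>k\<in>A. T' k I) = (\<Sum>k\<in>A. ip n m T (T' k))"
  by (simp add: ip_sym[of n m T] ip_sum_left)

lemma ip_scale_right: "ip n m T (\<lambda>I. c * T' I) = c * ip n m T T'"
  by (simp add: ip_sym[of n m T] ip_scale_left)

lemma ip_diff_right: "ip n m T (\<lambda>I. T' I - S I) = ip n m T T' - ip n m T S"
  by (simp add: ip_sym[of n m T] ip_diff_left)

lemma ip_outer: "ip n (Suc m) (outer v T) T' = ip n m T (contract n v T')"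
  by (simp add: ip_def sum_tuples_Suc outer_def contract_def sum_distrib_left mult_ac)
    (rule sum.swap)

lemma ip_head_cup: "ip n (Suc (Suc m)) (head_cup n T) T' = ip n m T (head_cap n T')"
proof -
  have "ip n (Suc (Suc m)) (head_cup n T) T' =
     (\<Sum>i<n. \<Sum>j<n. \<Sum>J\<in>tuples n m. (if i = j then T J else 0) * T' (i # j # J))"
    by (simp add: ip_def sum_tuples_Suc head_cup_def)
  also have "\<dots> = (\<Sum>i<n. \<Sum>j<n. if j = i then \<Sum>J\<in>tuples n m. T J * T' (i # i # J) else 0)"
    by (intro sum.cong) auto
  also have "\<dots> = (\<Sum>i<n. \<Sum>J\<in>tuples n m. T J * T' (i # i # J))"
    by simp
  finally show ?thesis
    by (simp add: ip_def head_cap_def sum_distrib_left sum.swap[of _ "{..<n}"])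
qed

lemma ip_head_proj:
  "ip n (Suc (Suc m)) (head_proj n e T) T' = ip n (Suc (Suc m)) T (head_proj n e T')"
proof -
  have "ip n (Suc (Suc m)) (head_proj n e T) T' =
     (\<Sum>k<n. ip n m (contract n (e k) (contract n (e k) T)) (contract n (e k) (contract n (e k) T')))"
    for T T' by (simp add: head_proj_def ip_sum_left ip_outer)
  then show ?thesis by (subst (2) ip_sym) (simp add: ip_sym)
qed

lemma ip_cup:
  assumes "p \<le> m" "T \<in> tensors n m" "T' \<in> tensors n (Suc (Suc m))"
  shows "ip n (Suc (Suc m)) (cup n p T) T' = ip n m T (cap n p T')"
  using assms
proof (induction m arbitrary: T T' rule: nat_induct_at_least)
  case base
  then show ?case by (simp add: cup_head cap_head ip_head_cup)
next
  case (Suc m)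
  then show ?case
    by (simp add: ip_Suc[of n "Suc (Suc m)"] ip_Suc[of n m] slice_cup[of _ n m] slice_cap[of _ n m] slice_tensors)
qed

section \<open>Self-adjointness and Temperley-Lieb relations of the local projections\<close>

context unbiased_bases
begin

lemma ip_proj:
  assumes "Suc (Suc p) \<le> m" "T \<in> tensors n m" "T' \<in> tensors n m"
  shows "ip n m (proj n e p T) T' = ip n m T (proj n e p T')"
  using assms
proof (induction m arbitrary: T T' rule: nat_induct_at_least)
  case base
  then show ?case by (simp add: proj_head ip_head_proj)
next
  case (Suc m)
  then show ?case by (simp add: ip_Suc[of n m] slice_proj[of _ m] slice_tensors)
qed

lemma head_proj_idem: "head_proj n (E c) (head_proj n (E c) T) = head_proj n (E c) T"
proof
  show "head_proj n (E c) (head_proj n (E c) T) I = head_proj n (E c) T I" for I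
    unfolding head_proj_def[of n "E c" "head_proj n (E c) T"]
    by (simp add: contract_head_proj contract_outer_E) (simp add: head_proj_def)
qed

text \<open>By completeness the sum of all e_k tensor e_k is the same vector for every orthonormal
  basis. Cups and caps are therefore shared by the two bases.\<close>

lemma sum_outer_outer:
  assumes "T \<in> tensors n m"
  shows "(\<lambda>I. \<Sum>k<n. outer (E c k) (outer (E c k) T) I) = head_cup n T"
proof
  fix I
  show "(\<Sum>k<n. outer (E c k) (outer (E c k) T) I) = head_cup n T I"
  proof (cases "\<exists>i j J. I = i # j # J")
    case True
    then obtain i j J where I: "I = i # j # J" by blast
    have "(\<Sum>k<n. outer (E c k) (outer (E c k) T) I) = (\<Sum>k<n. E c k i * E c k j) * T J"
      by (simp add: I outer_def sum_distrib_right mult.assoc)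
    then show ?thesis
      by (cases "i < n \<and> j < n") (auto simp: I head_cup_def compl supp not_less)
  next
    case False
    then show ?thesis
      by (auto simp: outer_def head_cup_def split: list.splits)
  qed
qed

lemma sum_contract_contract:
  "(\<lambda>I. \<Sum>k<n. contract n (E c k) (contract n (E c k) T) I) = head_cap n T"
proof
  fix J
  have "(\<Sum>k<n. contract n (E c k) (contract n (E c k) T) J) =
    (\<Sum>k<n. \<Sum>a<n. \<Sum>b<n. E c k a * E c k b * T (b # a # J))"
    by (simp add: contract_def sum_distrib_left mult_ac)
  also have "\<dots> = (\<Sum>a<n. \<Sum>k<n. \<Sum>b<n. E c k a * E c k b * T (b # a # J))"
    by (rule sum.swap)
  also have "\<dots> = (\<Sum>a<n. \<Sum>b<n. \<Sum>k<n. E c k a * E c k b * T (b # a # J))"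
    by (rule sum.cong[OF refl]) (rule sum.swap)
  also have "\<dots> = (\<Sum>a<n. \<Sum>b<n. of_bool (a = b) * T (b # a # J))"
    by (simp add: sum_distrib_right[symmetric] compl)
  also have "\<dots> = head_cap n T J"
    by (simp add: head_cap_def sum_delta_scale)
  finally show "(\<Sum>k<n. contract n (E c k) (contract n (E c k) T) J) = head_cap n T J" .
qed

text \<open>Every e_k tensor e_k has the same inner product 1/n with every e'_l tensor e'_l. The
  product of the two projections thus factors through the sums over k and over l, which are the cup
  and the cap.\<close>

lemma head_proj_cross:
  assumes "T \<in> tensors n (Suc (Suc m))"
  shows "head_proj n (E c) (head_proj n (E (\<not> c)) T) = (\<lambda>I. inverse (real n) * head_cup n (head_cap n T) I)"
proof -
  let ?e = "E (\<not> c)"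
  have "contract n (E c k) (contract n (E c k) (head_proj n ?e T)) =
      (\<lambda>I. inverse (real n) * head_cap n T I)" if "k < n" for k
  proof -
    have "contract n (E c k) (contract n (E c k)
        (outer (?e l) (outer (?e l) (contract n (?e l) (contract n (?e l) T))))) I
      = inverse (real n) * contract n (?e l) (contract n (?e l) T) I" if "l < n" for l I
      using unbiased[OF \<open>k < n\<close> that, of c]
      by (simp add: contract_outer contract_scale mult.assoc[symmetric] power2_eq_square)
    then show ?thesis
      unfolding head_proj_def contract_sum sum_contract_contract[of "\<not> c" T, symmetric]
      by (simp add: sum_distrib_left)
  qed
  then show ?thesis
    unfolding head_proj_def[of n "E c" "head_proj n _ _"]
    unfolding sum_outer_outer[OF head_cap_tensors[OF assms], of c, symmetric]
    by (simp add: outer_scale sum_distrib_left)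
qed

text \<open>Either order forces the same basis vector on all three legs, so both products equal the
  projection onto the span of the e_k tensor e_k tensor e_k.\<close>

lemma head_proj_comm:
  assumes "T \<in> tensors n (Suc (Suc (Suc p)))"
  shows "head_proj n (E c) (proj n (E c) p T) = proj n (E c) p (head_proj n (E c) T)"
proof -
  have cT: "contract n v T \<in> tensors n (Suc (Suc p))" for v
    using assms by (rule contract_tensors)
  have "head_proj n (E c) (proj n (E c) p T) I =
     (\<Sum>k<n. outer (E c k) (outer (E c k) (outer (E c k) (contract n (E c k) (contract n (E c k) (contract n (E c k) T))))) I)" for I
    unfolding head_proj_def
    by (simp add: contract_proj[OF assms] proj_head[OF cT] contract_head_proj)
  moreover have "proj n (E c) p (head_proj n (E c) T) I =
     (\<Sum>k<n. outer (E c k) (outer (E c k) (outer (E c k) (contract n (E c k) (contract n (E c k) (contract n (E c k) T))))) I)" for I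
  proof -
    have 1: "outer (E c k) (contract n (E c k) (contract n (E c k) T)) \<in> tensors n (Suc (Suc p))" for k
      using contract_tensors[OF cT] supp by (intro outer_tensors) auto
    show ?thesis
      unfolding head_proj_def proj_sum
      by (rule sum.cong[OF refl]) (simp add: proj_outer[OF 1] supp proj_head[OF 1] head_proj_outer)
  qed
  ultimately show ?thesis by (simp add: fun_eq_iff)
qed

text \<open>The outer projection puts e_k on the middle leg before and after the inner one acts, and
  that compression is the scalar 1/n by \<open>contract_head_proj_outer\<close>.\<close>

lemma head_proj_braid:
  assumes "T \<in> tensors n (Suc (Suc (Suc p)))"
  shows "head_proj n (E c) (proj n (E (\<not> c)) p (head_proj n (E c) T)) =
     (\<lambda>I. inverse (real n) * head_proj n (E c) T I)"
proof -
  have hT: "head_proj n (E c) T \<in> tensors n (Suc (Suc (Suc p)))"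
    using assms by (rule head_proj_tensors)
  have "contract n (E c k) (contract n (E c k) (proj n (E (\<not> c)) p (head_proj n (E c) T))) =
    (\<lambda>I. inverse (real n) * contract n (E c k) (contract n (E c k) T) I)" if "k < n" for k
  proof -
    have 1: "contract n (E c k) (contract n (E c k) T) \<in> tensors n (Suc p)"
      using assms by (intro contract_tensors)
    then have 2: "outer (E c k) (contract n (E c k) (contract n (E c k) T)) \<in> tensors n (Suc (Suc p))"
      by (intro outer_tensors) (auto simp: supp)
    show ?thesis
      by (simp add: contract_proj[OF hT] contract_head_proj that proj_head[OF 2] contract_head_proj_outer[OF 1])
  qed
  then show ?thesis
    unfolding head_proj_def[of n "E c" "proj _ _ _ _"]
    by (simp add: outer_scale sum_distrib_left[symmetric] head_proj_def[of n "E c" T])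
qed

text \<open>Induction on the number of legs: the base case has the pair at the head, and each
  further leg on the left is sliced off. \<open>proj_cross\<close>, \<open>proj_comm_adj\<close>,
  \<open>proj_braid_up\<close> and \<open>proj_comm_far\<close> are lifted in the same way.\<close>

lemma proj_idem:
  assumes "Suc (Suc p) \<le> m" "T \<in> tensors n m"
  shows "proj n (E c) p (proj n (E c) p T) = proj n (E c) p T"
  using assms
proof (induction m arbitrary: T rule: nat_induct_at_least)
  case base
  then show ?case by (simp add: proj_head head_proj_idem head_proj_tensors)
next
  case (Suc m)
  show ?case
    by (rule tensors_eqI[of _ n m])
      (use Suc in \<open>simp_all add: proj_tensors slice_proj[of _ m] slice_tensors\<close>)
qed

lemma proj_cross:
  assumes "p \<le> m" "T \<in> tensors n (Suc (Suc m))"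
  shows "proj n (E c) p (proj n (E (\<not> c)) p T) = (\<lambda>I. inverse (real n) * cup n p (cap n p T) I)"
  using assms
proof (induction m arbitrary: T rule: nat_induct_at_least)
  case base
  then show ?case
    by (simp add: proj_head cap_head cup_head[OF head_cap_tensors] head_proj_cross head_proj_tensors)
next
  case (Suc m)
  show ?case
    by (rule tensors_eqI[of _ n "Suc (Suc m)"])
      (use Suc in \<open>simp_all add: proj_tensors slice_proj[of _ "Suc (Suc m)"] slice_tensors
        slice_cup[of _ n m] slice_cap[of _ n m] slice_scale scale_tensors cup_tensors cap_tensors\<close>)
qed

text \<open>Both orders equal 1/n times a cap followed by a cup, an expression in which
  \<open>c\<close> does not occur.\<close>

lemma proj_comm_cross:
  assumes "Suc (Suc p) \<le> m" "T \<in> tensors n m"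
  shows "proj n (E c) p (proj n (E (\<not> c)) p T) = proj n (E (\<not> c)) p (proj n (E c) p T)"
proof -
  obtain m' where "m = Suc (Suc m')" "p \<le> m'" using assms(1) by (metis Suc_le_D Suc_le_mono)
  then show ?thesis using proj_cross[of p m' T c] proj_cross[of p m' T "\<not> c"] assms(2) by simp
qed

lemma proj_comm_adj:
  assumes "Suc (Suc (Suc p)) \<le> m" "T \<in> tensors n m"
  shows "proj n (E c) (Suc p) (proj n (E c) p T) = proj n (E c) p (proj n (E c) (Suc p) T)"
  using assms
proof (induction m arbitrary: T rule: nat_induct_at_least)
  case base
  then show ?case by (simp add: proj_head[of _ "Suc p"] proj_tensors head_proj_comm)
next
  case (Suc m)
  show ?case
    by (rule tensors_eqI[of _ n m])
      (use Suc in \<open>simp_all add: proj_tensors slice_proj[of _ m] slice_tensors\<close>)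
qed

lemma proj_braid_up:
  assumes "Suc (Suc (Suc p)) \<le> m" "T \<in> tensors n m"
  shows "proj n (E c) (Suc p) (proj n (E (\<not> c)) p (proj n (E c) (Suc p) T)) =
    (\<lambda>I. inverse (real n) * proj n (E c) (Suc p) T I)"
  using assms
proof (induction m arbitrary: T rule: nat_induct_at_least)
  case base
  then show ?case
    by (simp add: proj_head[of _ "Suc p"] head_proj_tensors proj_tensors head_proj_braid)
next
  case (Suc m)
  show ?case
    by (rule tensors_eqI[of _ n m])
      (use Suc in \<open>simp_all add: proj_tensors slice_proj[of _ m] slice_tensors slice_scale scale_tensors\<close>)
qed

lemma proj_comm_far:
  assumes "Suc (Suc q) \<le> m" "Suc (Suc p) \<le> q" "T \<in> tensors n m"
  shows "proj n (E c) q (proj n (E d) p T) = proj n (E d) p (proj n (E c) q T)"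
  using assms(1,3)
proof (induction m arbitrary: T rule: nat_induct_at_least)
  case base
  let ?c = "\<lambda>k. contract n (E c k) (contract n (E c k) T)"
  have cT: "contract n v T \<in> tensors n (Suc q)" for v using base by (rule contract_tensors)
  have 1: "?c k \<in> tensors n q" for k by (intro contract_tensors cT)
  have 2: "outer (E c k) (?c k) \<in> tensors n (Suc q)" for k
    using 1 by (intro outer_tensors) (auto simp: supp)
  have q: "Suc q \<noteq> Suc p" "q \<noteq> Suc p" using assms by auto
  show ?case
    unfolding proj_head[OF base] proj_head[OF proj_tensors[OF base]] head_proj_def proj_sum
    by (intro ext sum.cong refl)
      (simp add: contract_proj[OF base q(1)] contract_proj[OF cT q(2)] proj_outer[OF 2 q(1)]
        proj_outer[OF 1 q(2)] supp)
next
  case (Suc m)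
  show ?case
    by (rule tensors_eqI[of _ n m])
      (use Suc assms(2) in \<open>simp_all add: proj_tensors slice_proj[of _ m] slice_tensors\<close>)
qed

end

section \<open>Temperley--Lieb words and the Markov trace\<close>

text \<open>The last letter acts first, so concatenation of words is composition of
  operators.\<close>

definition ev :: "nat \<Rightarrow> bases \<Rightarrow> (bool \<times> nat) list \<Rightarrow> tensor \<Rightarrow> tensor" where
  "ev n E w T = foldr (\<lambda>(c, p). proj n (E c) p) w T"

definition fits :: "nat \<Rightarrow> (bool \<times> nat) list \<Rightarrow> bool" where
  "fits m w \<longleftrightarrow> (\<forall>x\<in>set w. Suc (Suc (snd x)) \<le> m)"

text \<open>The scalar is the same for all pairs of unbiased bases; this uniformity is what makes the trace
  of a word universal.\<close>

definition weq :: "nat \<Rightarrow> nat \<Rightarrow> real \<Rightarrow> (bool \<times> nat) list \<Rightarrow> (bool \<times> nat) list \<Rightarrow> bool" where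
  "weq n m s w w' \<longleftrightarrow> (\<forall>E. unbiased_bases n E \<longrightarrow>
     (\<forall>T\<in>tensors n m. ev n E w T = (\<lambda>I. s * ev n E w' T I)))"

lemma fits_simps [simp]:
  "fits m []" "fits m (x # w) \<longleftrightarrow> Suc (Suc (snd x)) \<le> m \<and> fits m w"
  "fits m (u @ v) \<longleftrightarrow> fits m u \<and> fits m v"
  by (auto simp: fits_def)

lemma ev_simps [simp]:
  "ev n E [] T = T" "ev n E ((c, p) # w) T = proj n (E c) p (ev n E w T)"
  "ev n E (u @ v) T = ev n E u (ev n E v T)"
  by (simp_all add: ev_def)

lemma ev_scale: "ev n E w (\<lambda>I. c * T I) = (\<lambda>I. c * ev n E w T I)"
  by (induction w) (auto simp: proj_scale)

lemma ev_sum: "ev n E w (\<lambda>I. \<Sum>k\<in>A. T k I) = (\<lambda>I. \<Sum>k\<in>A. ev n E w (T k) I)"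
  by (induction w) (auto simp: proj_sum)

lemma (in unbiased_bases) ev_tensors: "T \<in> tensors n m \<Longrightarrow> ev n E w T \<in> tensors n m"
  by (induction w) (auto simp: proj_tensors)

lemma weq_refl: "weq n m 1 w w"
  by (simp add: weq_def)

lemma weq_trans: "weq n m s u v \<Longrightarrow> weq n m t v w \<Longrightarrow> weq n m (s * t) u w"
  by (simp add: weq_def mult.assoc)

lemma weq_trans1: "weq n m 1 u v \<Longrightarrow> weq n m t v w \<Longrightarrow> weq n m t u w"
  using weq_trans[of n m 1] by simp

lemma weq_context: "weq n m s w w' \<Longrightarrow> weq n m s (u @ w @ v) (u @ w' @ v)"
  unfolding weq_def by (auto simp: ev_scale unbiased_bases.ev_tensors)

lemma weq_append: "weq n m s u u' \<Longrightarrow> weq n m t v v' \<Longrightarrow> weq n m (s * t) (u @ v) (u' @ v')"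
  unfolding weq_def by (auto simp: ev_scale unbiased_bases.ev_tensors mult.assoc)

text \<open>A letter \<open>(c, p)\<close> stands for the projection of basis \<open>c\<close> at position \<open>p\<close>. On neighbouring positions equal
  bases commute and different bases satisfy the Temperley--Lieb relation, so the bases alternate
  along each of the two commuting Temperley--Lieb algebras.\<close>

definition tl_class :: "bool \<times> nat \<Rightarrow> bool" where
  "tl_class x \<longleftrightarrow> (even (snd x) = fst x)"

lemma weq_idem: "Suc (Suc (snd x)) \<le> m \<Longrightarrow> weq n m 1 [x, x] [x]"
  by (cases x) (auto simp: weq_def unbiased_bases.proj_idem)

lemma weq_commute:
  assumes "Suc (Suc (snd x)) \<le> m" "Suc (Suc (snd y)) \<le> m"
    and "tl_class x \<noteq> tl_class y \<or> Suc (snd x) < snd y \<or> Suc (snd y) < snd x"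
  shows "weq n m 1 [x, y] [y, x]"
proof -
  obtain c p d q where xy: "x = (c, p)" "y = (d, q)" by (cases x, cases y)
  \<comment> \<open>For letters of different classes, equal positions force different bases and
    neighbouring positions force equal bases.\<close>
  consider "p = q" "d = (\<not> c)" | "q = Suc p" "d = c" | "p = Suc q" "d = c"
    | "Suc (Suc p) \<le> q" | "Suc (Suc q) \<le> p"
  proof -
    assume a: "p = q \<Longrightarrow> d = (\<not> c) \<Longrightarrow> thesis" "q = Suc p \<Longrightarrow> d = c \<Longrightarrow> thesis"
      "p = Suc q \<Longrightarrow> d = c \<Longrightarrow> thesis" "Suc (Suc p) \<le> q \<Longrightarrow> thesis" "Suc (Suc q) \<le> p \<Longrightarrow> thesis"
    consider "p = q" | "q = Suc p" | "p = Suc q" | "Suc (Suc p) \<le> q" | "Suc (Suc q) \<le> p" by linarith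
    then show thesis
      using a assms(3) by cases (auto simp: xy tl_class_def)
  qed
  then show ?thesis
  proof cases
    case 1
    then show ?thesis using assms
      by (auto simp: xy weq_def intro: unbiased_bases.proj_comm_cross)
  next
    case 2
    then show ?thesis using assms
      by (auto simp: xy weq_def unbiased_bases.proj_comm_adj)
  next
    case 3
    then show ?thesis using assms
      by (auto simp: xy weq_def unbiased_bases.proj_comm_adj)
  next
    case 4
    then show ?thesis using assms
      by (auto simp: xy weq_def unbiased_bases.proj_comm_far[where q=q and p=p])
  next
    case 5
    then show ?thesis using assms
      by (auto simp: xy weq_def unbiased_bases.proj_comm_far[where q=p and p=q])
  qed
qed

lemma weq_commute_word:
  assumes "Suc (Suc (snd x)) \<le> m" "fits m w"
    and "\<And>y. y \<in> set w \<Longrightarrow> tl_class x \<noteq> tl_class y \<or> Suc (snd x) < snd y \<or> Suc (snd y) < snd x"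
  shows "weq n m 1 (x # w) (w @ [x])"
  using assms(2,3)
proof (induction w)
  case Nil
  then show ?case by (simp add: weq_refl)
next
  case (Cons y w)
  have "weq n m 1 (x # y # w) (y # x # w)"
    using weq_context[OF weq_commute[of x m y], of n "[]" w] assms(1) Cons.prems by simp
  moreover have "weq n m 1 (y # x # w) (y # w @ [x])"
    using weq_context[of n m 1 "x # w" "w @ [x]" "[y]" "[]"] Cons by simp
  ultimately show ?case using weq_trans1 by fastforce
qed

text \<open>Letters of different classes commute at all positions, so a word is a product of one
  element from each of the two Temperley-Lieb algebras.\<close>

lemma weq_sort:
  assumes "fits m w"
  shows "weq n m 1 w (filter tl_class w @ filter (\<lambda>x. \<not> tl_class x) w)"
  using assms
proof (induction w)
  case Nil
  then show ?case by (simp add: weq_refl)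
next
  case (Cons x w)
  let ?a = "filter tl_class w" and ?b = "filter (\<lambda>x. \<not> tl_class x) w"
  have 1: "weq n m 1 (x # w) (x # ?a @ ?b)"
    using weq_context[of n m 1 w "?a @ ?b" "[x]" "[]"] Cons by simp
  show ?case
  proof (cases "tl_class x")
    case True
    then show ?thesis using 1 by simp
  next
    case False
    have "weq n m 1 (x # ?a) (?a @ [x])"
      using Cons.prems False by (intro weq_commute_word) (auto simp: fits_def)
    then have "weq n m 1 (x # ?a @ ?b) (?a @ x # ?b)"
      using weq_context[of n m 1 "x # ?a" "?a @ [x]" "[]" ?b] by simp
    then show ?thesis using weq_trans1[OF 1] False by simp
  qed
qed

text \<open>Within a class the basis alternates with the parity of the position. The position alone
  determines the letter, and words of one class become lists of numbers.\<close>

definition tl_letter :: "bool \<Rightarrow> nat \<Rightarrow> bool \<times> nat" where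
  "tl_letter d p = (even p = d, p)"

lemma snd_tl_letter [simp]: "snd (tl_letter d p) = p"
  by (simp add: tl_letter_def)

lemma tl_class_letter [simp]: "tl_class (tl_letter d p) = d"
  by (auto simp: tl_class_def tl_letter_def)

lemma letter_eq: "tl_class x = d \<Longrightarrow> x = tl_letter d (snd x)"
  by (cases x) (auto simp: tl_class_def tl_letter_def)

lemma weq_braid:
  assumes "Suc (Suc (Suc p)) \<le> m"
  shows "weq n m (inverse (real n)) [tl_letter d (Suc p), tl_letter d p, tl_letter d (Suc p)] [tl_letter d (Suc p)]"
proof -
  have e: "(even p = d) = (\<not> (even (Suc p) = d))" by auto
  show ?thesis
    using assms by (auto simp only: weq_def tl_letter_def e ev_simps unbiased_bases.proj_braid_up)
qed

text \<open>This is Jones' reduction in a Temperley-Lieb algebra: up to a scalar the highest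
  generator occurs at most once. The outer induction is on the highest position, the inner one on
  the number of its occurrences.\<close>

lemma tl_reduce:
  assumes "Suc (Suc K) \<le> m" "set w \<subseteq> {..K}"
  shows "\<exists>s w'. weq n m s (map (tl_letter d) w) (map (tl_letter d) w') \<and> set w' \<subseteq> {..K} \<and> count_list w' K \<le> 1"
  using assms
proof (induction K arbitrary: w)
  case (0 w)
  have "\<exists>s w'. weq n m s (map (tl_letter d) w) (map (tl_letter d) w') \<and> set w' \<subseteq> {0} \<and> length w' \<le> 1"
    using 0(2)
  proof (induction w)
    case Nil
    then show ?case using weq_refl[of n m "[]"] by (intro exI[of _ 1] exI[of _ "[]"]) auto
  next
    case (Cons x w)
    then obtain s w' where w': "weq n m s (map (tl_letter d) w) (map (tl_letter d) w')"
      "set w' \<subseteq> {0}" "length w' \<le> 1" by auto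
    have x: "x = 0" using Cons by auto
    have 1: "weq n m s (map (tl_letter d) (x # w)) (map (tl_letter d) (0 # w'))"
      using weq_context[OF w'(1), of "[tl_letter d 0]" "[]"] by (simp add: x)
    show ?case
    proof (cases w')
      case Nil
      then show ?thesis using 1 by (intro exI[of _ s] exI[of _ "[0]"]) auto
    next
      case (Cons y w'')
      then have "w' = [0]" using w' by (cases w'') auto
      then have "weq n m (s * 1) (map (tl_letter d) (x # w)) (map (tl_letter d) w')"
        using weq_trans[OF 1, of 1 "[tl_letter d 0]"] weq_idem[of "tl_letter d 0" m n] 0(1) by simp
      then show ?thesis using w' by blast
    qed
  qed
  then obtain s w' where "weq n m s (map (tl_letter d) w) (map (tl_letter d) w')" "set w' \<subseteq> {0}" "length w' \<le> 1"
    by blast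
  moreover have "count_list w' 0 \<le> length w'" by (rule count_le_length)
  ultimately show ?case by (intro exI[of _ s] exI[of _ w']) auto
next
  case (Suc K w)
  let ?L = "map (tl_letter d)" and ?k = "tl_letter d (Suc K)"
  show ?case using Suc.prems(2)
  proof (induction "count_list w (Suc K)" arbitrary: w rule: less_induct)
    case less
    show ?case
    proof (cases "count_list w (Suc K) \<le> 1")
      case True
      then show ?thesis using less.prems weq_refl by blast
    next
      case False
      then have "Suc K \<in> set w" using count_notin by fastforce
      then obtain u w1 where w1: "w = u @ Suc K # w1" "Suc K \<notin> set u" by (meson split_list_first)
      then have "Suc K \<in> set w1" using False count_notin by fastforce
      then obtain v z where v: "w1 = v @ Suc K # z" "Suc K \<notin> set v" by (meson split_list_first)
      \<comment> \<open>The factor \<open>v\<close> between the first two occurrences of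
        \<open>Suc K\<close> lies in the smaller algebra, so the outer induction leaves at most one
        \<open>K\<close> in it.\<close>
      have w: "w = u @ (Suc K # v @ [Suc K]) @ z" using w1 v by simp
      have vK: "set v \<subseteq> {..K}" using less.prems v(2) unfolding w by (auto simp: le_Suc_eq)
      obtain s v' where v': "weq n m s (?L v) (?L v')" "set v' \<subseteq> {..K}" "count_list v' K \<le> 1"
        using Suc.IH[OF _ vK] Suc.prems(1) by auto
      have s1: "weq n m s (?L (Suc K # v @ [Suc K])) (?L (Suc K # v' @ [Suc K]))"
        using weq_context[OF v'(1), of "[?k]" "[?k]"] by simp
      have comm: "weq n m 1 (?k # ?L x) (?L x @ [?k])" if "set x \<subseteq> {..<K}" for x
        using that Suc.prems(1) by (intro weq_commute_word) (auto simp: fits_def)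
      obtain t y where y: "weq n m t (?L (Suc K # v' @ [Suc K])) (?L y)"
        "set y \<subseteq> {..Suc K}" "count_list y (Suc K) \<le> 1"
      \<comment> \<open>Without \<open>K\<close> the two copies of \<open>Suc K\<close> meet by
        commutation and merge by idempotence. With a single \<open>K\<close> they close in on it,
        and \<open>weq_braid\<close> absorbs it together with one copy, at the cost of 1/n.\<close>
      proof (cases "K \<in> set v'")
        case False
        then have 1: "set v' \<subseteq> {..<K}" using v'(2) by (auto simp: le_less)
        have "weq n m 1 (?L (Suc K # v' @ [Suc K])) (?L (v' @ [Suc K, Suc K]))"
          using weq_context[OF comm[OF 1], of "[]" "[?k]"] by simp
        moreover have "weq n m 1 (?L (v' @ [Suc K, Suc K])) (?L (v' @ [Suc K]))"
          using weq_context[OF weq_idem[of ?k m n], of "?L v'" "[]"] Suc.prems(1) by simp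
        ultimately have "weq n m 1 (?L (Suc K # v' @ [Suc K])) (?L (v' @ [Suc K]))"
          by (rule weq_trans1)
        moreover have "count_list v' (Suc K) = 0" using 1 by (intro count_notin) auto
        ultimately show ?thesis using 1 by (intro that[of 1 "v' @ [Suc K]"]) (auto simp: less_imp_le)
      next
        case True
        then obtain v1 v2 where v12: "v' = v1 @ K # v2" "K \<notin> set v1" by (meson split_list_first)
        then have "count_list v2 K = 0" using v'(3) by simp
        then have "K \<notin> set v2" by (simp add: count_list_0_iff)
        then have 1: "set v1 \<subseteq> {..<K}" "set v2 \<subseteq> {..<K}" using v'(2) v12 by (auto simp: le_less)
        have 11: "weq n m 1 (?L (Suc K # v' @ [Suc K])) (?L (v1 @ Suc K # K # v2 @ [Suc K]))"
          using weq_context[OF comm[OF 1(1)], of "[]" "tl_letter d K # ?L v2 @ [?k]"] by (simp add: v12)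
        have 12: "weq n m 1 (?L (v1 @ Suc K # K # Suc K # v2)) (?L (v1 @ Suc K # K # v2 @ [Suc K]))"
          using weq_context[OF comm[OF 1(2)], of "?L v1 @ [?k, tl_letter d K]" "[]"] by simp
        have 13: "weq n m (inverse (real n)) (?L (v1 @ Suc K # K # Suc K # v2)) (?L (v1 @ Suc K # v2))"
          using weq_context[OF weq_braid[of K m n d], of "?L v1" "?L v2"] Suc.prems(1) by simp
        have "weq n m (inverse (real n)) (?L (v1 @ Suc K # K # v2 @ [Suc K])) (?L (v1 @ Suc K # v2))"
          using 12 13 by (simp add: weq_def)
        then have "weq n m (inverse (real n)) (?L (Suc K # v' @ [Suc K])) (?L (v1 @ Suc K # v2))"
          using weq_trans1[OF 11] by blast
        moreover have "count_list v1 (Suc K) = 0" "count_list v2 (Suc K) = 0"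
          using 1 by (auto intro!: count_notin)
        ultimately show ?thesis
          using 1 by (intro that[of "inverse (real n)" "v1 @ Suc K # v2"]) (auto simp: less_imp_le)
      qed
      have s2: "weq n m (s * t) (?L w) (?L (u @ y @ z))"
        using weq_context[OF weq_trans[OF s1 y(1)], of "?L u" "?L z"] by (simp add: w)
      have "count_list (u @ y @ z) (Suc K) < count_list w (Suc K)"
        using y(3) by (simp add: w)
      moreover have "set (u @ y @ z) \<subseteq> {..Suc K}" using y(2) less.prems by (auto simp: w)
      ultimately obtain s' w' where "weq n m s' (?L (u @ y @ z)) (?L w')" "set w' \<subseteq> {..Suc K}"
        "count_list w' (Suc K) \<le> 1" using less.hyps by blast
      then show ?thesis using weq_trans[OF s2] by blast
    qed
  qed
qed

section \<open>The Markov property of the matrix trace\<close>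

definition op_trace :: "nat \<Rightarrow> nat \<Rightarrow> (tensor \<Rightarrow> tensor) \<Rightarrow> real" where
  "op_trace n m S = (\<Sum>I\<in>tuples n m. S (\<lambda>J. of_bool (J = I)) I)"

lemma delta_tensors: "I \<in> tuples n m \<Longrightarrow> (\<lambda>J. of_bool (J = I)) \<in> tensors n m"
  by (auto simp: tensors_def)

lemma op_trace_weq:
  "unbiased_bases n E \<Longrightarrow> weq n m s w w' \<Longrightarrow> op_trace n m (ev n E w) = s * op_trace n m (ev n E w')"
  by (simp add: op_trace_def weq_def delta_tensors sum_distrib_left)

context unbiased_bases
begin

lemma slice_ev: "T \<in> tensors n (Suc m) \<Longrightarrow> fits m u \<Longrightarrow> slice i (ev n E u T) = ev n E u (slice i T)"
proof (induction u)
  case (Cons x u)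
  then show ?case by (cases x) (auto simp: slice_proj[of _ m] ev_tensors)
qed simp

lemma ev_outer:
  "T \<in> tensors n m \<Longrightarrow> fits m u \<Longrightarrow> (\<And>i. i \<ge> n \<Longrightarrow> v i = 0) \<Longrightarrow>
    ev n E u (outer v T) = outer v (ev n E u T)"
proof (induction u)
  case (Cons x u)
  then show ?case by (cases x) (auto simp: proj_outer[of _ m] ev_tensors)
qed simp

text \<open>\<open>u\<close> and \<open>v\<close> do not touch the first leg, so the trace over that
  leg can be taken of \<open>w\<close> alone. If this partial trace is a scalar \<open>c\<close>,
  one leg disappears. The next three lemmas supply the scalars n, 1 and 1/n.\<close>

lemma op_trace_markov:
  assumes "fits m u" "fits m v"
    and S: "\<And>T. T \<in> tensors n (Suc m) \<Longrightarrow> ev n E w T = S T"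
    and ptr: "\<And>T. T \<in> tensors n m \<Longrightarrow>
      (\<lambda>J. \<Sum>i<n. slice i (S (outer (\<lambda>a. of_bool (a = i)) T)) J) = (\<lambda>J. c * T J)"
  shows "op_trace n (Suc m) (ev n E (u @ w @ v)) = c * op_trace n m (ev n E (u @ v))"
proof -
  have "ev n E (u @ w @ v) (\<lambda>J. of_bool (J = i # I)) (i # I) =
    ev n E u (slice i (S (outer (\<lambda>a. of_bool (a = i)) (ev n E v (\<lambda>J. of_bool (J = I)))))) I"
    if "i < n" "I \<in> tuples n m" for i I
  proof -
    have e: "(\<lambda>J. of_bool (J = i # I)) = outer (\<lambda>a. of_bool (a = i)) (\<lambda>J. of_bool (J = I))"
      by (auto simp: outer_def fun_eq_iff split: list.splits)
    have o: "outer (\<lambda>a. of_bool (a = i)) (ev n E v (\<lambda>J. of_bool (J = I))) \<in> tensors n (Suc m)"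
      using that by (intro outer_tensors ev_tensors delta_tensors) auto
    have "ev n E (u @ w @ v) (\<lambda>J. of_bool (J = i # I)) (i # I) =
       slice i (ev n E u (ev n E w (outer (\<lambda>a. of_bool (a = i)) (ev n E v (\<lambda>J. of_bool (J = I)))))) I"
      unfolding e using that assms(2) by (simp add: ev_outer[of _ m] delta_tensors slice_def)
    also have "\<dots> = ev n E u (slice i (ev n E w (outer (\<lambda>a. of_bool (a = i)) (ev n E v (\<lambda>J. of_bool (J = I)))))) I"
      by (subst slice_ev[of _ m]) (use o assms(1) in \<open>auto intro: ev_tensors\<close>)
    finally show ?thesis using S[OF o] by simp
  qed
  then have "op_trace n (Suc m) (ev n E (u @ w @ v)) = (\<Sum>i<n. \<Sum>I\<in>tuples n m.
     ev n E u (slice i (S (outer (\<lambda>a. of_bool (a = i)) (ev n E v (\<lambda>J. of_bool (J = I)))))) I)"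
    by (simp add: op_trace_def sum_tuples_Suc)
  also have "\<dots> = (\<Sum>I\<in>tuples n m. \<Sum>i<n.
     ev n E u (slice i (S (outer (\<lambda>a. of_bool (a = i)) (ev n E v (\<lambda>J. of_bool (J = I)))))) I)"
    by (rule sum.swap)
  also have "\<dots> = (\<Sum>I\<in>tuples n m. ev n E u (\<lambda>J. \<Sum>i<n.
     slice i (S (outer (\<lambda>a. of_bool (a = i)) (ev n E v (\<lambda>J. of_bool (J = I))))) J) I)"
    by (simp add: ev_sum)
  also have "\<dots> = (\<Sum>I\<in>tuples n m. c * ev n E (u @ v) (\<lambda>J. of_bool (J = I)) I)"
    by (intro sum.cong refl) (simp add: ptr ev_tensors delta_tensors ev_scale)
  finally show ?thesis by (simp add: op_trace_def sum_distrib_left)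
qed

lemma op_trace_markov_id:
  assumes "fits m w"
  shows "op_trace n (Suc m) (ev n E w) = real n * op_trace n m (ev n E w)"
  using op_trace_markov[of m w "[]" "[]" "\<lambda>T. T" "real n"] assms
  by (simp add: slice_outer)

text \<open>Tracing out the first leg leaves the sum of |e_k|^2 times the projection onto e_k, which
  is the identity.\<close>

lemma op_trace_markov_proj:
  assumes "fits (Suc p) u" "fits (Suc p) v"
  shows "op_trace n (Suc (Suc p)) (ev n E (u @ [(c, p)] @ v)) = op_trace n (Suc p) (ev n E (u @ v))"
proof -
  have "(\<Sum>i<n. slice i (head_proj n (E c) (outer (\<lambda>a. of_bool (a = i)) T)) J) = T J"
    if T: "T \<in> tensors n (Suc p)" for T J
  proof -
    have 1: "contract n (E c k) (outer (\<lambda>a. of_bool (a = i)) T) = (\<lambda>I. E c k i * T I)" if "i < n" for k i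
      using that by (simp add: contract_outer mult.commute[of "E c k _"] sum_delta_scale)
    have "(\<Sum>i<n. slice i (head_proj n (E c) (outer (\<lambda>a. of_bool (a = i)) T)) J) =
       (\<Sum>i<n. \<Sum>k<n. E c k i * E c k i * outer (E c k) (contract n (E c k) T) J)"
      by (simp add: head_proj_def slice_sum slice_outer slice_scale 1 contract_scale outer_scale mult.assoc)
    also have "\<dots> = (\<Sum>k<n. (\<Sum>i<n. E c k i * E c k i) * outer (E c k) (contract n (E c k) T) J)"
      by (subst sum.swap) (simp add: sum_distrib_right)
    also have "\<dots> = T J"
      using fun_cong[OF resolution[OF T, of c], of J] by (simp add: orth)
    finally show ?thesis .
  qed
  then show ?thesis
    using op_trace_markov[of "Suc p" u v "[(c, p)]" "head_proj n (E c)" 1] assms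
    by (simp add: proj_head)
qed

text \<open>The two letters multiply to 1/n times a cap followed by a cup, whose partial trace is
  1/n times the identity. This covers words in which both Temperley-Lieb algebras contribute their
  highest generator.\<close>

lemma op_trace_markov_cross:
  assumes "fits (Suc p) u" "fits (Suc p) v"
  shows "op_trace n (Suc (Suc p)) (ev n E (u @ [(c, p), (\<not> c, p)] @ v)) =
     inverse (real n) * op_trace n (Suc p) (ev n E (u @ v))"
proof -
  let ?S = "\<lambda>T I. inverse (real n) * head_cup n (head_cap n T) I"
  have "(\<Sum>i<n. slice i (?S (outer (\<lambda>a. of_bool (a = i)) T)) J) = inverse (real n) * T J"
    if T: "T \<in> tensors n (Suc p)" for T J
  proof -
    have 1: "head_cap n (outer (\<lambda>a. of_bool (a = i)) T) = slice i T" if "i < n" for i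
      using that by (simp add: head_cap_def outer_def slice_def sum_delta_scale)
    have "(\<Sum>i<n. slice i (head_cup n (slice i T)) J) = T J"
    proof (cases J)
      case Nil
      then show ?thesis using T by (auto simp: slice_def head_cup_def tensors_def tuples_def)
    next
      case (Cons j J')
      then show ?thesis using T by (auto simp: slice_def head_cup_def tensors_def)
    qed
    then show ?thesis by (simp add: slice_scale 1 sum_distrib_left[symmetric])
  qed
  then show ?thesis
    using op_trace_markov[of "Suc p" u v "[(c, p), (\<not> c, p)]" ?S "inverse (real n)"] assms
    by (simp add: proj_head head_proj_tensors head_proj_cross[of _ p])
qed

end

text \<open>A case distinction for words of one class: after reduction the highest position
  \<open>p\<close> is absent or occurs exactly once.\<close>

lemma tl_reduce_word:
  assumes "fits (Suc (Suc p)) w" "\<And>x. x \<in> set w \<Longrightarrow> tl_class x = d"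
  obtains s u where "weq n (Suc (Suc p)) s w u" "fits (Suc p) u" "\<And>x. x \<in> set u \<Longrightarrow> tl_class x = d"
  | s u v where "weq n (Suc (Suc p)) s w (u @ [tl_letter d p] @ v)" "fits (Suc p) u" "fits (Suc p) v"
    "\<And>x. x \<in> set u \<union> set v \<Longrightarrow> tl_class x = d"
proof -
  let ?L = "map (tl_letter d)"
  have "map (\<lambda>x. tl_letter d (snd x)) w = map (\<lambda>x. x) w"
    using letter_eq[symmetric] assms(2) by (intro map_cong) auto
  then have w: "?L (map snd w) = w" by (simp add: comp_def)
  have "set (map snd w) \<subseteq> {..p}" using assms(1) by (auto simp: fits_def)
  from tl_reduce[OF _ this, of "Suc (Suc p)" n d] obtain s w' where w':
    "weq n (Suc (Suc p)) s w (?L w')" "set w' \<subseteq> {..p}" "count_list w' p \<le> 1"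
    unfolding w by auto
  have cls: "tl_class x = d" if x: "x \<in> set (?L z)" for x z
  proof -
    obtain q where "x = tl_letter d q" using x by auto
    then show ?thesis by simp
  qed
  show ?thesis
  proof (cases "p \<in> set w'")
    case False
    then have "fits (Suc p) (?L w')" using w'(2) by (auto simp: fits_def less_le Suc_le_eq)
    then show ?thesis using that(1)[OF w'(1)] cls by blast
  next
    case True
    then obtain u v where uv: "w' = u @ p # v" "p \<notin> set u" by (meson split_list_first)
    then have "count_list v p = 0" using w'(3) by simp
    then have "p \<notin> set v" by (simp add: count_list_0_iff)
    then have "fits (Suc p) (?L u)" "fits (Suc p) (?L v)"
      using w'(2) uv by (auto simp: fits_def less_le Suc_le_eq)
    then show ?thesis using that(2)[of s "?L u" "?L v"] w'(1) uv cls by (metis Un_iff append_Cons append_Nil list.map(2) map_append)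
  qed
qed

text \<open>Induction on the number of legs. After sorting and reducing, each class contains the
  highest position at most once, and in each of the four combinations a Markov identity removes the
  first leg with a scalar depending on \<open>n\<close> only.\<close>

lemma op_trace_universal:
  assumes "fits m w"
  shows "\<exists>t. \<forall>E. unbiased_bases n E \<longrightarrow> op_trace n m (ev n E w) = t"
  using assms
proof (induction m arbitrary: w)
  case 0
  then have "w = []" by (cases w) auto
  then show ?case by (auto simp: op_trace_def)
next
  case (Suc m)
  show ?case
  proof (cases m)
    case 0
    then have "fits m w" using Suc.prems by (cases w) auto
    then show ?thesis
      using Suc.IH[of w] unbiased_bases.op_trace_markov_id[of n _ m w] by metis
  next
    case (Suc p)
    note m = this
    let ?M = "Suc (Suc p)"
    have fw: "fits ?M w" using Suc.prems m by simp
    let ?a = "filter tl_class w" and ?b = "filter (\<lambda>x. \<not> tl_class x) w"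
    have sort: "weq n ?M 1 w (?a @ ?b)" using weq_sort fw by blast
    have fa: "fits ?M ?a" "fits ?M ?b" using fw by (auto simp: fits_def)
    have up: "fits ?M u" if "fits (Suc p) u" for u using that by (auto simp: fits_def)
    \<comment> \<open>The common end of all four cases: \<open>s\<close> and \<open>k\<close> are
      fixed before the bases are, so universality passes from the shorter tensors to the longer
      ones.\<close>
    have *: ?thesis if a1: "weq n ?M s w w'" and a2: "\<And>E. unbiased_bases n E \<Longrightarrow>
        op_trace n ?M (ev n E w') = k * op_trace n (Suc p) (ev n E u)" and a3: "fits (Suc p) u" for s w' k u
    proof -
      obtain t where t: "\<And>E. unbiased_bases n E \<Longrightarrow> op_trace n (Suc p) (ev n E u) = t"
        using Suc.IH[of u] a3 m by auto
      have "op_trace n ?M (ev n E w) = s * (k * t)" if "unbiased_bases n E" for E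
        using op_trace_weq[OF that a1] a2[OF that] t[OF that] by simp
      then show ?thesis using m by auto
    qed
    show ?thesis
    proof (rule tl_reduce_word[OF fa(1), of True n])
      fix s u assume u: "weq n ?M s ?a u" "fits (Suc p) u"
      show ?thesis
      proof (rule tl_reduce_word[OF fa(2), of False n])
        fix s' u' assume u': "weq n ?M s' ?b u'" "fits (Suc p) u'"
        show ?thesis
          by (rule *[OF weq_trans1[OF sort weq_append[OF u(1) u'(1)]], of "real n" "u @ u'"])
            (use unbiased_bases.op_trace_markov_id[of n _ "Suc p" "u @ u'"] u u' in auto)
      next
        fix s' u' v' assume u': "weq n ?M s' ?b (u' @ [tl_letter False p] @ v')" "fits (Suc p) u'" "fits (Suc p) v'"
        show ?thesis
          by (rule *[OF weq_trans1[OF sort weq_append[OF u(1) u'(1)]], of 1 "(u @ u') @ v'"])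
            (use unbiased_bases.op_trace_markov_proj[of n _ p "u @ u'" v'] u u' in \<open>auto simp: tl_letter_def\<close>)
      qed auto
    next
      fix s u v assume u: "weq n ?M s ?a (u @ [tl_letter True p] @ v)" "fits (Suc p) u" "fits (Suc p) v"
        and cu: "\<And>x. x \<in> set u \<union> set v \<Longrightarrow> tl_class x = True"
      show ?thesis
      proof (rule tl_reduce_word[OF fa(2), of False n])
        fix s' u' assume u': "weq n ?M s' ?b u'" "fits (Suc p) u'"
        show ?thesis
          by (rule *[OF weq_trans1[OF sort weq_append[OF u(1) u'(1)]], of 1 "u @ (v @ u')"])
            (use unbiased_bases.op_trace_markov_proj[of n _ p "u" "v @ u'"] u u' in \<open>auto simp: tl_letter_def\<close>)
      next
        fix s' u' v' assume u': "weq n ?M s' ?b (u' @ [tl_letter False p] @ v')" "fits (Suc p) u'" "fits (Suc p) v'"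
          and cu': "\<And>x. x \<in> set u' \<union> set v' \<Longrightarrow> tl_class x = False"
        \<comment> \<open>Commutation of the classes moves u x v u' y v' to u u' x y v v', where the
          two highest letters are adjacent and can be traced out together.\<close>
        let ?x = "tl_letter True p" and ?y = "tl_letter False p"
        have y: "?y = (\<not> fst ?x, p)" "?x = (fst ?x, p)" by (auto simp: tl_letter_def)
        have vy: "weq n ?M 1 (?y # v) (v @ [?y])" if "\<And>x. x \<in> set v \<Longrightarrow> tl_class x = True" "fits (Suc p) v" for v
          using that up by (intro weq_commute_word) auto
        have xu: "weq n ?M 1 (?x # u') (u' @ [?x])"
          using cu' u' up by (intro weq_commute_word) auto
        have vu: "weq n ?M 1 (x # u') (u' @ [x])" if "x \<in> set v" for x
          using cu cu' that u u' up by (intro weq_commute_word) (auto simp: fits_def)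
        have vu': "weq n ?M 1 (v @ u') (u' @ v)"
        proof -
          have "weq n ?M 1 (z @ u') (u' @ z)" if "set z \<subseteq> set v" for z
            using that
          proof (induction z)
            case Nil
            then show ?case by (simp add: weq_refl)
          next
            case (Cons x z)
            then have "weq n ?M 1 (x # z @ u') (x # u' @ z)"
              using weq_context[of n ?M 1 "z @ u'" "u' @ z" "[x]" "[]"] by simp
            moreover have "weq n ?M 1 (x # u' @ z) (u' @ x # z)"
              using weq_context[OF vu[of x], of "[]" z] Cons by simp
            ultimately show ?case using weq_trans1 by fastforce
          qed
          then show ?thesis by simp
        qed
        have 1: "weq n ?M 1 (u @ ?x # v @ u' @ ?y # v') (u @ ?x # u' @ v @ ?y # v')"
          using weq_context[OF vu', of "u @ [?x]" "?y # v'"] by simp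
        have 2: "weq n ?M 1 (u @ ?x # u' @ v @ ?y # v') (u @ u' @ ?x # v @ ?y # v')"
          using weq_context[OF xu, of u "v @ ?y # v'"] by simp
        have 3: "weq n ?M 1 (u @ u' @ ?x # v @ ?y # v') (u @ u' @ ?x # ?y # v @ v')"
          using weq_context[OF vy[of v], of "u @ u' @ [?x]" v'] cu u by (simp add: weq_def)
        have 4: "weq n ?M (s * s') w (u @ u' @ ?x # ?y # v @ v')"
          using weq_trans[OF weq_trans1[OF sort weq_append[OF u(1) u'(1)]]
            weq_trans1[OF _ weq_trans1[OF 2 3]], of ] 1 by simp
        show ?thesis
          by (rule *[OF 4, of "inverse (real n)" "(u @ u') @ v @ v'"])
            (use unbiased_bases.op_trace_markov_cross[of n _ p "u @ u'" "v @ v'" "fst ?x"] u u'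
              in \<open>auto simp: y(1)[symmetric] y(2)[symmetric] simp del: ev_simps\<close>)
      qed auto
    qed auto
  qed
qed

section \<open>Diagrams and isometry\<close>

definition unit_tensor :: tensor where
  "unit_tensor = (\<lambda>I. of_bool (I = []))"

text \<open>The pairs stand side by side: each new cup is placed to the left of the earlier
  ones.\<close>

definition cups :: "nat \<Rightarrow> nat \<Rightarrow> tensor" where
  "cups n k = (head_cup n ^^ k) unit_tensor"

text \<open>The same sequence of operations is performed for both families of bases.\<close>

inductive diagram :: "nat \<Rightarrow> bases \<Rightarrow> bases \<Rightarrow> nat \<Rightarrow> tensor \<Rightarrow> tensor \<Rightarrow> bool" for n E F where
  diagram_unit: "diagram n E F 0 unit_tensor unit_tensor"
| diagram_head_cup: "diagram n E F m \<xi> \<eta> \<Longrightarrow> diagram n E F (Suc (Suc m)) (head_cup n \<xi>) (head_cup n \<eta>)"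
| diagram_head_cap: "diagram n E F (Suc (Suc m)) \<xi> \<eta> \<Longrightarrow> diagram n E F m (head_cap n \<xi>) (head_cap n \<eta>)"
| diagram_proj: "diagram n E F m \<xi> \<eta> \<Longrightarrow> Suc (Suc p) \<le> m \<Longrightarrow>
    diagram n E F m (proj n (E c) p \<xi>) (proj n (F c) p \<eta>)"

text \<open>By \<open>proj_cross\<close> this word acts as 1/n times the cap at \<open>p\<close>
  followed by the cup at \<open>p\<close>; words thereby express operations that change the number
  of legs.\<close>

definition cup_cap_word :: "nat \<Rightarrow> (bool \<times> nat) list" where
  "cup_cap_word p = [(False, p), (True, p)]"

text \<open>Up to the factor n^r this word caps off the \<open>r\<close> pairs at the head and puts
  cups back in their place, with \<open>m\<close> legs to the right of them.\<close>

primrec nested_word :: "nat \<Rightarrow> nat \<Rightarrow> (bool \<times> nat) list" where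
  "nested_word m 0 = []"
| "nested_word m (Suc r) = nested_word (Suc (Suc m)) r @ cup_cap_word m"

text \<open>Up to a power of n this word carries a cup inserted at the head, with \<open>M\<close>
  legs to its right, down to position \<open>p\<close>.\<close>

definition shift_word :: "nat \<Rightarrow> nat \<Rightarrow> (bool \<times> nat) list" where
  "shift_word p M = concat (map cup_cap_word [p..<M])"

text \<open>The standard shape of a diagram: all cups are created before the word acts, and all caps
  come after it.\<close>

definition normal_form :: "nat \<Rightarrow> bases \<Rightarrow> real \<Rightarrow> nat \<Rightarrow> nat \<Rightarrow> (bool \<times> nat) list \<Rightarrow> tensor" where
  "normal_form n E s r k w = (\<lambda>I. s * (head_cap n ^^ r) (ev n E w (cups n k)) I)"

lemma unit_tensors: "unit_tensor \<in> tensors n 0"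
  by (simp add: unit_tensor_def tensors_def)

lemma cups_Suc: "cups n (Suc k) = head_cup n (cups n k)"
  by (simp add: cups_def)

lemma cups_tensors: "cups n k \<in> tensors n (2 * k)"
  by (induction k) (simp_all add: cups_Suc head_cup_tensors, simp add: cups_def unit_tensors)

lemma fits_mono: "fits m w \<Longrightarrow> m \<le> m' \<Longrightarrow> fits m' w"
  by (auto simp: fits_def)

lemma fits_rev: "fits m (rev w) \<longleftrightarrow> fits m w"
  by (simp add: fits_def)

lemma fits_nested: "fits (m + 2 * r) (nested_word m r)"
proof (induction r arbitrary: m)
  case (Suc r)
  from Suc[of "Suc (Suc m)"] show ?case by (simp add: cup_cap_word_def)
qed simp

lemma fits_shift: "fits (Suc (Suc M)) (shift_word p (Suc M))" "fits (Suc (Suc M)) (shift_word p M)"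
  by (auto simp: fits_def shift_word_def cup_cap_word_def)

lemma head_cap_slices: "head_cap n T = (\<lambda>J. \<Sum>i<n. slice i (slice i T) J)"
  by (simp add: head_cap_def slice_def)

lemma head_cap_scale: "head_cap n (\<lambda>I. c * T I) = (\<lambda>I. c * head_cap n T I)"
  by (simp add: head_cap_def sum_distrib_left)

lemma head_cup_scale: "head_cup n (\<lambda>I. c * T I) = (\<lambda>I. c * head_cup n T I)"
  by (rule ext) (simp add: head_cup_def split: list.splits)

lemma head_cap_pow_scale: "(head_cap n ^^ r) (\<lambda>I. c * T I) = (\<lambda>I. c * (head_cap n ^^ r) T I)"
  by (induction r) (simp_all add: head_cap_scale)

lemma head_cup_pow_scale: "(head_cup n ^^ r) (\<lambda>I. c * T I) = (\<lambda>I. c * (head_cup n ^^ r) T I)"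
  by (induction r) (simp_all add: head_cup_scale)

lemma head_cap_pow_tensors: "T \<in> tensors n (m + 2 * r) \<Longrightarrow> (head_cap n ^^ r) T \<in> tensors n m"
  by (induction r arbitrary: m) (simp_all add: head_cap_tensors)

lemma slice_slice_head_cup:
  "slice j (slice i (head_cup n T)) = (\<lambda>J. of_bool (i = j \<and> i < n) * T J)"
  by (auto simp: slice_def head_cup_def)

lemma head_cap_cup:
  "head_cap n (head_cup n T) = (\<lambda>I. real n * T I)"
  by (simp add: head_cap_def head_cup_def)

lemma cup_head_cap:
  assumes "T \<in> tensors n (Suc (Suc m))" "p \<le> m"
  shows "cup n p (head_cap n T) = head_cap n (cup n p T)"
proof -
  have "slice i (slice i (cup n p T)) = cup n p (slice i (slice i T))" for i
    using assms by (simp add: slice_cup[of _ n "Suc m"] slice_cup[of _ n m] slice_tensors)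
  then show ?thesis by (simp add: head_cap_slices cup_sum)
qed

lemma cup_head_cap_pow:
  assumes "T \<in> tensors n (m + 2 * r)" "p \<le> m"
  shows "cup n p ((head_cap n ^^ r) T) = (head_cap n ^^ r) (cup n p T)"
  using assms
proof (induction r arbitrary: m)
  case (Suc r)
  have "(head_cap n ^^ r) T \<in> tensors n (Suc (Suc m))"
    using Suc.prems by (intro head_cap_pow_tensors) simp
  then show ?case
    using Suc.IH[of "Suc (Suc m)"] Suc.prems by (simp add: cup_head_cap)
qed simp

text \<open>The snake identity: a cup and a cap sharing one leg straighten to the identity.
  \<open>cap_Suc_cup\<close> is the mirror image.\<close>

lemma cap_cup_Suc:
  assumes "Suc p \<le> m" "T \<in> tensors n m"
  shows "cap n p (cup n (Suc p) T) = T"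
  using assms
proof (induction m arbitrary: T rule: nat_induct_at_least)
  case base
  have c: "cup n (Suc p) T \<in> tensors n (Suc (Suc (Suc p)))" using base by (intro cup_tensors) auto
  show ?case
  proof (rule tensors_eqI[of _ n p])
    show "cap n p (cup n (Suc p) T) \<in> tensors n (Suc p)" using c by (intro cap_tensors) auto
    show "slice i (cap n p (cup n (Suc p) T)) = slice i T" if "i < n" for i
    proof -
      have "slice i (cap n p (cup n (Suc p) T)) = head_cap n (slice i (cup n (Suc p) T))"
        using slice_cap[OF c, of p i] cap_head[OF slice_tensors[OF c, of i]] by simp
      also have "\<dots> = slice i T"
        using that by (auto simp: cup_head[OF base] head_cap_def slice_def head_cup_def)
      finally show ?thesis .
    qed
  qed (use base in auto)
next
  case (Suc m)
  show ?case
    by (rule tensors_eqI[of _ n m])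
      (use Suc in \<open>simp_all add: slice_cap[of _ n m] slice_cup[of _ n m] slice_tensors cap_tensors cup_tensors\<close>)
qed

lemma cap_Suc_cup:
  assumes "Suc p \<le> m" "T \<in> tensors n m"
  shows "cap n (Suc p) (cup n p T) = T"
  using assms
proof (induction m arbitrary: T rule: nat_induct_at_least)
  case base
  have c: "cup n p T \<in> tensors n (Suc (Suc (Suc p)))" using base by (intro cup_tensors) auto
  have "head_cap n (cup n p T) = T"
  proof (rule tensors_eqI[of _ n p])
    show "head_cap n (cup n p T) \<in> tensors n (Suc p)" using c by (rule head_cap_tensors)
    show "slice i (head_cap n (cup n p T)) = slice i T" if "i < n" for i
    proof -
      have "slice k (cup n p T) = head_cup n (slice k T)" for k
        using slice_cup[OF base, of p k] cup_head[OF slice_tensors[OF base, of k]] by simp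
      then have "head_cap n (cup n p T) (i # J) = (\<Sum>k<n. slice k (head_cup n (slice k T)) (i # J))" for J
        unfolding head_cap_slices by simp
      moreover have "(\<Sum>k<n. slice k (head_cup n (slice k T)) (i # J)) = T (i # J)" for J
        using that by (simp add: head_cup_def slice_def)
      ultimately show ?thesis by (simp add: slice_def)
    qed
  qed (use base in auto)
  then show ?case using cap_head[OF c] by simp
next
  case (Suc m)
  show ?case
    by (rule tensors_eqI[of _ n m])
      (use Suc in \<open>simp_all add: slice_cap[of _ n m] slice_cup[of _ n m] slice_tensors cap_tensors cup_tensors\<close>)
qed

lemma ip_head_cap_pow:
  "ip n m ((head_cap n ^^ r) T) T' = ip n (m + 2 * r) T ((head_cup n ^^ r) T')"
proof (induction r arbitrary: m T')
  case (Suc r)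
  have "ip n m ((head_cap n ^^ Suc r) T) T' = ip n (Suc (Suc m)) ((head_cap n ^^ r) T) (head_cup n T')"
    using ip_head_cup[of n m T' "(head_cap n ^^ r) T"] by (simp add: ip_sym)
  then show ?case by (simp add: Suc funpow_swap1)
qed simp

context unbiased_bases
begin

lemma proj_head_cap:
  assumes "T \<in> tensors n (Suc (Suc m))" "Suc (Suc p) \<le> m"
  shows "proj n e p (head_cap n T) = head_cap n (proj n e p T)"
proof -
  have "slice i (slice i (proj n e p T)) = proj n e p (slice i (slice i T))" for i
    using assms by (simp add: slice_proj[of _ "Suc m"] slice_proj[of _ m] slice_tensors)
  then show ?thesis by (simp add: head_cap_slices proj_sum)
qed

lemma proj_head_cap_pow:
  assumes "T \<in> tensors n (m + 2 * r)" "Suc (Suc p) \<le> m"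
  shows "proj n e p ((head_cap n ^^ r) T) = (head_cap n ^^ r) (proj n e p T)"
  using assms
proof (induction r arbitrary: m)
  case (Suc r)
  have "(head_cap n ^^ r) T \<in> tensors n (Suc (Suc m))"
    using Suc.prems by (intro head_cap_pow_tensors) simp
  then show ?case
    using Suc.IH[of "Suc (Suc m)"] Suc.prems by (simp add: proj_head_cap)
qed simp

lemma ev_head_cap_pow:
  assumes "T \<in> tensors n (m + 2 * r)" "fits m w"
  shows "ev n E w ((head_cap n ^^ r) T) = (head_cap n ^^ r) (ev n E w T)"
  using assms
proof (induction w)
  case (Cons x w)
  then show ?case by (cases x) (simp add: proj_head_cap_pow[of _ m] ev_tensors)
qed simp

lemma proj_head_cup:
  assumes "T \<in> tensors n m" "Suc (Suc p) \<le> m"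
  shows "proj n (E c) p (head_cup n T) = head_cup n (proj n (E c) p T)"
proof (rule tensors_eqI[of _ n "Suc m"])
  have h: "head_cup n T \<in> tensors n (Suc (Suc m))" using assms by (intro head_cup_tensors)
  show "slice i (proj n (E c) p (head_cup n T)) = slice i (head_cup n (proj n (E c) p T))" for i
  proof (rule tensors_eqI[of _ n m])
    show "slice i (proj n (E c) p (head_cup n T)) \<in> tensors n (Suc m)"
      using h by (intro slice_tensors proj_tensors)
    show "slice i (head_cup n (proj n (E c) p T)) \<in> tensors n (Suc m)"
      using assms by (intro slice_tensors head_cup_tensors proj_tensors)
    show "slice j (slice i (proj n (E c) p (head_cup n T))) = slice j (slice i (head_cup n (proj n (E c) p T)))" for j
      using h assms by (simp add: slice_proj[of _ "Suc m"] slice_proj[of _ m] slice_tensors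
          slice_slice_head_cup proj_scale)
  qed
qed (use assms in \<open>auto intro: head_cup_tensors proj_tensors\<close>)

lemma ev_head_cup:
  assumes "T \<in> tensors n m" "fits m w"
  shows "ev n E w (head_cup n T) = head_cup n (ev n E w T)"
  using assms
proof (induction w)
  case (Cons x w)
  then show ?case by (cases x) (simp add: proj_head_cup[of _ m] ev_tensors)
qed simp

lemma ev_cup_cap:
  assumes "p \<le> m" "T \<in> tensors n (Suc (Suc m))"
  shows "cup n p (cap n p T) = (\<lambda>I. real n * ev n E (cup_cap_word p) T I)"
  using proj_cross[OF assms, of False] n_pos by (simp add: cup_cap_word_def mult.assoc[symmetric])

text \<open>By the snake identity the cup at \<open>p\<close> is the cup at \<open>Suc p\<close>
  followed by cap and cup at \<open>p\<close>, and the latter two are a word up to the factor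
  n.\<close>

lemma cup_shift:
  assumes "Suc p \<le> m" "T \<in> tensors n m"
  shows "cup n p T = (\<lambda>I. real n * ev n E (cup_cap_word p) (cup n (Suc p) T) I)"
  using ev_cup_cap[of p m "cup n (Suc p) T"] assms by (simp add: cap_cup_Suc[of p m] cup_tensors)

lemma cap_shift:
  assumes "Suc p \<le> m" "T \<in> tensors n (Suc (Suc m))"
  shows "cap n p T = cap n (Suc p) (\<lambda>I. real n * ev n E (cup_cap_word p) T I)"
proof -
  have "cap n p T \<in> tensors n m" using assms by (intro cap_tensors) auto
  then show ?thesis
    using ev_cup_cap[of p m T] cap_Suc_cup[of p m "cap n p T" n] assms by simp
qed

lemma cup_to_head:
  assumes "p \<le> m" "T \<in> tensors n m"
  shows "cup n p T = (\<lambda>I. real n ^ (m - p) * ev n E (shift_word p m) (head_cup n T) I)"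
  using assms
proof (induction p rule: inc_induct)
  case base
  then show ?case by (simp add: cup_head shift_word_def)
next
  case (step p)
  have "cup n p T = (\<lambda>I. real n * ev n E (cup_cap_word p) (cup n (Suc p) T) I)"
    using step by (intro cup_shift) auto
  also have "\<dots> = (\<lambda>I. real n * (real n ^ (m - Suc p) * ev n E (cup_cap_word p @ shift_word (Suc p) m) (head_cup n T) I))"
    using step by (simp add: ev_scale)
  also have "cup_cap_word p @ shift_word (Suc p) m = shift_word p m"
    using step by (simp add: shift_word_def upt_conv_Cons)
  also have "(\<lambda>I. real n * (real n ^ (m - Suc p) * ev n E (shift_word p m) (head_cup n T) I)) =
      (\<lambda>I. real n ^ (m - p) * ev n E (shift_word p m) (head_cup n T) I)"
    using step by (metis Suc_diff_Suc mult.assoc power_Suc)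
  finally show ?case .
qed

lemma nested_cup_cap:
  assumes "T \<in> tensors n (m + 2 * r)"
  shows "(head_cup n ^^ r) ((head_cap n ^^ r) T) = (\<lambda>I. real n ^ r * ev n E (nested_word m r) T I)"
  using assms
proof (induction r arbitrary: m T)
  case (Suc r)
  have T: "T \<in> tensors n (Suc (Suc m) + 2 * r)" using Suc.prems by simp
  then have S: "(head_cap n ^^ r) T \<in> tensors n (Suc (Suc m))" by (rule head_cap_pow_tensors)
  have "head_cup n (head_cap n ((head_cap n ^^ r) T)) =
    (\<lambda>I. real n * ev n E (cup_cap_word m) ((head_cap n ^^ r) T) I)"
    using ev_cup_cap[OF _ S, of m] by (simp add: cap_head[OF S] cup_head[OF head_cap_tensors[OF S]])
  also have "\<dots> = (\<lambda>I. real n * (head_cap n ^^ r) (ev n E (cup_cap_word m) T) I)"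
    using ev_head_cap_pow[OF T, of "cup_cap_word m"] by (simp add: cup_cap_word_def)
  finally have "(head_cup n ^^ Suc r) ((head_cap n ^^ Suc r) T) =
    (\<lambda>I. real n * (head_cup n ^^ r) ((head_cap n ^^ r) (ev n E (cup_cap_word m) T)) I)"
    by (simp add: funpow_swap1 head_cup_pow_scale)
  also have "\<dots> = (\<lambda>I. real n ^ Suc r * ev n E (nested_word m (Suc r)) T I)"
    using Suc.IH[of "ev n E (cup_cap_word m) T" "Suc (Suc m)"] ev_tensors[OF T] by (simp add: mult.assoc)
  finally show ?case .
qed simp

lemma ip_ev:
  assumes "fits m w" "T \<in> tensors n m" "T' \<in> tensors n m"
  shows "ip n m (ev n E w T) T' = ip n m T (ev n E (rev w) T')"
  using assms
proof (induction w arbitrary: T')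
  case (Cons x w)
  then show ?case by (cases x) (simp add: ip_proj ev_tensors proj_tensors)
qed simp

text \<open>The rank one operator given by the vector \<open>cups n k\<close> is k caps followed by
  k cups, hence n^k times \<open>nested_word 0 k\<close>. A vector expectation thereby becomes a
  trace of a word.\<close>

lemma ip_cups_ev:
  "ip n (2 * k) (cups n k) (ev n E w (cups n k)) =
     real n ^ k * op_trace n (2 * k) (ev n E (w @ nested_word 0 k))"
proof -
  have "real n ^ k * ev n E (w @ nested_word 0 k) (\<lambda>J. of_bool (J = I)) I =
     cups n k I * ev n E w (cups n k) I" if I: "I \<in> tuples n (2 * k)" for I
  proof -
    let ?d = "\<lambda>J. of_bool (J = I) :: real"
    have d: "?d \<in> tensors n (0 + 2 * k)" using delta_tensors[OF I] by simp
    let ?c = "(head_cap n ^^ k) ?d"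
    have c: "?c \<in> tensors n 0" using d by (rule head_cap_pow_tensors)
    have "?c [] = ip n 0 ?c unit_tensor" by (simp add: ip_def unit_tensor_def)
    also have "\<dots> = cups n k I"
      using I by (simp add: ip_head_cap_pow cups_def[symmetric]) (simp add: ip_def of_bool_def if_distrib[of "\<lambda>x. x * _"] cong: if_cong)
    finally have "?c = (\<lambda>J. cups n k I * unit_tensor J)"
      using c by (auto simp: unit_tensor_def tensors_def fun_eq_iff)
    then have "(head_cup n ^^ k) ?c = (\<lambda>J. cups n k I * cups n k J)"
      by (simp add: head_cup_pow_scale cups_def)
    then have "(\<lambda>J. cups n k I * cups n k J) = (\<lambda>J. real n ^ k * ev n E (nested_word 0 k) ?d J)"
      using nested_cup_cap[OF d] by simp
    then have "ev n E w (\<lambda>J. cups n k I * cups n k J) I = ev n E w (\<lambda>J. real n ^ k * ev n E (nested_word 0 k) ?d J) I"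
      by simp
    then show ?thesis by (simp add: ev_scale)
  qed
  then show ?thesis by (simp add: ip_def op_trace_def sum_distrib_left)
qed

lemma normal_form_head_cap: "head_cap n (normal_form n E s r k w) = normal_form n E s (Suc r) k w"
  by (simp add: normal_form_def head_cap_scale)

lemma normal_form_proj:
  assumes "m + 2 * r = 2 * k" "Suc (Suc p) \<le> m"
  shows "proj n (E c) p (normal_form n E s r k w) = normal_form n E s r k ((c, p) # w)"
  using assms proj_head_cap_pow[of "ev n E w (cups n k)" m r p "E c"] ev_tensors[OF cups_tensors, of w k]
  by (simp add: normal_form_def proj_scale)

text \<open>Seen below the final caps, the new cup sits at position \<open>m\<close>. The caps act
  to its left and commute with it; it is then carried to the head, where the remaining cups are
  created.\<close>

lemma normal_form_head_cup:
  assumes "m + 2 * r = 2 * k" "fits (2 * k) w"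
  shows "head_cup n (normal_form n E s r k w) =
    normal_form n E (s * real n ^ (2 * k - m)) r (Suc k) (shift_word m (2 * k) @ w)"
proof -
  let ?T = "ev n E w (cups n k)"
  have T: "?T \<in> tensors n (m + 2 * r)" "?T \<in> tensors n (2 * k)" using assms ev_tensors[OF cups_tensors, of w k] by simp_all
  have "head_cup n ((head_cap n ^^ r) ?T) = cup n m ((head_cap n ^^ r) ?T)"
    using cup_head[OF head_cap_pow_tensors[OF T(1)]] by simp
  also have "\<dots> = (head_cap n ^^ r) (cup n m ?T)"
    using T(1) by (intro cup_head_cap_pow) auto
  also have "\<dots> = (\<lambda>I. real n ^ (2 * k - m) * (head_cap n ^^ r) (ev n E (shift_word m (2 * k)) (head_cup n ?T)) I)"
    using assms by (subst cup_to_head[OF _ T(2)]) (simp_all add: head_cap_pow_scale)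
  also have "head_cup n ?T = ev n E w (cups n (Suc k))"
    using ev_head_cup[OF cups_tensors assms(2)] by (simp add: cups_Suc)
  finally show ?thesis by (simp add: normal_form_def head_cup_scale mult.assoc)
qed

text \<open>Each extra cup closed by an extra cap is a loop worth n. This brings two normal forms to
  common numbers of cups and caps.\<close>

lemma normal_form_raise:
  assumes "fits (2 * k) w"
  shows "normal_form n E s r k w = normal_form n E (s * inverse (real n) ^ i) (r + i) (k + i) w"
proof (induction i)
  case (Suc i)
  have "ev n E w (cups n (Suc (k + i))) = head_cup n (ev n E w (cups n (k + i)))"
    using ev_head_cup[OF cups_tensors, of "k + i" w] fits_mono[OF assms] by (simp add: cups_Suc)
  then have "normal_form n E s' (Suc (r + i)) (Suc (k + i)) w = normal_form n E (s' * real n) (r + i) (k + i) w" for s'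
    by (simp add: normal_form_def funpow_swap1 head_cap_cup head_cap_pow_scale mult.assoc)
  moreover have "s * inverse (real n) ^ Suc i * real n = s * inverse (real n) ^ i"
    using n_pos by simp
  ultimately show ?case by (simp only: Suc add_Suc_right)
qed simp

text \<open>Moving the caps of one factor across the inner product turns them into cups and produces
  \<open>nested_word m r\<close>; moving \<open>w\<close> across reverses it, because the letters
  are self-adjoint.\<close>

lemma ip_normal_form_eq:
  assumes "m + 2 * r = 2 * k" "fits (2 * k) w" "fits (2 * k) w'"
  shows "ip n m (normal_form n E s r k w) (normal_form n E s' r k w') =
    s * s' * real n ^ r * real n ^ k * op_trace n (2 * k) (ev n E (rev w @ nested_word m r @ w' @ nested_word 0 k))"
proof -
  have t: "ev n E v (cups n k) \<in> tensors n (2 * k)" for v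
    by (rule ev_tensors[OF cups_tensors])
  have "ip n m ((head_cap n ^^ r) (ev n E w (cups n k))) ((head_cap n ^^ r) (ev n E w' (cups n k))) =
     ip n (2 * k) (ev n E w (cups n k)) (\<lambda>I. real n ^ r * ev n E (nested_word m r @ w') (cups n k) I)"
    using nested_cup_cap[of "ev n E w' (cups n k)" m r] t[of w'] assms(1) by (simp add: ip_head_cap_pow)
  also have "\<dots> = real n ^ r * ip n (2 * k) (cups n k) (ev n E (rev w @ nested_word m r @ w') (cups n k))"
    using ip_ev[OF assms(2) cups_tensors t, of "nested_word m r @ w'"] by (simp add: ip_scale_right)
  finally show ?thesis
    by (simp add: normal_form_def ip_scale_left ip_scale_right ip_cups_ev del: ev_simps)
qed

end

text \<open>The rewriting rules involve scalars in \<open>n\<close> only, so one choice of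
  \<open>s\<close>, \<open>r\<close>, \<open>k\<close> and \<open>w\<close> serves both families of
  bases.\<close>

lemma diagram_normal_form:
  assumes "diagram n E F m \<xi> \<eta>" "unbiased_bases n E" "unbiased_bases n F"
  shows "\<exists>s r k w. m + 2 * r = 2 * k \<and> fits (2 * k) w \<and>
    \<xi> = normal_form n E s r k w \<and> \<eta> = normal_form n F s r k w"
  using assms(1)
proof induction
  case diagram_unit
  show ?case
    by (intro exI[of _ 1] exI[of _ 0] exI[of _ "[]"]) (simp add: normal_form_def cups_def)
next
  case (diagram_head_cup m \<xi> \<eta>)
  then obtain s r k w where *: "m + 2 * r = 2 * k" "fits (2 * k) w"
    "\<xi> = normal_form n E s r k w" "\<eta> = normal_form n F s r k w" by blast
  have "fits (2 * Suc k) (shift_word m (2 * k) @ w)"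
    using *(2) fits_shift(2)[of "2 * k" m] by (auto intro: fits_mono)
  then show ?case
    using * assms(2,3) by (intro exI[of _ "s * real n ^ (2 * k - m)"] exI[of _ r] exI[of _ "Suc k"]
        exI[of _ "shift_word m (2 * k) @ w"]) (simp add: unbiased_bases.normal_form_head_cup)
next
  case (diagram_head_cap m \<xi> \<eta>)
  then obtain s r k w where *: "Suc (Suc m) + 2 * r = 2 * k" "fits (2 * k) w"
    "\<xi> = normal_form n E s r k w" "\<eta> = normal_form n F s r k w" by blast
  then show ?case
    using assms(2,3) by (intro exI[of _ s] exI[of _ "Suc r"] exI[of _ k] exI[of _ w])
      (simp add: unbiased_bases.normal_form_head_cap)
next
  case (diagram_proj m \<xi> \<eta> p c)
  then obtain s r k w where *: "m + 2 * r = 2 * k" "fits (2 * k) w"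
    "\<xi> = normal_form n E s r k w" "\<eta> = normal_form n F s r k w" by blast
  then show ?case
    using assms(2,3) diagram_proj.hyps(2) by (intro exI[of _ s] exI[of _ r] exI[of _ k] exI[of _ "(c, p) # w"])
      (simp add: unbiased_bases.normal_form_proj)
qed

lemma diagram_isometry:
  assumes "diagram n E F m \<xi> \<eta>" "diagram n E F m \<xi>' \<eta>'" "unbiased_bases n E" "unbiased_bases n F"
  shows "ip n m \<xi> \<xi>' = ip n m \<eta> \<eta>'"
proof -
  obtain s r k w where 1: "m + 2 * r = 2 * k" "fits (2 * k) w"
    "\<xi> = normal_form n E s r k w" "\<eta> = normal_form n F s r k w"
    using diagram_normal_form[OF assms(1,3,4)] by blast
  obtain s' r' k' w' where 2: "m + 2 * r' = 2 * k'" "fits (2 * k') w'"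
    "\<xi>' = normal_form n E s' r' k' w'" "\<eta>' = normal_form n F s' r' k' w'"
    using diagram_normal_form[OF assms(2,3,4)] by blast
  \<comment> \<open>Comparing the leg counts shows that \<open>r'\<close> extra loops on one side
    and \<open>r\<close> on the other give equal numbers of cups as well as of caps.\<close>
  have k: "k' + r = k + r'" using 1 2 by simp
  let ?k = "k + r'"
  have f: "fits (2 * ?k) w" "fits (2 * ?k) w'" "m + 2 * (r + r') = 2 * ?k"
    using 1(1,2) 2(1,2) by (auto intro: fits_mono)
  let ?w = "rev w @ nested_word m (r + r') @ w' @ nested_word 0 ?k"
  have "fits (2 * ?k) ?w"
    using f fits_nested[of m "r + r'"] fits_nested[of 0 ?k] unfolding f(3) by (simp add: fits_rev)
  then obtain t where t: "\<And>E. unbiased_bases n E \<Longrightarrow> op_trace n (2 * ?k) (ev n E ?w) = t"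
    using op_trace_universal by blast
  have "ip n m (normal_form n E s r k w) (normal_form n E s' r' k' w') =
     (s * inverse (real n) ^ r') * (s' * inverse (real n) ^ r) * real n ^ (r + r') * real n ^ ?k * t"
    if "unbiased_bases n E" for E
    unfolding unbiased_bases.normal_form_raise[OF that 1(2), of s r r']
      unbiased_bases.normal_form_raise[OF that 2(2), of s' r' r] k add.commute[of r' r]
    using unbiased_bases.ip_normal_form_eq[OF that f(3,1,2)] t[OF that] by simp
  then show ?thesis using 1 2 assms(3,4) by simp
qed

section \<open>Invariant pairs and their closure properties\<close>

inductive invariant :: "nat \<Rightarrow> bases \<Rightarrow> bases \<Rightarrow> nat \<Rightarrow> tensor \<Rightarrow> tensor \<Rightarrow> bool" for n E F where
  invariant_diagram: "diagram n E F m \<xi> \<eta> \<Longrightarrow> invariant n E F m \<xi> \<eta>"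
| invariant_sum: "(\<And>k. k < N \<Longrightarrow> invariant n E F m (\<xi> k) (\<eta> k)) \<Longrightarrow>
    invariant n E F m (\<lambda>I. \<Sum>k<(N::nat). c k * \<xi> k I) (\<lambda>I. \<Sum>k<N. c k * \<eta> k I)"

text \<open>The matrix entries of the projection onto the span of the e_k tensor e_k, when
  \<open>e\<close> is orthonormal.\<close>

definition kern :: "nat \<Rightarrow> (nat \<Rightarrow> nat \<Rightarrow> real) \<Rightarrow> nat \<Rightarrow> nat \<Rightarrow> nat \<Rightarrow> nat \<Rightarrow> real" where
  "kern n e i j a b = (\<Sum>k<n. e k i * e k j * e k a * e k b)"

text \<open>The list is split by counting from the tail, in agreement with the positions of cups,
  caps and projections.\<close>

definition tensor_prod :: "nat \<Rightarrow> tensor \<Rightarrow> tensor \<Rightarrow> tensor" where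
  "tensor_prod m \<xi> \<zeta> = (\<lambda>I. \<xi> (take (length I - m) I) * \<zeta> (drop (length I - m) I))"

definition nested_cap :: "nat \<Rightarrow> nat \<Rightarrow> nat \<Rightarrow> tensor \<Rightarrow> tensor" where
  "nested_cap n l k T = (\<lambda>I. \<Sum>C\<in>tuples n l. T (take k I @ rev C @ C @ drop k I))"

lemma append_in_tuples [simp]:
  "length A = k \<Longrightarrow> A @ B \<in> tuples n (k + m) \<longleftrightarrow> A \<in> tuples n k \<and> B \<in> tuples n m"
  by (auto simp: tuples_def)

lemma rev_in_tuples [simp]: "rev I \<in> tuples n m \<longleftrightarrow> I \<in> tuples n m"
  by (simp add: tuples_def)

lemma length_tuples: "I \<in> tuples n m \<Longrightarrow> length I = m"
  by (simp add: tuples_def)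

lemma sum_tuples_rev: "(\<Sum>I\<in>tuples n m. f (rev I)) = (\<Sum>I\<in>tuples n m. f I)"
  by (rule sum.reindex_bij_witness[of _ rev rev]) auto

lemma sum_tuples_append:
  "(\<Sum>I\<in>tuples n (k + m). f I) = (\<Sum>A\<in>tuples n k. \<Sum>B\<in>tuples n m. f (A @ B))"
  by (induction k arbitrary: f) (simp_all add: sum_tuples_Suc)

lemma tensors_append_eqI:
  assumes "T \<in> tensors n (k + m)" "T' \<in> tensors n (k + m)"
    and "\<And>A B. A \<in> tuples n k \<Longrightarrow> B \<in> tuples n m \<Longrightarrow> T (A @ B) = T' (A @ B)"
  shows "T = T'"
proof
  fix I
  show "T I = T' I"
  proof (cases "I \<in> tuples n (k + m)")
    case True
    then have "take k I @ drop k I \<in> tuples n (k + m)" "length (take k I) = k"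
      by (auto simp: tuples_def)
    then have "take k I \<in> tuples n k" "drop k I \<in> tuples n m"
      using append_in_tuples by blast+
    then show ?thesis using assms(3)[of "take k I" "drop k I"] by simp
  next
    case False
    then show ?thesis using assms by (simp add: tensorsD)
  qed
qed

lemma proj_append:
  "proj n e (length B) T (A @ i # j # B) = (\<Sum>a<n. \<Sum>b<n. kern n e i j a b * T (A @ a # b # B))"
proof (induction A arbitrary: T)
  case Nil
  have "proj n e (length B) T (i # j # B) =
      (\<Sum>k<n. \<Sum>b<n. \<Sum>a<n. e k i * e k j * e k a * e k b * T (a # b # B))"
    by (simp add: head_proj_def outer_def contract_def sum_distrib_left mult_ac)
  also have "\<dots> = (\<Sum>b<n. \<Sum>k<n. \<Sum>a<n. e k i * e k j * e k a * e k b * T (a # b # B))"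
    by (rule sum.swap)
  also have "\<dots> = (\<Sum>b<n. \<Sum>a<n. \<Sum>k<n. e k i * e k j * e k a * e k b * T (a # b # B))"
    by (rule sum.cong[OF refl]) (rule sum.swap)
  also have "\<dots> = (\<Sum>a<n. \<Sum>b<n. \<Sum>k<n. e k i * e k j * e k a * e k b * T (a # b # B))"
    by (rule sum.swap)
  finally show ?case by (simp add: kern_def sum_distrib_right)
next
  case (Cons x A)
  then show ?case by (simp add: slice_def)
qed

lemma kern_sym: "kern n e i j a b = kern n e a b i j" "kern n e i j a b = kern n e j i b a"
  by (simp_all add: kern_def mult_ac)

lemma tensor_prod_append: "length B = m \<Longrightarrow> tensor_prod m \<xi> \<zeta> (A @ B) = \<xi> A * \<zeta> B"
  by (simp add: tensor_prod_def)

lemma tensor_prod_tensors: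
  assumes "\<xi> \<in> tensors n k" "\<zeta> \<in> tensors n m"
  shows "tensor_prod m \<xi> \<zeta> \<in> tensors n (k + m)"
proof -
  have "tensor_prod m \<xi> \<zeta> I = 0" if "I \<notin> tuples n (k + m)" for I
  proof (rule ccontr)
    assume "tensor_prod m \<xi> \<zeta> I \<noteq> 0"
    then have "take (length I - m) I \<in> tuples n k" "drop (length I - m) I \<in> tuples n m"
      using assms by (auto simp: tensor_prod_def tensors_def)
    then have "take (length I - m) I @ drop (length I - m) I \<in> tuples n (k + m)"
      using append_in_tuples length_tuples by blast
    then show False using that by simp
  qed
  then show ?thesis by (simp add: tensors_def)
qed

lemma nested_cap_tensors:
  assumes "T \<in> tensors n (k + 2 * l + m)"
  shows "nested_cap n l k T \<in> tensors n (k + m)"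
proof -
  have "T (take k I @ rev C @ C @ drop k I) = 0" if "I \<notin> tuples n (k + m)" "C \<in> tuples n l" for I C
  proof -
    have "set (take k I) \<union> set (drop k I) = set I" by (metis append_take_drop_id set_append)
    then have "take k I @ rev C @ C @ drop k I \<notin> tuples n (k + 2 * l + m)"
      using that by (auto simp: tuples_def min_def split: if_splits)
    then show ?thesis using assms by (simp add: tensorsD)
  qed
  then show ?thesis by (simp add: tensors_def nested_cap_def)
qed

text \<open>The innermost pair of \<open>rev C @ C\<close> is formed by the head of \<open>C\<close>
  and has \<open>l + m\<close> legs to its right, so a single \<open>cap\<close> removes it.\<close>

lemma nested_cap_Suc:
  assumes "T \<in> tensors n (k + 2 * Suc l + m)"
  shows "nested_cap n (Suc l) k T = nested_cap n l k (cap n (l + m) T)"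
proof (rule tensors_append_eqI[of _ n k m])
  have T: "T \<in> tensors n (Suc (Suc (k + 2 * l + m)))" using assms by simp
  have c: "cap n (l + m) T \<in> tensors n (k + 2 * l + m)" using T by (intro cap_tensors) auto
  show "nested_cap n (Suc l) k T \<in> tensors n (k + m)" using assms by (rule nested_cap_tensors)
  show "nested_cap n l k (cap n (l + m) T) \<in> tensors n (k + m)" using c by (rule nested_cap_tensors)
  fix A B assume AB: "A \<in> tuples n k" "B \<in> tuples n m"
  have k: "length A = k" "length B = m" using AB by (simp_all add: tuples_def)
  have "cap n (l + m) T (A @ rev C @ C @ B) = (\<Sum>i<n. T (A @ rev C @ i # i # C @ B))"
    if "C \<in> tuples n l" for C
  proof -
    have "(A @ rev C) @ (C @ B) \<in> tuples n (k + 2 * l + m)"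
      using that AB by (auto simp: tuples_def)
    from cap_append[OF T this] show ?thesis using that k by (simp add: tuples_def)
  qed
  then show "nested_cap n (Suc l) k T (A @ B) = nested_cap n l k (cap n (l + m) T) (A @ B)"
    by (simp add: nested_cap_def k sum_tuples_Suc sum.swap[of _ "{..<n}"])
qed

lemma head_cup_sum: "head_cup n (\<lambda>I. \<Sum>k\<in>A. T k I) = (\<lambda>I. \<Sum>k\<in>A. head_cup n (T k) I)"
  by (rule ext) (auto simp: head_cup_def split: list.splits intro!: sum.neutral)

lemma head_cap_sum: "head_cap n (\<lambda>I. \<Sum>k\<in>A. T k I) = (\<lambda>I. \<Sum>k\<in>A. head_cap n (T k) I)"
  by (rule ext) (simp add: head_cap_def sum.swap[of _ A])

lemma invariant_scale: "invariant n E F m \<xi> \<eta> \<Longrightarrow> invariant n E F m (\<lambda>I. c * \<xi> I) (\<lambda>I. c * \<eta> I)"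
  using invariant_sum[of 1 n E F m "\<lambda>_. \<xi>" "\<lambda>_. \<eta>" "\<lambda>_. c"] by simp

lemma invariant_lincomb:
  assumes "invariant n E F m \<xi> \<eta>" "invariant n E F m \<xi>' \<eta>'"
  shows "invariant n E F m (\<lambda>I. c * \<xi> I + c' * \<xi>' I) (\<lambda>I. c * \<eta> I + c' * \<eta>' I)"
  using invariant_sum[of 2 n E F m "\<lambda>k. if k = 0 then \<xi> else \<xi>'" "\<lambda>k. if k = 0 then \<eta> else \<eta>'" "\<lambda>k. if k = 0 then c else c'"]
    assms by (simp add: numeral_2_eq_2)

lemma invariant_head_cup:
  "invariant n E F m \<xi> \<eta> \<Longrightarrow> invariant n E F (Suc (Suc m)) (head_cup n \<xi>) (head_cup n \<eta>)"
proof (induction rule: invariant.induct)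
  case (invariant_sum N m \<xi> \<eta> c)
  then show ?case by (simp add: head_cup_sum head_cup_scale invariant.invariant_sum)
qed (auto intro: invariant_diagram diagram_head_cup)

lemma invariant_head_cap:
  assumes "invariant n E F (Suc (Suc m)) \<xi> \<eta>"
  shows "invariant n E F m (head_cap n \<xi>) (head_cap n \<eta>)"
  using assms
proof (induction "Suc (Suc m)" \<xi> \<eta> rule: invariant.induct)
  case (invariant_sum N \<xi> \<eta> c)
  then show ?case by (simp add: head_cap_sum head_cap_scale invariant.invariant_sum)
qed (auto intro: invariant_diagram diagram_head_cap)

lemma invariant_proj:
  "invariant n E F m \<xi> \<eta> \<Longrightarrow> Suc (Suc p) \<le> m \<Longrightarrow>
    invariant n E F m (proj n (E c) p \<xi>) (proj n (F c) p \<eta>)"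
proof (induction rule: invariant.induct)
  case (invariant_sum N m \<xi> \<eta> c)
  then show ?case by (simp add: proj_sum proj_scale invariant.invariant_sum)
qed (auto intro: invariant_diagram diagram_proj)

lemma invariant_ev:
  "invariant n E F m \<xi> \<eta> \<Longrightarrow> fits m w \<Longrightarrow> invariant n E F m (ev n E w \<xi>) (ev n F w \<eta>)"
proof (induction w)
  case (Cons x w)
  then show ?case by (cases x) (auto intro: invariant_proj)
qed simp

text \<open>Reversal exchanges the numbers of legs to the left and right of the pair, which are
  \<open>m - Suc (Suc p)\<close> and \<open>p\<close>, and swaps the two legs of the pair, under
  which \<open>kern\<close> is symmetric.\<close>

lemma proj_rev:
  assumes "T \<in> tensors n m" "Suc (Suc p) \<le> m" "(\<lambda>I. proj n e p T (rev I)) \<in> tensors n m"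
    "proj n e (m - Suc (Suc p)) (\<lambda>I. T (rev I)) \<in> tensors n m"
  shows "(\<lambda>I. proj n e p T (rev I)) = proj n e (m - Suc (Suc p)) (\<lambda>I. T (rev I))"
proof
  fix I
  show "proj n e p T (rev I) = proj n e (m - Suc (Suc p)) (\<lambda>I. T (rev I)) I"
  proof (cases "I \<in> tuples n m")
    case False
    then show ?thesis using assms(3,4) by (auto simp: tensors_def)
  next
    case True
    then have l: "length I = m" by (simp add: tuples_def)
    define A where "A = take p I"
    define B where "B = drop (Suc (Suc p)) I"
    have "I = A @ I ! p # I ! Suc p # B"
      using l assms(2) unfolding A_def B_def by (simp add: Cons_nth_drop_Suc Suc_le_lessD)
    then obtain i j where I: "I = A @ i # j # B" by blast
    have A: "length A = p" and B: "length B = m - Suc (Suc p)" using l assms(2) by (auto simp: A_def B_def)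
    have "proj n e p T (rev I) = (\<Sum>a<n. \<Sum>b<n. kern n e j i a b * T (rev B @ a # b # rev A))"
      using proj_append[of n e "rev A" T "rev B" j i] A by (simp add: I)
    also have "\<dots> = (\<Sum>b<n. \<Sum>a<n. kern n e i j b a * T (rev B @ a # b # rev A))"
      by (subst sum.swap) (simp add: kern_sym(2)[of n e i j])
    also have "\<dots> = proj n e (m - Suc (Suc p)) (\<lambda>I. T (rev I)) I"
      using proj_append[of n e B "\<lambda>I. T (rev I)" A i j] B by (simp add: I)
    finally show ?thesis .
  qed
qed

lemma proj_tensor_prod:
  assumes "Suc (Suc p) \<le> k" "\<xi> \<in> tensors n k" "\<zeta> \<in> tensors n m" "A \<in> tuples n k" "B \<in> tuples n m"
  shows "proj n e (p + m) (tensor_prod m \<xi> \<zeta>) (A @ B) = proj n e p \<xi> A * \<zeta> B"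
proof -
  have l: "length A = k" "length B = m" using assms by (simp_all add: tuples_def)
  define q where "q = k - Suc (Suc p)"
  define A1 where "A1 = take q A"
  define A2 where "A2 = drop (Suc (Suc q)) A"
  have "A = A1 @ A ! q # A ! Suc q # A2"
    using l assms(1) unfolding A1_def A2_def q_def by (simp add: Cons_nth_drop_Suc Suc_le_lessD)
  then obtain i j where A: "A = A1 @ i # j # A2" by blast
  have p: "length A2 = p" using l assms(1) by (auto simp: A2_def q_def)
  have "tensor_prod m \<xi> \<zeta> (A1 @ a # b # A2 @ B) = \<xi> (A1 @ a # b # A2) * \<zeta> B" for a b
    using tensor_prod_append[OF l(2), of \<xi> \<zeta> "A1 @ a # b # A2"] by simp
  then show ?thesis
    using proj_append[of n e "A2 @ B" "tensor_prod m \<xi> \<zeta>" A1 i j] proj_append[of n e A2 \<xi> A1 i j] p l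
    by (simp add: A sum_distrib_right mult.assoc)
qed

text \<open>Bending legs turns the vector \<open>\<xi>\<close> on k + l legs into an operator from l
  to k legs; here it acts on the first l legs of \<open>\<zeta>\<close>. The reversal keeps the
  contraction planar.\<close>

definition glue :: "nat \<Rightarrow> nat \<Rightarrow> nat \<Rightarrow> tensor \<Rightarrow> tensor \<Rightarrow> tensor" where
  "glue n k l \<xi> \<zeta> = (\<lambda>I. \<Sum>C\<in>tuples n l. \<xi> (take k I @ rev C) * \<zeta> (C @ drop k I))"

lemma ip_rev: "ip n m (\<lambda>I. T (rev I)) T' = ip n m T (\<lambda>I. T' (rev I))"
  using sum_tuples_rev[of "\<lambda>I. T I * T' (rev I)" n m] by (simp add: ip_def)

text \<open>Reading the bent vector backwards transposes the operator it represents.\<close>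

lemma ip_glue:
  "ip n (k + m) (glue n k l \<eta> \<zeta>) \<theta> = ip n (l + m) \<zeta> (glue n l k (\<lambda>I. \<eta> (rev I)) \<theta>)"
proof -
  have "ip n (k + m) (glue n k l \<eta> \<zeta>) \<theta> =
    (\<Sum>A\<in>tuples n k. \<Sum>B\<in>tuples n m. \<Sum>C\<in>tuples n l. \<eta> (A @ rev C) * \<zeta> (C @ B) * \<theta> (A @ B))"
    by (simp add: ip_def sum_tuples_append glue_def length_tuples sum_distrib_right)
  also have "\<dots> = (\<Sum>A\<in>tuples n k. \<Sum>C\<in>tuples n l. \<Sum>B\<in>tuples n m. \<eta> (A @ rev C) * \<zeta> (C @ B) * \<theta> (A @ B))"
    by (rule sum.cong[OF refl]) (rule sum.swap)
  also have "\<dots> = (\<Sum>C\<in>tuples n l. \<Sum>A\<in>tuples n k. \<Sum>B\<in>tuples n m. \<eta> (A @ rev C) * \<zeta> (C @ B) * \<theta> (A @ B))"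
    by (rule sum.swap)
  also have "\<dots> = (\<Sum>C\<in>tuples n l. \<Sum>B\<in>tuples n m. \<Sum>A\<in>tuples n k. \<eta> (A @ rev C) * \<zeta> (C @ B) * \<theta> (A @ B))"
    by (rule sum.cong[OF refl]) (rule sum.swap)
  also have "\<dots> = ip n (l + m) \<zeta> (glue n l k (\<lambda>I. \<eta> (rev I)) \<theta>)"
    by (simp add: ip_def sum_tuples_append glue_def length_tuples sum_distrib_left mult_ac)
  finally show ?thesis .
qed

locale unbiased_pair = E: unbiased_bases n E + F: unbiased_bases n F
  for n :: nat and E F :: bases
begin

abbreviation "fix_pair \<equiv> invariant n E F"

lemma diagram_tensors: "diagram n E F m \<xi> \<eta> \<Longrightarrow> \<xi> \<in> tensors n m \<and> \<eta> \<in> tensors n m"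
  by (induction rule: diagram.induct)
    (auto intro: unit_tensors head_cup_tensors head_cap_tensors E.proj_tensors F.proj_tensors)

lemma invariant_tensors: "fix_pair m \<xi> \<eta> \<Longrightarrow> \<xi> \<in> tensors n m \<and> \<eta> \<in> tensors n m"
  by (induction rule: invariant.induct)
    (auto intro!: sum_tensors scale_tensors simp: diagram_tensors)

text \<open>Bilinear extension from diagrams to their span. In particular either component of an
  invariant pair determines the other.\<close>

lemma invariant_isometry:
  assumes "fix_pair m \<xi> \<eta>" "fix_pair m \<xi>' \<eta>'"
  shows "ip n m \<xi> \<xi>' = ip n m \<eta> \<eta>'"
  using assms
proof (induction rule: invariant.induct)
  case (invariant_diagram m \<xi> \<eta>)
  from invariant_diagram(2,1) show ?case
  proof (induction rule: invariant.induct)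
    case (invariant_diagram m \<xi>' \<eta>')
    then show ?case using diagram_isometry E.unbiased_bases_axioms F.unbiased_bases_axioms by blast
  qed (simp add: ip_sum_right ip_scale_right)
qed (simp add: ip_sum_left ip_scale_left)

text \<open>Only cups at the head are generators of diagrams; downward induction with
  \<open>cup_shift\<close> reaches every other position by words.\<close>

lemma invariant_cup:
  assumes "fix_pair m \<xi> \<eta>" "p \<le> m"
  shows "fix_pair (Suc (Suc m)) (cup n p \<xi>) (cup n p \<eta>)"
  using assms(2)
proof (induction p rule: inc_induct)
  case base
  show ?case using assms(1) invariant_tensors[OF assms(1)] by (simp add: cup_head invariant_head_cup)
next
  case (step p)
  have "fits (Suc (Suc m)) (cup_cap_word p)" using step by (simp add: cup_cap_word_def)
  then show ?case
    using E.cup_shift[of p m \<xi>] F.cup_shift[of p m \<eta>] step invariant_tensors[OF assms(1)]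
    by (simp add: invariant_scale invariant_ev)
qed

lemma invariant_cap:
  assumes "p \<le> m" "fix_pair (Suc (Suc m)) \<xi> \<eta>"
  shows "fix_pair m (cap n p \<xi>) (cap n p \<eta>)"
  using assms
proof (induction p arbitrary: \<xi> \<eta> rule: inc_induct)
  case base
  then show ?case using invariant_tensors[OF base] by (simp add: cap_head invariant_head_cap)
next
  case (step p)
  have "fits (Suc (Suc m)) (cup_cap_word p)" using step by (simp add: cup_cap_word_def)
  then show ?case
    using E.cap_shift[of p m \<xi>] F.cap_shift[of p m \<eta>] step invariant_tensors[OF step.prems]
    by (simp add: invariant_scale invariant_ev)
qed

text \<open>Cups and caps at the head become cups and caps at position 0, and the projections change
  their positions by \<open>proj_rev\<close>.\<close>

lemma invariant_rev: "fix_pair m \<xi> \<eta> \<Longrightarrow> fix_pair m (\<lambda>I. \<xi> (rev I)) (\<lambda>I. \<eta> (rev I))"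
proof (induction rule: invariant.induct)
  case (invariant_diagram m \<xi> \<eta>)
  then show ?case
  proof (induction rule: diagram.induct)
    case diagram_unit
    have "(\<lambda>I. unit_tensor (rev I)) = unit_tensor" by (simp add: unit_tensor_def)
    then show ?case by (simp add: invariant.invariant_diagram diagram.diagram_unit)
  next
    case (diagram_head_cup m \<xi> \<eta>)
    have *: "(\<lambda>I. head_cup n T (rev I)) = cup n 0 (\<lambda>I. T (rev I))" if T: "T \<in> tensors n m" for T
    proof (rule tensors_append_eqI[of _ n m 2])
      have T': "(\<lambda>I. T (rev I)) \<in> tensors n m" using T by (simp add: tensors_def)
      show "(\<lambda>I. head_cup n T (rev I)) \<in> tensors n (m + 2)"
        using head_cup_tensors[OF T] by (simp add: tensors_def)
      show "cup n 0 (\<lambda>I. T (rev I)) \<in> tensors n (m + 2)"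
        using cup_tensors[OF _ T', of 0] by simp
      fix A B assume A: "A \<in> tuples n m" "B \<in> tuples n 2"
      then obtain i j where B: "B = [i, j]"
        by (auto simp: tuples_def length_Suc_conv numeral_2_eq_2)
      then show "head_cup n T (rev (A @ B)) = cup n 0 (\<lambda>I. T (rev I)) (A @ B)"
        using cup_append[OF T', of A i j "[]"] A append_in_tuples[of A m B n 2]
        by (auto simp: head_cup_def length_tuples)
    qed
    show ?case
      using *[of \<xi>] *[of \<eta>] diagram_tensors[OF diagram_head_cup.hyps] invariant_cup[OF diagram_head_cup.IH, of 0]
      by simp
  next
    case (diagram_head_cap m \<xi> \<eta>)
    have *: "(\<lambda>I. head_cap n T (rev I)) = cap n 0 (\<lambda>I. T (rev I))" if T: "T \<in> tensors n (Suc (Suc m))" for T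
    proof (rule tensors_append_eqI[of _ n m 0])
      have T': "(\<lambda>I. T (rev I)) \<in> tensors n (Suc (Suc m))" using T by (simp add: tensors_def)
      show "(\<lambda>I. head_cap n T (rev I)) \<in> tensors n (m + 0)"
        using head_cap_tensors[OF T] by (simp add: tensors_def)
      show "cap n 0 (\<lambda>I. T (rev I)) \<in> tensors n (m + 0)"
        using cap_tensors[OF _ T', of 0] by simp
      fix A B assume A: "A \<in> tuples n m" "B \<in> tuples n 0"
      then show "head_cap n T (rev (A @ B)) = cap n 0 (\<lambda>I. T (rev I)) (A @ B)"
        using cap_append[OF T', of A "[]"] by (simp add: head_cap_def)
    qed
    show ?case
      using *[of \<xi>] *[of \<eta>] diagram_tensors[OF diagram_head_cap.hyps] invariant_cap[OF _ diagram_head_cap.IH, of 0]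
      by simp
  next
    case (diagram_proj m \<xi> \<eta> p c)
    have t: "(\<lambda>I. T (rev I)) \<in> tensors n m" if "T \<in> tensors n m" for T
      using that by (simp add: tensors_def)
    have x: "\<xi> \<in> tensors n m" "\<eta> \<in> tensors n m" using diagram_tensors[OF diagram_proj.hyps(1)] by auto
    have "fix_pair m (proj n (E c) (m - Suc (Suc p)) (\<lambda>I. \<xi> (rev I))) (proj n (F c) (m - Suc (Suc p)) (\<lambda>I. \<eta> (rev I)))"
      using diagram_proj by (intro invariant_proj) auto
    then show ?case
      using proj_rev[OF x(1) diagram_proj.hyps(2), of "E c"] proj_rev[OF x(2) diagram_proj.hyps(2), of "F c"]
      by (simp add: t E.proj_tensors F.proj_tensors x)
  qed
next
  case (invariant_sum N m \<xi> \<eta> c)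
  then show ?case by (simp add: invariant.invariant_sum)
qed

text \<open>The operations that build the left factor are carried out with the right factor present
  from the start; positions of projections grow by \<open>m\<close>.\<close>

lemma invariant_tensor_prod:
  assumes "fix_pair k \<xi> \<eta>" "fix_pair m \<zeta> \<theta>"
  shows "fix_pair (k + m) (tensor_prod m \<xi> \<zeta>) (tensor_prod m \<eta> \<theta>)"
  using assms
proof (induction rule: invariant.induct)
  case (invariant_diagram k \<xi> \<eta>)
  have zt: "\<zeta> \<in> tensors n m" "\<theta> \<in> tensors n m" using invariant_tensors[OF invariant_diagram.prems] by auto
  from invariant_diagram show ?case
  proof (induction rule: diagram.induct)
    case diagram_unit
    have "tensor_prod m unit_tensor T = T" if "T \<in> tensors n m" for T
      using that tensor_prod_tensors[OF unit_tensors that]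
      by (intro tensors_append_eqI[of _ n 0 m]) (auto simp: tensor_prod_def unit_tensor_def length_tuples)
    then show ?case using diagram_unit zt by simp
  next
    case (diagram_head_cup k \<xi> \<eta>)
    have "tensor_prod m (head_cup n T) S = head_cup n (tensor_prod m T S)"
      if "T \<in> tensors n k" "S \<in> tensors n m" for T S
    proof (rule tensors_append_eqI[of _ n "Suc (Suc k)" m])
      show "tensor_prod m (head_cup n T) S \<in> tensors n (Suc (Suc k) + m)"
        using that by (intro tensor_prod_tensors head_cup_tensors)
      show "head_cup n (tensor_prod m T S) \<in> tensors n (Suc (Suc k) + m)"
        using that by (simp add: tensor_prod_tensors head_cup_tensors)
      fix A B assume A: "A \<in> tuples n (Suc (Suc k))" "B \<in> tuples n m"
      then obtain i j A' where "A = i # j # A'" by (auto simp: tuples_def length_Suc_conv)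
      then show "tensor_prod m (head_cup n T) S (A @ B) = head_cup n (tensor_prod m T S) (A @ B)"
        using A tensor_prod_append[of B m "head_cup n T" S "i # j # A'"]
        by (simp add: tensor_prod_append length_tuples head_cup_def)
    qed
    then show ?case
      using diagram_head_cup diagram_tensors[OF diagram_head_cup.hyps] zt by (simp add: invariant_head_cup)
  next
    case (diagram_head_cap k \<xi> \<eta>)
    have "tensor_prod m (head_cap n T) S = head_cap n (tensor_prod m T S)"
      if "T \<in> tensors n (Suc (Suc k))" "S \<in> tensors n m" for T S
    proof (rule tensors_append_eqI[of _ n k m])
      show "tensor_prod m (head_cap n T) S \<in> tensors n (k + m)"
        using that by (intro tensor_prod_tensors head_cap_tensors)
      have "tensor_prod m T S \<in> tensors n (Suc (Suc (k + m)))"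
        using tensor_prod_tensors[OF that] by simp
      then show "head_cap n (tensor_prod m T S) \<in> tensors n (k + m)"
        by (rule head_cap_tensors)
      fix A B assume A: "A \<in> tuples n k" "B \<in> tuples n m"
      have "tensor_prod m T S (i # i # A @ B) = T (i # i # A) * S B" for i
        using tensor_prod_append[of B m T S "i # i # A"] A by (simp add: length_tuples)
      then show "tensor_prod m (head_cap n T) S (A @ B) = head_cap n (tensor_prod m T S) (A @ B)"
        using A by (simp add: tensor_prod_append length_tuples head_cap_def sum_distrib_right)
    qed
    then show ?case
      using diagram_head_cap diagram_tensors[OF diagram_head_cap.hyps] zt by (simp add: invariant_head_cap)
  next
    case (diagram_proj k \<xi> \<eta> p c)
    note x = diagram_tensors[OF diagram_proj.hyps(1), THEN conjunct1] diagram_tensors[OF diagram_proj.hyps(1), THEN conjunct2]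
    have "tensor_prod m (proj n (E c) p \<xi>) \<zeta> = proj n (E c) (p + m) (tensor_prod m \<xi> \<zeta>)"
      by (rule tensors_append_eqI[of _ n k m])
        (use x zt diagram_proj.hyps(2) in \<open>simp_all add: proj_tensor_prod[where k=k] tensor_prod_append length_tuples
          tensor_prod_tensors E.proj_tensors\<close>)
    moreover have "tensor_prod m (proj n (F c) p \<eta>) \<theta> = proj n (F c) (p + m) (tensor_prod m \<eta> \<theta>)"
      by (rule tensors_append_eqI[of _ n k m])
        (use x zt diagram_proj.hyps(2) in \<open>simp_all add: proj_tensor_prod[where k=k] tensor_prod_append length_tuples
          tensor_prod_tensors F.proj_tensors\<close>)
    ultimately show ?case
      using diagram_proj by (simp add: invariant_proj)
  qed
next
  case (invariant_sum N k \<xi> \<eta> c)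
  have "tensor_prod m (\<lambda>I. \<Sum>k<N. c k * \<xi> k I) \<zeta> = (\<lambda>I. \<Sum>k<N. c k * tensor_prod m (\<xi> k) \<zeta> I)"
    for \<xi> :: "nat \<Rightarrow> tensor" and \<zeta> by (simp add: tensor_prod_def sum_distrib_right mult.assoc)
  then show ?case using invariant_sum by (simp add: invariant.invariant_sum)
qed

lemma invariant_nested_cap:
  assumes "fix_pair (k + 2 * l + m) \<xi> \<eta>"
  shows "fix_pair (k + m) (nested_cap n l k \<xi>) (nested_cap n l k \<eta>)"
  using assms
proof (induction l arbitrary: \<xi> \<eta>)
  case 0
  then show ?case by (simp add: nested_cap_def)
next
  case (Suc l)
  have "fix_pair (k + 2 * l + m) (cap n (l + m) \<xi>) (cap n (l + m) \<eta>)"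
    using Suc.prems by (intro invariant_cap) auto
  then show ?case
    using Suc.IH invariant_tensors[OF Suc.prems] nested_cap_Suc[of \<xi> n k l m] nested_cap_Suc[of \<eta> n k l m] by simp
qed

text \<open>Gluing is a tensor product followed by nested caps, both of which preserve invariant
  pairs.\<close>

lemma invariant_glue:
  assumes "fix_pair (k + l) \<xi> \<eta>" "fix_pair (l + m) \<zeta> \<theta>"
  shows "fix_pair (k + m) (glue n k l \<xi> \<zeta>) (glue n k l \<eta> \<theta>)"
proof -
  have *: "glue n k l T S = nested_cap n l k (tensor_prod (l + m) T S)"
    if "T \<in> tensors n (k + l)" "S \<in> tensors n (l + m)" for T S
  proof (rule tensors_append_eqI[of _ n k m])
    have "tensor_prod (l + m) T S \<in> tensors n (k + 2 * l + m)"
      using tensor_prod_tensors[OF that] by (simp add: add_ac mult_2)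
    then show "nested_cap n l k (tensor_prod (l + m) T S) \<in> tensors n (k + m)"
      by (rule nested_cap_tensors)
    have "T (take k I @ rev C) * S (C @ drop k I) = 0" if "I \<notin> tuples n (k + m)" "C \<in> tuples n l" for I C
    proof -
      have "set (take k I) \<union> set (drop k I) = set I" by (metis append_take_drop_id set_append)
      then have "take k I @ rev C \<notin> tuples n (k + l) \<or> C @ drop k I \<notin> tuples n (l + m)"
        using that by (auto simp: tuples_def min_def split: if_splits)
      then show ?thesis using \<open>T \<in> _\<close> \<open>S \<in> _\<close> by (auto simp: tensorsD)
    qed
    then show "glue n k l T S \<in> tensors n (k + m)"
      by (auto simp: tensors_def glue_def intro!: sum.neutral)
    fix A B assume A: "A \<in> tuples n k" "B \<in> tuples n m"
    have "tensor_prod (l + m) T S (A @ rev C @ C @ B) = T (A @ rev C) * S (C @ B)" if "C \<in> tuples n l" for C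
      using tensor_prod_append[of "C @ B" "l + m" T S "A @ rev C"] A that by (simp add: length_tuples)
    then show "glue n k l T S (A @ B) = nested_cap n l k (tensor_prod (l + m) T S) (A @ B)"
      using A by (simp add: glue_def nested_cap_def length_tuples)
  qed
  have "fix_pair (k + 2 * l + m) (tensor_prod (l + m) \<xi> \<zeta>) (tensor_prod (l + m) \<eta> \<theta>)"
    using invariant_tensor_prod[OF assms] by (simp add: add_ac mult_2)
  then show ?thesis
    using * invariant_tensors[OF assms(1)] invariant_tensors[OF assms(2)] invariant_nested_cap by simp
qed

end

section \<open>The Haar functional\<close>

text \<open>Solvability of the normal equations, by Gram-Schmidt elimination of one vector at a
  time. Linear dependence among the vectors is allowed.\<close>

lemma exists_orthogonal_residual:
  fixes f :: "'b \<Rightarrow> 'x \<Rightarrow> real"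
  assumes "finite B"
  shows "\<exists>d. \<forall>b\<in>B. (\<Sum>x\<in>X. f b x * (c x - (\<Sum>b'\<in>B. d b' * f b' x))) = 0"
  using assms
proof (induction B arbitrary: c)
  case empty
  then show ?case by simp
next
  case (insert b0 B)
  obtain e where e: "\<And>b. b \<in> B \<Longrightarrow> (\<Sum>x\<in>X. f b x * (f b0 x - (\<Sum>b'\<in>B. e b' * f b' x))) = 0"
    using insert.IH[of "f b0"] by blast
  obtain d where d: "\<And>b. b \<in> B \<Longrightarrow> (\<Sum>x\<in>X. f b x * (c x - (\<Sum>b'\<in>B. d b' * f b' x))) = 0"
    using insert.IH[of c] by blast
  define g where "g x = f b0 x - (\<Sum>b'\<in>B. e b' * f b' x)" for x
  define r where "r x = c x - (\<Sum>b'\<in>B. d b' * f b' x)" for x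
  define t where "t = (\<Sum>x\<in>X. g x * r x) / (\<Sum>x\<in>X. g x * g x)"
  \<comment> \<open>\<open>g\<close> already contains the correction of \<open>f b0\<close> by the
    earlier vectors, so subtracting \<open>t\<close> times \<open>g\<close> also changes their
    coefficients by \<open>t * e b\<close>.\<close>
  define d' where "d' b = (if b = b0 then t else d b - t * e b)" for b
  have gB: "(\<Sum>x\<in>X. f b x * g x) = 0" if "b \<in> B" for b using e[OF that] by (simp add: g_def)
  have rB: "(\<Sum>x\<in>X. f b x * r x) = 0" if "b \<in> B" for b using d[OF that] by (simp add: r_def)
  have res: "c x - (\<Sum>b'\<in>insert b0 B. d' b' * f b' x) = r x - t * g x" for x
  proof -
    have "(\<Sum>b'\<in>B. d' b' * f b' x) = (\<Sum>b'\<in>B. (d b' - t * e b') * f b' x)"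
      using insert.hyps by (intro sum.cong) (auto simp: d'_def)
    also have "\<dots> = (\<Sum>b'\<in>B. d b' * f b' x) - t * (\<Sum>b'\<in>B. e b' * f b' x)"
      by (simp add: algebra_simps sum_subtractf sum_distrib_left)
    finally show ?thesis
      using insert.hyps by (simp add: r_def g_def d'_def algebra_simps)
  qed
  have gr: "(\<Sum>x\<in>X. g x * (r x - t * g x)) = 0"
  proof (cases "(\<Sum>x\<in>X. g x * g x) = 0")
    case True
    \<comment> \<open>A vector \<open>g\<close> of norm zero vanishes on \<open>X\<close>, so the
      value that division by zero gives to \<open>t\<close> has no effect.\<close>
    have "g x * (r x - t * g x) = 0" if "x \<in> X" "finite X" for x
      using True that sum_nonneg_eq_0_iff[of X "\<lambda>x. g x * g x"] by auto
    then show ?thesis by (cases "finite X") (auto intro!: sum.neutral)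
  next
    case False
    have "(\<Sum>x\<in>X. g x * (r x - t * g x)) = (\<Sum>x\<in>X. g x * r x) - t * (\<Sum>x\<in>X. g x * g x)"
      by (simp add: right_diff_distrib sum_subtractf mult.left_commute[of "g _" t] sum_distrib_left[symmetric])
    then show ?thesis using False by (simp add: t_def)
  qed
  have B0: "(\<Sum>x\<in>X. f b x * (r x - t * g x)) = 0" if "b \<in> B" for b
    using gB[OF that] rB[OF that]
    by (simp add: right_diff_distrib sum_subtractf mult.left_commute[of _ t] sum_distrib_left[symmetric])
  have "(\<Sum>x\<in>X. f b0 x * (r x - t * g x)) =
      (\<Sum>x\<in>X. g x * (r x - t * g x)) + (\<Sum>x\<in>X. \<Sum>b\<in>B. e b * (f b x * (r x - t * g x)))"
    by (simp add: g_def sum.distrib[symmetric] algebra_simps sum_distrib_left sum_distrib_right sum_subtractf)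
  also have "(\<Sum>x\<in>X. \<Sum>b\<in>B. e b * (f b x * (r x - t * g x))) = (\<Sum>b\<in>B. e b * (\<Sum>x\<in>X. f b x * (r x - t * g x)))"
    by (subst sum.swap) (simp add: sum_distrib_left)
  also have "\<dots> = 0" using B0 by simp
  finally have "(\<Sum>x\<in>X. f b0 x * (r x - t * g x)) = 0" using gr by simp
  then have "\<forall>b\<in>insert b0 B. (\<Sum>x\<in>X. f b x * (c x - (\<Sum>b'\<in>insert b0 B. d' b' * f b' x))) = 0"
    unfolding res using B0 by simp
  then show ?case by blast
qed

section \<open>Corresponding orthonormal bases of invariant vectors\<close>

context unbiased_pair
begin

text \<open>Orthonormality is stated for the first family; \<open>invariant_isometry\<close>
  transfers it to the second.\<close>

definition onb :: "nat \<Rightarrow> nat \<Rightarrow> (nat \<Rightarrow> tensor) \<Rightarrow> (nat \<Rightarrow> tensor) \<Rightarrow> bool" where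
  "onb m d \<xi> \<eta> \<longleftrightarrow> (\<forall>a<d. fix_pair m (\<xi> a) (\<eta> a)) \<and>
     (\<forall>a<d. \<forall>b<d. ip n m (\<xi> a) (\<xi> b) = of_bool (a = b))"

text \<open>Bessel's inequality for each coordinate vector, summed over all coordinates, bounds the
  size of the family by the dimension of the tensor space.\<close>

lemma onb_bound:
  assumes "onb m d \<xi> \<eta>"
  shows "d \<le> card (tuples n m)"
proof -
  have "(\<Sum>a<d. \<xi> a I * \<xi> a I) \<le> 1" if I: "I \<in> tuples n m" for I
  proof -
    let ?d = "\<lambda>J. of_bool (J = I) :: real"
    let ?p = "\<lambda>J. \<Sum>a<d. \<xi> a I * \<xi> a J"
    have d: "ip n m ?d T = T I" for T
      using I by (simp add: ip_def of_bool_def if_distrib[of "\<lambda>x. x * _"] cong: if_cong)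
    have "0 \<le> ip n m (\<lambda>J. ?d J - ?p J) (\<lambda>J. ?d J - ?p J)"
      by (simp add: ip_def sum_nonneg)
    also have "\<dots> = ip n m ?d ?d - 2 * ip n m ?d ?p + ip n m ?p ?p"
      by (simp add: ip_diff_left ip_diff_right ip_sym[of n m ?p ?d])
    also have "ip n m ?p ?p = (\<Sum>a<d. \<xi> a I * \<xi> a I)"
      using assms by (simp add: onb_def ip_sum_left ip_scale_left ip_sum_right ip_scale_right
          of_bool_def if_distrib[of "\<lambda>x. _ * x"] cong: if_cong)
    finally show ?thesis by (simp add: d)
  qed
  then have "(\<Sum>I\<in>tuples n m. \<Sum>a<d. \<xi> a I * \<xi> a I) \<le> (\<Sum>I\<in>tuples n m. 1)"
    by (intro sum_mono)
  also have "(\<Sum>I\<in>tuples n m. \<Sum>a<d. \<xi> a I * \<xi> a I) = (\<Sum>a<d. ip n m (\<xi> a) (\<xi> a))"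
    by (subst sum.swap) (simp add: ip_def)
  finally have "real d \<le> real (card (tuples n m))"
    using assms by (simp add: onb_def)
  then show ?thesis by linarith
qed

lemma ip_eq_0_imp: "T \<in> tensors n m \<Longrightarrow> ip n m T T = 0 \<Longrightarrow> T = (\<lambda>I. 0)"
proof
  fix I assume "T \<in> tensors n m" "ip n m T T = 0"
  then show "T I = 0"
    using sum_nonneg_eq_0_iff[of "tuples n m" "\<lambda>I. T I * T I"]
    by (cases "I \<in> tuples n m") (auto simp: ip_def tensorsD)
qed

text \<open>A family that cannot be enlarged spans: a nonzero residual could be normalised and
  added. The corresponding residual on the other side has the same norm and vanishes too.\<close>

lemma onb_extend:
  assumes o: "onb m d \<xi> \<eta>" and i: "fix_pair m \<zeta> \<theta>" and "\<nexists>\<xi> \<eta>. onb m (Suc d) \<xi> \<eta>"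
  shows "\<zeta> = (\<lambda>I. \<Sum>a<d. ip n m \<zeta> (\<xi> a) * \<xi> a I)" "\<theta> = (\<lambda>I. \<Sum>a<d. ip n m \<theta> (\<eta> a) * \<eta> a I)"
proof -
  let ?r = "\<lambda>I. 1 * \<zeta> I + (-1) * (\<Sum>a<d. ip n m \<zeta> (\<xi> a) * \<xi> a I)"
  \<comment> \<open>The coefficients are those of \<open>\<zeta>\<close>, so that the two residuals
    form an invariant pair.\<close>
  let ?s = "\<lambda>I. 1 * \<theta> I + (-1) * (\<Sum>a<d. ip n m \<zeta> (\<xi> a) * \<eta> a I)"
  have rs: "fix_pair m ?r ?s"
    using o i by (intro invariant_lincomb invariant_sum) (auto simp: onb_def)
  have orth: "ip n m ?r (\<xi> b) = 0" if "b < d" for b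
  proof -
    have "ip n m ?r (\<xi> b) = ip n m \<zeta> (\<xi> b) - (\<Sum>a<d. ip n m \<zeta> (\<xi> a) * ip n m (\<xi> a) (\<xi> b))"
      by (simp add: ip_diff_left ip_sum_left ip_scale_left)
    also have "\<dots> = 0"
      using o that by (simp add: onb_def of_bool_def if_distrib[of "\<lambda>x. _ * x"] cong: if_cong)
    finally show ?thesis .
  qed
  have z: "ip n m ?r ?r = 0"
  proof (rule ccontr)
    assume nz: "ip n m ?r ?r \<noteq> 0"
    have pos: "ip n m ?r ?r > 0" using nz by (simp add: ip_def less_le sum_nonneg)
    define t where "t = inverse (sqrt (ip n m ?r ?r))"
    have t: "t * (t * ip n m ?r ?r) = 1"
      using pos by (simp add: t_def field_simps)
    let ?\<xi> = "\<lambda>a. if a = d then (\<lambda>I. t * ?r I) else \<xi> a"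
    let ?\<eta> = "\<lambda>a. if a = d then (\<lambda>I. t * ?s I) else \<eta> a"
    have "onb m (Suc d) ?\<xi> ?\<eta>"
      unfolding onb_def
    proof (intro conjI allI impI)
      fix a assume "a < Suc d"
      then show "fix_pair m (?\<xi> a) (?\<eta> a)"
        using o invariant_scale[OF rs, of t] by (auto simp: onb_def)
    next
      fix a b assume ab: "a < Suc d" "b < Suc d"
      consider "a = d" "b = d" | "a = d" "b < d" | "a < d" "b = d" | "a < d" "b < d"
        using ab by linarith
      then show "ip n m (?\<xi> a) (?\<xi> b) = of_bool (a = b)"
      proof cases
        case 1
        have "ip n m (\<lambda>I. t * ?r I) (\<lambda>I. t * ?r I) = 1"
          using t by (simp only: ip_scale_left ip_scale_right)
        then show ?thesis using 1 by simp
      next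
        case 2
        have "ip n m (\<lambda>I. t * ?r I) (\<xi> b) = 0"
          using orth[of b] 2 by (simp only: ip_scale_left mult_zero_right)
        then show ?thesis using 2 by simp
      next
        case 3
        have "ip n m (\<xi> a) ?r = 0" using orth[of a] 3 by (simp only: ip_sym)
        then have "ip n m (\<xi> a) (\<lambda>I. t * ?r I) = 0"
          by (simp only: ip_scale_right mult_zero_right)
        then show ?thesis using 3 by simp
      next
        case 4
        then show ?thesis using o by (simp add: onb_def)
      qed
    qed
    then show False using assms(3) by blast
  qed
  have "?r = (\<lambda>I. 0)" by (rule ip_eq_0_imp[of _ m]) (use invariant_tensors[OF rs] z in auto)
  then show "\<zeta> = (\<lambda>I. \<Sum>a<d. ip n m \<zeta> (\<xi> a) * \<xi> a I)" by (simp add: fun_eq_iff)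
  have "ip n m ?s ?s = 0" using z invariant_isometry[OF rs rs] by simp
  then have "?s = (\<lambda>I. 0)" by (intro ip_eq_0_imp[of _ m]) (use invariant_tensors[OF rs] in auto)
  moreover have "ip n m \<theta> (\<eta> a) = ip n m \<zeta> (\<xi> a)" if "a < d" for a
    using o invariant_isometry[OF i, of "\<xi> a" "\<eta> a"] that by (simp add: onb_def)
  ultimately show "\<theta> = (\<lambda>I. \<Sum>a<d. ip n m \<theta> (\<eta> a) * \<eta> a I)" by (simp add: fun_eq_iff)
qed

definition complete_onb :: "nat \<Rightarrow> nat \<Rightarrow> (nat \<Rightarrow> tensor) \<Rightarrow> (nat \<Rightarrow> tensor) \<Rightarrow> bool" where
  "complete_onb m d \<xi> \<eta> \<longleftrightarrow> (\<forall>a<d. fix_pair m (\<xi> a) (\<eta> a)) \<and>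
     (\<forall>\<zeta> \<theta>. fix_pair m \<zeta> \<theta> \<longrightarrow> \<zeta> = (\<lambda>I. \<Sum>a<d. ip n m \<zeta> (\<xi> a) * \<xi> a I) \<and>
       \<theta> = (\<lambda>I. \<Sum>a<d. ip n m \<theta> (\<eta> a) * \<eta> a I))"

lemma complete_onb_exists: "\<exists>d \<xi> \<eta>. complete_onb m d \<xi> \<eta>"
proof -
  have "\<exists>d \<xi> \<eta>. onb m d \<xi> \<eta> \<and> (\<nexists>\<xi> \<eta>. onb m (Suc d) \<xi> \<eta>)"
  proof (rule ccontr)
    assume *: "\<nexists>d \<xi> \<eta>. onb m d \<xi> \<eta> \<and> (\<nexists>\<xi> \<eta>. onb m (Suc d) \<xi> \<eta>)"
    have "\<exists>\<xi> \<eta>. onb m d \<xi> \<eta>" for d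
    proof (induction d)
      case 0
      then show ?case by (simp add: onb_def)
    next
      case (Suc d)
      then show ?case using * by blast
    qed
    then show False using onb_bound[of m "Suc (card (tuples n m))"] by fastforce
  qed
  then obtain d \<xi> \<eta> where o: "onb m d \<xi> \<eta>" "\<nexists>\<xi> \<eta>. onb m (Suc d) \<xi> \<eta>" by blast
  have "complete_onb m d \<xi> \<eta>"
    unfolding complete_onb_def
  proof (intro conjI allI impI)
    show "fix_pair m (\<xi> a) (\<eta> a)" if "a < d" for a using o(1) that by (simp add: onb_def)
  qed (rule onb_extend[OF o(1) _ o(2)], assumption)+
  then show ?thesis by blast
qed

definition dm :: "nat \<Rightarrow> nat" where
  "dm m = (SOME d. \<exists>\<xi> \<eta>. complete_onb m d \<xi> \<eta>)"

definition xi :: "nat \<Rightarrow> nat \<Rightarrow> tensor" where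
  "xi m = (SOME \<xi>. \<exists>\<eta>. complete_onb m (dm m) \<xi> \<eta>)"

definition eta :: "nat \<Rightarrow> nat \<Rightarrow> tensor" where
  "eta m = (SOME \<eta>. complete_onb m (dm m) (xi m) \<eta>)"

lemma complete_onb: "complete_onb m (dm m) (xi m) (eta m)"
proof -
  have "\<exists>\<xi> \<eta>. complete_onb m (dm m) \<xi> \<eta>"
    unfolding dm_def by (rule someI_ex) (rule complete_onb_exists)
  then have "\<exists>\<eta>. complete_onb m (dm m) (xi m) \<eta>"
    unfolding xi_def by (rule someI_ex)
  then show ?thesis unfolding eta_def by (rule someI_ex)
qed

lemma fix_pair_basis: "a < dm m \<Longrightarrow> fix_pair m (xi m a) (eta m a)"
  using complete_onb by (simp add: complete_onb_def)

lemma expand: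
  assumes "fix_pair m \<zeta> \<theta>"
  shows "\<zeta> I = (\<Sum>a<dm m. ip n m \<zeta> (xi m a) * xi m a I)" "\<theta> I = (\<Sum>a<dm m. ip n m \<theta> (eta m a) * eta m a I)"
  using complete_onb[of m] assms unfolding complete_onb_def by metis+

section \<open>The kernel of the functional and the relations it satisfies\<close>

definition haar :: "nat \<Rightarrow> nat list \<Rightarrow> nat list \<Rightarrow> real" where
  "haar m I J = (\<Sum>a<dm m. xi m a I * eta m a J)"

text \<open>Operations preserving invariant pairs can be moved from one argument of the kernel to the other;
  every relation between the generators is an instance of this.\<close>

lemma haar_transfer:
  assumes S: "\<And>\<xi> \<eta>. fix_pair a \<xi> \<eta> \<Longrightarrow> fix_pair b (S2 \<xi>) (S1 \<eta>)"
    and S': "\<And>\<xi> \<eta>. fix_pair b \<xi> \<eta> \<Longrightarrow> fix_pair a (S2' \<xi>) (S1' \<eta>)"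
    and adj: "\<And>\<eta> \<theta>. \<eta> \<in> tensors n a \<Longrightarrow> \<theta> \<in> tensors n b \<Longrightarrow> ip n b (S1 \<eta>) \<theta> = ip n a \<eta> (S1' \<theta>)"
  shows "(\<Sum>x<dm a. S2 (xi a x) I * eta a x J) = (\<Sum>y<dm b. xi b y I * S1' (eta b y) J)"
proof -
  have 1: "ip n b (S2 (xi a x)) (xi b y) = ip n a (S1' (eta b y)) (eta a x)" if "x < dm a" "y < dm b" for x y
  proof -
    have "ip n b (S2 (xi a x)) (xi b y) = ip n b (S1 (eta a x)) (eta b y)"
      using that by (intro invariant_isometry S fix_pair_basis)
    also have "\<dots> = ip n a (eta a x) (S1' (eta b y))"
      using that invariant_tensors fix_pair_basis by (intro adj) blast+
    finally show ?thesis by (simp add: ip_sym)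
  qed
  have "(\<Sum>x<dm a. S2 (xi a x) I * eta a x J) =
     (\<Sum>x<dm a. \<Sum>y<dm b. xi b y I * (ip n a (S1' (eta b y)) (eta a x) * eta a x J))"
  proof (rule sum.cong[OF refl])
    fix x assume "x \<in> {..<dm a}"
    then have x: "x < dm a" by simp
    have "S2 (xi a x) I = (\<Sum>y<dm b. ip n b (S2 (xi a x)) (xi b y) * xi b y I)"
      using expand(1)[OF S[OF fix_pair_basis[OF x]]] .
    also have "\<dots> = (\<Sum>y<dm b. ip n a (S1' (eta b y)) (eta a x) * xi b y I)"
      using 1[OF x] by simp
    finally show "S2 (xi a x) I * eta a x J =
        (\<Sum>y<dm b. xi b y I * (ip n a (S1' (eta b y)) (eta a x) * eta a x J))"
      by (simp add: sum_distrib_right sum_distrib_left mult_ac)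
  qed
  also have "\<dots> = (\<Sum>y<dm b. xi b y I * (\<Sum>x<dm a. ip n a (S1' (eta b y)) (eta a x) * eta a x J))"
    by (subst sum.swap) (simp add: sum_distrib_left)
  also have "\<dots> = (\<Sum>y<dm b. xi b y I * S1' (eta b y) J)"
    using expand(2)[OF S'[OF fix_pair_basis]] by simp
  finally show ?thesis .
qed

lemma haar_eq_0: "I \<notin> tuples n m \<or> J \<notin> tuples n m \<Longrightarrow> haar m I J = 0"
  using invariant_tensors[OF fix_pair_basis] by (fastforce simp: haar_def tensors_def intro!: sum.neutral)

text \<open>Pairing with the empty diagram shows that corresponding basis vectors of rank 0 have
  equal values; expanding the empty diagram then yields 1.\<close>

lemma haar_0: "haar 0 [] [] = 1"
proof -
  have u: "fix_pair 0 unit_tensor unit_tensor" by (intro invariant_diagram diagram_unit)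
  have ip0: "ip n 0 unit_tensor T = T []" for T by (simp add: ip_def unit_tensor_def)
  have "xi 0 a [] = eta 0 a []" if "a < dm 0" for a
    using invariant_isometry[OF u fix_pair_basis[OF that]] by (simp add: ip0)
  then show ?thesis
    using expand(2)[OF u, of "[]"] by (simp add: ip0 haar_def) (simp add: unit_tensor_def)
qed

lemma haar_rev: "haar m (rev I) (rev J) = haar m I J"
  using haar_transfer[of m m "\<lambda>T I. T (rev I)" "\<lambda>T I. T (rev I)" "\<lambda>T I. T (rev I)" "\<lambda>T I. T (rev I)" I "rev J"]
  by (simp add: haar_def invariant_rev ip_rev)

text \<open>The orthogonality of the rows of x, inserted at any place of a word: a cup on one side
  of the kernel becomes a cap on the other. \<open>haar_cap\<close> is the same for columns.\<close>

lemma haar_cup: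
  assumes "i < n" "i' < n" "A @ B \<in> tuples n m" "C @ D \<in> tuples n m" "length B = length D"
  shows "(\<Sum>j<n. haar (Suc (Suc m)) (A @ i # i' # B) (C @ j # j # D)) = of_bool (i = i') * haar m (A @ B) (C @ D)"
proof -
  let ?p = "length D"
  have p: "?p \<le> m" using assms(4) by (auto simp: tuples_def)
  have AB: "A @ i # i' # B \<in> tuples n (Suc (Suc m))" using assms by (auto simp: tuples_def)
  have "(\<Sum>x<dm m. cup n ?p (xi m x) (A @ i # i' # B) * eta m x (C @ D)) =
    (\<Sum>y<dm (Suc (Suc m)). xi (Suc (Suc m)) y (A @ i # i' # B) * cap n ?p (eta (Suc (Suc m)) y) (C @ D))"
    using p by (intro haar_transfer[of m "Suc (Suc m)" "cup n ?p" "cup n ?p" "cap n ?p" "cap n ?p"])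
      (auto simp: invariant_cup invariant_cap ip_cup)
  also have "\<dots> = (\<Sum>j<n. haar (Suc (Suc m)) (A @ i # i' # B) (C @ j # j # D))"
    using invariant_tensors[OF fix_pair_basis] assms(4)
    by (simp add: cap_append[where m=m] haar_def sum_distrib_left sum.swap[of _ "{..<n}"])
  also have "(\<Sum>x<dm m. cup n ?p (xi m x) (A @ i # i' # B) * eta m x (C @ D)) = of_bool (i = i') * haar m (A @ B) (C @ D)"
    using invariant_tensors[OF fix_pair_basis] AB
    by (simp add: assms(5)[symmetric] cup_append[where m=m] haar_def)
  finally show ?thesis by simp
qed

lemma haar_cap:
  assumes "j < n" "j' < n" "A @ B \<in> tuples n m" "C @ D \<in> tuples n m" "length B = length D"
  shows "(\<Sum>i<n. haar (Suc (Suc m)) (A @ i # i # B) (C @ j # j' # D)) = of_bool (j = j') * haar m (A @ B) (C @ D)"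
proof -
  let ?p = "length D"
  have p: "?p \<le> m" using assms(4) by (auto simp: tuples_def)
  have CD: "C @ j # j' # D \<in> tuples n (Suc (Suc m))" using assms by (auto simp: tuples_def)
  have "(\<Sum>x<dm (Suc (Suc m)). cap n ?p (xi (Suc (Suc m)) x) (A @ B) * eta (Suc (Suc m)) x (C @ j # j' # D)) =
    (\<Sum>y<dm m. xi m y (A @ B) * cup n ?p (eta m y) (C @ j # j' # D))"
    using p by (intro haar_transfer[of "Suc (Suc m)" m "cap n ?p" "cap n ?p" "cup n ?p" "cup n ?p"])
      (auto simp: invariant_cup invariant_cap ip_cup ip_sym[of n m "cap _ _ _"] ip_sym[of n "Suc (Suc m)" _ "cup _ _ _"])
  also have "\<dots> = of_bool (j = j') * haar m (A @ B) (C @ D)"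
    using invariant_tensors[OF fix_pair_basis] CD by (simp add: cup_append[where m=m] haar_def sum_distrib_left mult_ac)
  also have "(\<Sum>x<dm (Suc (Suc m)). cap n ?p (xi (Suc (Suc m)) x) (A @ B) * eta (Suc (Suc m)) x (C @ j # j' # D)) =
    (\<Sum>i<n. haar (Suc (Suc m)) (A @ i # i # B) (C @ j # j' # D))"
    using invariant_tensors[OF fix_pair_basis] assms(3)
    by (simp add: assms(5)[symmetric] cap_append[where m=m] haar_def sum_distrib_right sum.swap[of _ "{..<n}"])
  finally show ?thesis .
qed

text \<open>Inside the functional, x tensor x intertwines the projection of \<open>F c\<close> with
  that of \<open>E c\<close>. This relation encodes the vanishing products.\<close>

lemma haar_proj:
  assumes "length A + length B + 2 = m" "length B = length D"
  shows "(\<Sum>a<n. \<Sum>b<n. kern n (E c) i i' a b * haar m (A @ a # b # B) (C @ j # j' # D)) =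
    (\<Sum>a<n. \<Sum>b<n. kern n (F c) j j' a b * haar m (A @ i # i' # B) (C @ a # b # D))"
proof -
  let ?p = "length D"
  have p: "Suc (Suc ?p) \<le> m" using assms by auto
  have "(\<Sum>x<dm m. proj n (E c) ?p (xi m x) (A @ i # i' # B) * eta m x (C @ j # j' # D)) =
    (\<Sum>y<dm m. xi m y (A @ i # i' # B) * proj n (F c) ?p (eta m y) (C @ j # j' # D))"
    using p by (intro haar_transfer[of m m "proj n (E c) ?p" "proj n (F c) ?p" "proj n (E c) ?p" "proj n (F c) ?p"])
      (auto simp: invariant_proj F.ip_proj)
  moreover have "(\<Sum>x<dm m. proj n (E c) ?p (xi m x) (A @ i # i' # B) * eta m x (C @ j # j' # D)) =
    (\<Sum>a<n. \<Sum>b<n. kern n (E c) i i' a b * haar m (A @ a # b # B) (C @ j # j' # D))"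
    by (simp add: assms(2)[symmetric] proj_append haar_def sum_distrib_right sum_distrib_left sum.swap[of _ "{..<n}" "{..<dm m}"] mult_ac)
  moreover have "(\<Sum>y<dm m. xi m y (A @ i # i' # B) * proj n (F c) ?p (eta m y) (C @ j # j' # D)) =
    (\<Sum>a<n. \<Sum>b<n. kern n (F c) j j' a b * haar m (A @ i # i' # B) (C @ a # b # D))"
    by (simp add: proj_append haar_def sum_distrib_right sum_distrib_left sum.swap[of _ "{..<n}" "{..<dm m}"] mult_ac)
  ultimately show ?thesis by simp
qed

text \<open>Every invariant pair, read as a pair of operators from l to k legs, intertwines the
  tensor powers of x in front of an arbitrary word. The first blocks are reversed because adjoints
  of words are.\<close>

lemma haar_glue:
  assumes "fix_pair (k + l) \<xi> \<eta>" "I \<in> tuples n k" "J' \<in> tuples n l" "length I0 = m"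
  shows "(\<Sum>I'\<in>tuples n l. \<xi> (rev I @ I') * haar (l + m) (rev I' @ I0) (rev J' @ J0)) =
    (\<Sum>J\<in>tuples n k. haar (k + m) (rev I @ I0) (rev J @ J0) * \<eta> (rev J @ J'))"
proof -
  have "(\<Sum>x<dm (l + m). glue n k l \<xi> (xi (l + m) x) (rev I @ I0) * eta (l + m) x (rev J' @ J0)) =
    (\<Sum>y<dm (k + m). xi (k + m) y (rev I @ I0) * glue n l k (\<lambda>I. \<eta> (rev I)) (eta (k + m) y) (rev J' @ J0))"
  proof (rule haar_transfer[of "l + m" "k + m" "glue n k l \<xi>" "glue n k l \<eta>" "glue n l k (\<lambda>I. \<xi> (rev I))"])
    have "fix_pair (l + k) (\<lambda>I. \<xi> (rev I)) (\<lambda>I. \<eta> (rev I))"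
      using invariant_rev[OF assms(1)] by (simp add: add.commute)
    then show "fix_pair (l + m) (glue n l k (\<lambda>I. \<xi> (rev I)) \<zeta>) (glue n l k (\<lambda>I. \<eta> (rev I)) \<theta>)"
      if "fix_pair (k + m) \<zeta> \<theta>" for \<zeta> \<theta>
      using invariant_glue that by blast
  qed (use invariant_glue[OF assms(1)] in \<open>auto simp: ip_glue\<close>)
  moreover have "(\<Sum>x<dm (l + m). glue n k l \<xi> (xi (l + m) x) (rev I @ I0) * eta (l + m) x (rev J' @ J0)) =
    (\<Sum>I'\<in>tuples n l. \<xi> (rev I @ I') * haar (l + m) (rev I' @ I0) (rev J' @ J0))"
  proof -
    have "(\<Sum>x<dm (l + m). glue n k l \<xi> (xi (l + m) x) (rev I @ I0) * eta (l + m) x (rev J' @ J0)) =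
      (\<Sum>C\<in>tuples n l. \<xi> (rev I @ rev C) * haar (l + m) (C @ I0) (rev J' @ J0))"
      using length_tuples[OF assms(2)]
      by (simp add: glue_def haar_def sum_distrib_right sum_distrib_left sum.swap[of _ "tuples n l"] mult_ac)
    also have "\<dots> = (\<Sum>I'\<in>tuples n l. \<xi> (rev I @ I') * haar (l + m) (rev I' @ I0) (rev J' @ J0))"
      by (subst sum_tuples_rev[symmetric]) simp
    finally show ?thesis .
  qed
  moreover have "(\<Sum>y<dm (k + m). xi (k + m) y (rev I @ I0) * glue n l k (\<lambda>I. \<eta> (rev I)) (eta (k + m) y) (rev J' @ J0)) =
    (\<Sum>J\<in>tuples n k. haar (k + m) (rev I @ I0) (rev J @ J0) * \<eta> (rev J @ J'))"
  proof -
    have "(\<Sum>y<dm (k + m). xi (k + m) y (rev I @ I0) * glue n l k (\<lambda>I. \<eta> (rev I)) (eta (k + m) y) (rev J' @ J0)) =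
      (\<Sum>C\<in>tuples n k. haar (k + m) (rev I @ I0) (C @ J0) * \<eta> (C @ J'))"
      using length_tuples[OF assms(3)]
      by (simp add: glue_def haar_def sum_distrib_right sum_distrib_left sum.swap[of _ "tuples n k"] mult_ac)
    also have "\<dots> = (\<Sum>J\<in>tuples n k. haar (k + m) (rev I @ I0) (rev J @ J0) * \<eta> (rev J @ J'))"
      by (subst sum_tuples_rev[symmetric]) simp
    finally show ?thesis .
  qed
  ultimately show ?thesis by simp
qed

text \<open>The first indices belong to \<open>E\<close>, the second ones to \<open>F\<close>.\<close>

definition hw :: "(nat \<times> nat) list \<Rightarrow> real" where
  "hw w = haar (length w) (map fst w) (map snd w)"

definition words :: "nat \<Rightarrow> (nat \<times> nat) list set" where
  "words m = {w. map fst w \<in> tuples n m \<and> map snd w \<in> tuples n m}"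

lemma words_eq: "words m = (\<lambda>(I, J). zip I J) ` (tuples n m \<times> tuples n m)"
proof -
  have "w \<in> (\<lambda>(I, J). zip I J) ` (tuples n m \<times> tuples n m)" if "w \<in> words m" for w
    using that by (intro image_eqI[of _ _ "(map fst w, map snd w)"]) (auto simp: words_def zip_map_fst_snd)
  moreover have "zip I J \<in> words m" if "I \<in> tuples n m" "J \<in> tuples n m" for I J
    using that by (simp add: words_def length_tuples)
  ultimately show ?thesis by auto
qed

lemma sum_words: "(\<Sum>w\<in>words m. f w) = (\<Sum>I\<in>tuples n m. \<Sum>J\<in>tuples n m. f (zip I J))"
proof -
  have "inj_on (\<lambda>(I, J). zip I J) (tuples n m \<times> tuples n m)"
    by (auto simp: inj_on_def length_tuples zip_eq_conv)
  then show ?thesis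
    unfolding words_eq by (simp add: sum.reindex sum.cartesian_product case_prod_unfold)
qed

lemma finite_words: "finite (words m)"
  by (simp add: words_eq)

lemma words_length: "w \<in> words m \<Longrightarrow> length w = m"
  by (auto simp: words_def tuples_def)

lemma hw_Nil: "hw [] = 1"
  by (simp add: hw_def haar_0)

lemma hw_rev: "hw (rev w) = hw w"
  using haar_rev[of "length w" "map fst w" "map snd w"] by (simp add: hw_def rev_map)

lemma hw_eq_0: "w \<notin> words (length w) \<Longrightarrow> hw w = 0"
  by (auto simp: hw_def words_def intro: haar_eq_0)


section \<open>Positivity of the functional\<close>

lemma hw_append_rev:
  "length I = k \<Longrightarrow> length J = k \<Longrightarrow> length I' = l \<Longrightarrow> length J' = l \<Longrightarrow>
    hw (rev (zip I J) @ zip I' J') = haar (k + l) (rev I @ I') (rev J @ J')"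
  by (simp add: hw_def rev_map[symmetric])

text \<open>Each column of the Gram matrix intertwines all invariant pairs by
  \<open>haar_glue\<close>, hence so does every linear combination \<open>T\<close> of
  columns.\<close>

lemma hw_intertwiner:
  fixes d :: "(nat \<times> nat) list \<Rightarrow> real"
  assumes "finite V" "V \<subseteq> (\<Union>m. words m)" "fix_pair (k + l) \<xi> \<eta>" "I \<in> tuples n k" "J' \<in> tuples n l"
  defines "T \<equiv> \<lambda>w. \<Sum>v\<in>V. d v * hw (rev w @ v)"
  shows "(\<Sum>I'\<in>tuples n l. \<xi> (rev I @ I') * T (zip I' J')) = (\<Sum>J\<in>tuples n k. T (zip I J) * \<eta> (rev J @ J'))"
proof -
  have "(\<Sum>I'\<in>tuples n l. \<xi> (rev I @ I') * hw (rev (zip I' J') @ v)) =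
      (\<Sum>J\<in>tuples n k. hw (rev (zip I J) @ v) * \<eta> (rev J @ J'))" if v: "v \<in> V" for v
  proof -
    obtain m where "v \<in> words m" using assms(2) v by blast
    then obtain I0 J0 where v: "v = zip I0 J0" "I0 \<in> tuples n m" "J0 \<in> tuples n m" by (auto simp: words_eq)
    then show ?thesis
      using haar_glue[OF assms(3-5), of I0 m J0] assms(4,5) by (simp add: hw_append_rev length_tuples)
  qed
  then have "(\<Sum>v\<in>V. d v * (\<Sum>I'\<in>tuples n l. \<xi> (rev I @ I') * hw (rev (zip I' J') @ v))) =
     (\<Sum>v\<in>V. d v * (\<Sum>J\<in>tuples n k. hw (rev (zip I J) @ v) * \<eta> (rev J @ J')))"
    by simp
  then show ?thesis
    unfolding T_def by (simp add: sum_distrib_left sum_distrib_right sum.swap[of _ V] mult_ac)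
qed

text \<open>After expanding the kernel in the bases, intertwining replaces the factor with \<xi>_a
  by a second copy of the factor with \<eta>_a, and the form becomes a sum of squares.\<close>

lemma hw_pos_intertwiner:
  fixes T :: "(nat \<times> nat) list \<Rightarrow> real"
  assumes T: "\<And>k l \<xi> \<eta> I J'. fix_pair (k + l) \<xi> \<eta> \<Longrightarrow> I \<in> tuples n k \<Longrightarrow> J' \<in> tuples n l \<Longrightarrow>
    (\<Sum>I'\<in>tuples n l. \<xi> (rev I @ I') * T (zip I' J')) = (\<Sum>J\<in>tuples n k. T (zip I J) * \<eta> (rev J @ J'))"
  shows "0 \<le> (\<Sum>w\<in>words k. \<Sum>w'\<in>words l. T w * T w' * hw (rev w @ w'))"
proof -
  let ?x = "xi (k + l)" and ?e = "eta (k + l)" and ?d = "dm (k + l)"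
  let ?I = "tuples n k" and ?J = "tuples n l"
  have "(\<Sum>w\<in>words k. \<Sum>w'\<in>words l. T w * T w' * hw (rev w @ w')) =
     (\<Sum>I\<in>?I. \<Sum>J\<in>?I. \<Sum>I'\<in>?J. \<Sum>J'\<in>?J. \<Sum>a<?d. T (zip I J) * T (zip I' J') * (?x a (rev I @ I') * ?e a (rev J @ J')))"
    by (simp add: sum_words hw_append_rev length_tuples haar_def sum_distrib_left)
  also have "\<dots> = (\<Sum>I\<in>?I. \<Sum>J\<in>?I. \<Sum>J'\<in>?J. \<Sum>I'\<in>?J. \<Sum>a<?d. T (zip I J) * T (zip I' J') * (?x a (rev I @ I') * ?e a (rev J @ J')))"
    by (rule sum.cong[OF refl], rule sum.cong[OF refl]) (rule sum.swap)
  also have "\<dots> = (\<Sum>I\<in>?I. \<Sum>J\<in>?I. \<Sum>J'\<in>?J. \<Sum>a<?d. \<Sum>I'\<in>?J. T (zip I J) * T (zip I' J') * (?x a (rev I @ I') * ?e a (rev J @ J')))"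
    by (rule sum.cong[OF refl], rule sum.cong[OF refl], rule sum.cong[OF refl]) (rule sum.swap)
  also have "\<dots> = (\<Sum>I\<in>?I. \<Sum>J\<in>?I. \<Sum>J'\<in>?J. \<Sum>a<?d. T (zip I J) * ?e a (rev J @ J') *
      (\<Sum>K\<in>?I. T (zip I K) * ?e a (rev K @ J')))"
  proof (intro sum.cong refl)
    fix I J J' a assume "I \<in> ?I" "J \<in> ?I" "J' \<in> ?J" "a \<in> {..<?d}"
    \<comment> \<open>The sum over \<open>I'\<close> against \<xi>_a turns into a sum over
      \<open>K\<close> against \<eta>_a, the same expression as the sum over
      \<open>J\<close>.\<close>
    then have *: "(\<Sum>I'\<in>?J. ?x a (rev I @ I') * T (zip I' J')) = (\<Sum>K\<in>?I. T (zip I K) * ?e a (rev K @ J'))"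
      by (intro T fix_pair_basis) auto
    show "(\<Sum>I'\<in>?J. T (zip I J) * T (zip I' J') * (?x a (rev I @ I') * ?e a (rev J @ J'))) =
      T (zip I J) * ?e a (rev J @ J') * (\<Sum>K\<in>?I. T (zip I K) * ?e a (rev K @ J'))"
      by (simp only: flip: *) (simp add: sum_distrib_left mult_ac)
  qed
  also have "\<dots> = (\<Sum>I\<in>?I. \<Sum>J'\<in>?J. \<Sum>J\<in>?I. \<Sum>a<?d. T (zip I J) * ?e a (rev J @ J') *
      (\<Sum>K\<in>?I. T (zip I K) * ?e a (rev K @ J')))"
    by (rule sum.cong[OF refl]) (rule sum.swap)
  also have "\<dots> = (\<Sum>I\<in>?I. \<Sum>J'\<in>?J. \<Sum>a<?d. \<Sum>J\<in>?I. T (zip I J) * ?e a (rev J @ J') *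
      (\<Sum>K\<in>?I. T (zip I K) * ?e a (rev K @ J')))"
    by (rule sum.cong[OF refl], rule sum.cong[OF refl]) (rule sum.swap)
  also have "\<dots> = (\<Sum>I\<in>?I. \<Sum>J'\<in>?J. \<Sum>a<?d. (\<Sum>K\<in>?I. T (zip I K) * ?e a (rev K @ J'))\<^sup>2)"
    by (simp add: sum_distrib_right[symmetric] power2_eq_square)
  also have "\<dots> \<ge> 0" by (intro sum_nonneg) auto
  finally show ?thesis .
qed

text \<open>The Gram matrix \<open>Q\<close> takes values in intertwiners, on which the form is a sum of squares. Since \<open>Q\<close> is
  symmetric, every vector is \<open>Q d + e\<close> with \<open>Q e = 0\<close>, and \<open>e\<close> does not contribute.\<close>

lemma hw_pos:
  assumes "finite S"
  shows "0 \<le> (\<Sum>w\<in>S. \<Sum>w'\<in>S. c w * c w' * hw (rev w @ w'))"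
proof -
  define K where "K = Max (insert 0 (length ` S))"
  \<comment> \<open>Complete sets \<open>words m\<close> are taken because intertwining sums over
    all tuples. A word of \<open>S\<close> outside \<open>W\<close> has an index out of range, so
    its Gram entries vanish.\<close>
  define W where "W = (\<Union>m\<le>K. words m)"
  have fW: "finite W" by (simp add: W_def finite_words)
  define c0 where "c0 w = (if w \<in> S then c w else 0)" for w
  define Q where "Q w w' = hw (rev w @ w')" for w w'
  have Qsym: "Q w w' = Q w' w" for w w' using hw_rev[of "rev w @ w'"] by (simp add: Q_def)
  have Q0: "Q w w' = 0" if "w \<in> S - W" for w w'
  proof -
    have "length w \<le> K" using that assms by (auto simp: K_def intro: Max_ge)
    then have "w \<notin> words (length w)" using that by (auto simp: W_def)
    then have "rev w @ w' \<notin> words (length (rev w @ w'))"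
      by (auto simp: words_def tuples_def)
    then show ?thesis unfolding Q_def by (rule hw_eq_0)
  qed
  have "(\<Sum>w\<in>S. \<Sum>w'\<in>S. c w * c w' * Q w w') = (\<Sum>w\<in>S \<union> W. \<Sum>w'\<in>S \<union> W. c0 w * c0 w' * Q w w')"
    using assms fW by (intro sum.mono_neutral_cong_left) (auto simp: c0_def intro!: sum.mono_neutral_cong_left)
  also have "\<dots> = (\<Sum>w\<in>W. \<Sum>w'\<in>W. c0 w * c0 w' * Q w w')"
  proof -
    have "(\<Sum>w'\<in>S \<union> W. c0 w * c0 w' * Q w w') = (\<Sum>w'\<in>W. c0 w * c0 w' * Q w w')" for w
      using assms fW Q0 Qsym by (intro sum.mono_neutral_right) auto
    then show ?thesis
      using assms fW Q0 by (simp) (intro sum.mono_neutral_right, auto)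
  qed
  finally have 1: "(\<Sum>w\<in>S. \<Sum>w'\<in>S. c w * c w' * Q w w') = (\<Sum>w\<in>W. \<Sum>w'\<in>W. c0 w * c0 w' * Q w w')" .
  obtain d where d: "\<And>b. b \<in> W \<Longrightarrow> (\<Sum>x\<in>W. Q b x * (c0 x - (\<Sum>b'\<in>W. d b' * Q b' x))) = 0"
    using exists_orthogonal_residual[OF fW, of Q c0 W] by blast
  define T where "T w = (\<Sum>v\<in>W. d v * hw (rev w @ v))" for w
  define e where "e w = c0 w - T w" for w
  have Qe: "(\<Sum>x\<in>W. Q b x * e x) = 0" if "b \<in> W" for b
  proof -
    have "T x = (\<Sum>b'\<in>W. d b' * Q b' x)" for x by (subst Qsym) (simp add: T_def Q_def)
    then show ?thesis using d[OF that] by (simp add: e_def)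
  qed
  have "c0 w * c0 w' * Q w w' = T w * T w' * Q w w' + T w * (Q w w' * e w') + c0 w' * (Q w' w * e w)" for w w'
    using Qsym[of w w'] by (simp add: e_def algebra_simps)
  then have "(\<Sum>w\<in>W. \<Sum>w'\<in>W. c0 w * c0 w' * Q w w') = (\<Sum>w\<in>W. \<Sum>w'\<in>W. T w * T w' * Q w w')
     + (\<Sum>w\<in>W. T w * (\<Sum>w'\<in>W. Q w w' * e w')) + (\<Sum>w\<in>W. \<Sum>w'\<in>W. c0 w' * (Q w' w * e w))"
    by (simp add: sum.distrib sum_distrib_left)
  also have "(\<Sum>w\<in>W. \<Sum>w'\<in>W. c0 w' * (Q w' w * e w)) = (\<Sum>w'\<in>W. c0 w' * (\<Sum>w\<in>W. Q w' w * e w))"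
    by (subst sum.swap) (simp add: sum_distrib_left)
  finally have 2: "(\<Sum>w\<in>W. \<Sum>w'\<in>W. c0 w * c0 w' * Q w w') = (\<Sum>w\<in>W. \<Sum>w'\<in>W. T w * T w' * Q w w')"
    using Qe by simp
  have sW: "(\<Sum>w\<in>W. f w) = (\<Sum>m\<le>K. \<Sum>w\<in>words m. f w)" for f :: "(nat \<times> nat) list \<Rightarrow> real"
    unfolding W_def by (rule sum.UNION_disjoint) (auto simp: finite_words dest: words_length)
  have "(\<Sum>w\<in>W. \<Sum>w'\<in>W. T w * T w' * Q w w') =
    (\<Sum>k\<le>K. \<Sum>l\<le>K. \<Sum>w\<in>words k. \<Sum>w'\<in>words l. T w * T w' * Q w w')"
    unfolding sW by (rule sum.cong[OF refl]) (rule sum.swap)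
  also have "\<dots> \<ge> 0"
    unfolding Q_def
  proof (rule sum_nonneg, rule sum_nonneg, rule hw_pos_intertwiner)
    fix k l \<xi> \<eta> I J' assume a: "fix_pair (k + l) \<xi> \<eta>" "I \<in> tuples n k" "J' \<in> tuples n l"
    have "W \<subseteq> (\<Union>m. words m)" by (auto simp: W_def)
    from hw_intertwiner[OF fW this a, of d] show "(\<Sum>I'\<in>tuples n l. \<xi> (rev I @ I') * T (zip I' J')) = (\<Sum>J\<in>tuples n k. T (zip I J) * \<eta> (rev J @ J'))"
      unfolding T_def .
  qed
  finally show ?thesis using 1 2 by (simp add: Q_def)
qed

text \<open>This is \<open>haar_cup\<close> for words; if \<open>u\<close> or \<open>v\<close>
  contains an index out of range, both sides are 0.\<close>

lemma hw_orth_row: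
  assumes "i < n" "i' < n"
  shows "(\<Sum>j<n. hw (u @ (i, j) # (i', j) # v)) = of_bool (i = i') * hw (u @ v)"
proof (cases "u @ v \<in> words (length (u @ v))")
  case True
  then show ?thesis
    using haar_cup[OF assms, of "map fst u" "map fst v" "length (u @ v)" "map snd u" "map snd v"]
    by (simp add: hw_def words_def)
next
  case False
  have "u @ (i, j) # (i', j) # v \<notin> words (length (u @ (i, j) # (i', j) # v))" for j
    using False by (auto simp: words_def tuples_def)
  then show ?thesis using hw_eq_0 False by simp
qed

lemma hw_orth_col:
  assumes "j < n" "j' < n"
  shows "(\<Sum>i<n. hw (u @ (i, j) # (i, j') # v)) = of_bool (j = j') * hw (u @ v)"
proof (cases "u @ v \<in> words (length (u @ v))")
  case True
  then show ?thesis
    using haar_cap[OF assms, of "map fst u" "map fst v" "length (u @ v)" "map snd u" "map snd v"]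
    by (simp add: hw_def words_def)
next
  case False
  have "u @ (i, j) # (i, j') # v \<notin> words (length (u @ (i, j) # (i, j') # v))" for i
    using False by (auto simp: words_def tuples_def)
  then show ?thesis using hw_eq_0 False by simp
qed

lemma hw_proj:
  "(\<Sum>a<n. \<Sum>b<n. kern n (E c) i i' a b * hw (u @ (a, j) # (b, j') # v)) =
   (\<Sum>a<n. \<Sum>b<n. kern n (F c) j j' a b * hw (u @ (i, a) # (i', b) # v))"
  using haar_proj[of "map fst u" "map fst v" "length u + length v + 2" "map snd v" c i i' "map snd u" j j']
  by (simp add: hw_def)

end

section \<open>Completion of a pre-C*-algebra\<close>

lemma cstar_add_closed:
    "unital_cstar_algebra A \<Longrightarrow> \<forall>x\<in>carrier A. \<forall>y\<in>carrier A. add A x y \<in> carrier A \<and> mult A x y \<in> carrier A"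
  and cstar_add_assoc: "unital_cstar_algebra A \<Longrightarrow> \<forall>x\<in>carrier A. \<forall>y\<in>carrier A. \<forall>z\<in>carrier A.
    add A (add A x y) z = add A x (add A y z)"
  and cstar_add_commute: "unital_cstar_algebra A \<Longrightarrow> \<forall>x\<in>carrier A. \<forall>y\<in>carrier A. add A x y = add A y x"
  and cstar_zero_closed: "unital_cstar_algebra A \<Longrightarrow> zero A \<in> carrier A"
  unfolding unital_cstar_algebra_def by (elim conjE, assumption)+

lemma csum_empty [simp]: "csum A f {} = zero A"
  by (simp add: csum_def)

text \<open>Addition commutes only on the carrier, whereas the fold lemmas ask for commutation at
  every accumulator. Folding with \<open>g\<close>, which is the identity off the carrier, gives the
  same sums and satisfies the law everywhere.\<close>

lemma csum_insert:
  assumes A: "unital_cstar_algebra A" and S: "finite S" "x \<notin> S"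
    and f: "\<And>y. y \<in> insert x S \<Longrightarrow> f y \<in> carrier A"
  shows "csum A f (insert x S) = add A (f x) (csum A f S)"
proof -
  have z: "zero A \<in> carrier A" and closed: "\<And>a b. a \<in> carrier A \<Longrightarrow> b \<in> carrier A \<Longrightarrow> add A a b \<in> carrier A"
    and assoc: "\<And>a b c. a \<in> carrier A \<Longrightarrow> b \<in> carrier A \<Longrightarrow> c \<in> carrier A \<Longrightarrow>
      add A (add A a b) c = add A a (add A b c)"
    and comm: "\<And>a b. a \<in> carrier A \<Longrightarrow> b \<in> carrier A \<Longrightarrow> add A a b = add A b a"
    using cstar_zero_closed[OF A] cstar_add_closed[OF A] cstar_add_assoc[OF A] cstar_add_commute[OF A]
    by blast+
  define g where "g y acc = (if acc \<in> carrier A then add A (f y) acc else acc)" for y acc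
  have lc: "add A a (add A b c) = add A b (add A a c)"
    if "a \<in> carrier A" "b \<in> carrier A" "c \<in> carrier A" for a b c
    using that assoc[of a b c] assoc[of b a c] comm[of a b] by simp
  interpret comp_fun_commute_on "insert x S" g
  proof
    show "g y \<circ> g y' = g y' \<circ> g y" if "y \<in> insert x S" "y' \<in> insert x S" for y y'
      using f that closed lc by (auto simp: g_def fun_eq_iff)
  qed
  have eq: "csum A f S' = Finite_Set.fold g (zero A) S'" if "S' \<subseteq> insert x S" for S'
    unfolding csum_def
    by (rule fold_closed_eq[of _ "carrier A"]) (use that f z closed in \<open>auto simp: g_def\<close>)
  have "Finite_Set.fold g (zero A) S \<in> carrier A"
  proof -
    have "Finite_Set.fold g (zero A) S' \<in> carrier A" if "S' \<subseteq> insert x S" for S'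
    proof -
      have "finite S'" using that S(1) by (meson finite_insert finite_subset)
      then show ?thesis using that
        by (induction S') (use z f closed in \<open>auto simp: g_def\<close>)
    qed
    then show ?thesis by blast
  qed
  then show ?thesis
    using S by (simp add: eq g_def subset_insertI)
qed

text \<open>\<open>N\<close> is a seminorm; elements of seminorm zero become 0 in the completion.
  \<open>code\<close> places sequences in the fixed carrier type, and \<open>cst\<close> embeds the
  scalars centrally.\<close>

locale pre_cstar =
  fixes cst :: "complex \<Rightarrow> 'a::ring_1" and st :: "'a \<Rightarrow> 'a" and N :: "'a \<Rightarrow> real"
    and code :: "(nat \<Rightarrow> 'a) \<Rightarrow> cstar_universe"
  assumes cst_add: "cst (a + b) = cst a + cst b" and cst_mult: "cst (a * b) = cst a * cst b"
    and cst_1: "cst 1 = 1" and cst_comm: "x * cst a = cst a * x"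
    and st_st: "st (st x) = x" and st_add: "st (x + y) = st x + st y"
    and st_mult: "st (x * y) = st y * st x" and st_cst: "st (cst a) = cst (cnj a)"
    and N_nonneg: "N x \<ge> 0" and N_add: "N (x + y) \<le> N x + N y" and N_mult: "N (x * y) \<le> N x * N y"
    and N_cst: "N (cst a * x) = cmod a * N x" and N_st: "N (st x) = N x"
    and N_C: "N (st x * x) = (N x)\<^sup>2" and N_1: "N 1 \<noteq> 0"
    and inj_code: "inj code"
begin

lemma cst_0: "cst 0 = 0"
  using cst_add[of 0 0] by simp

lemma cst_minus_1: "cst (- 1) = - 1"
proof -
  have "cst (- 1) + cst 1 = 0" using cst_add[of "-1" 1] by (simp add: cst_0)
  then show ?thesis by (simp add: cst_1 add_eq_0_iff2)
qed

lemma N_0: "N 0 = 0"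
  using N_cst[of 0 0] by (simp add: cst_0)

lemma N_minus: "N (- x) = N x"
  using N_cst[of "-1" x] by (simp add: cst_minus_1)

lemma N_minus_commute: "N (x - y) = N (y - x)"
  using N_minus[of "x - y"] by simp

lemma N_diff_triangle: "N (x - z) \<le> N (x - y) + N (y - z)"
  using N_add[of "x - y" "y - z"] by simp

lemma N_diff_le: "\<bar>N x - N y\<bar> \<le> N (x - y)"
  using N_add[of "x - y" y] N_add[of "y - x" x] N_minus_commute[of x y] by auto

lemma st_0: "st 0 = 0"
  using st_add[of 0 0] by simp

lemma st_minus: "st (- x) = - st x"
  using st_add[of x "- x"] by (simp add: st_0 minus_unique)

lemma st_diff: "st (x - y) = st x - st y"
  using st_add[of x "- y"] by (simp add: st_minus)

section \<open>Cauchy sequences modulo null sequences\<close>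

definition cauchy :: "(nat \<Rightarrow> 'a) \<Rightarrow> bool" where
  "cauchy s \<longleftrightarrow> (\<forall>e>0. \<exists>M. \<forall>m\<ge>M. \<forall>k\<ge>M. N (s m - s k) < e)"

definition nul :: "(nat \<Rightarrow> 'a) \<Rightarrow> bool" where
  "nul s \<longleftrightarrow> (\<lambda>k. N (s k)) \<longlonglongrightarrow> 0"

lemma cauchyD: "cauchy s \<Longrightarrow> e > 0 \<Longrightarrow> \<exists>M. \<forall>m\<ge>M. \<forall>k\<ge>M. N (s m - s k) < e"
  by (simp add: cauchy_def)

lemma cauchy_const: "cauchy (\<lambda>k. x)"
  by (simp add: cauchy_def N_0)

lemma cauchy_convergent_N: "cauchy s \<Longrightarrow> convergent (\<lambda>k. N (s k))"
proof -
  assume "cauchy s"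
  have "Cauchy (\<lambda>k. N (s k))"
  proof (rule CauchyI)
    fix e :: real assume "e > 0"
    then obtain M where "\<forall>m\<ge>M. \<forall>k\<ge>M. N (s m - s k) < e" using \<open>cauchy s\<close> by (auto simp: cauchy_def)
    then show "\<exists>M. \<forall>m\<ge>M. \<forall>k\<ge>M. norm (N (s m) - N (s k)) < e"
      using le_less_trans[OF N_diff_le] by (intro exI[of _ M]) simp
  qed
  then show ?thesis by (rule Cauchy_convergent)
qed

lemma cauchy_bounded: "cauchy s \<Longrightarrow> \<exists>B>0. \<forall>k. N (s k) \<le> B"
proof -
  assume "cauchy s"
  then have "Bseq (\<lambda>k. N (s k))" using cauchy_convergent_N convergent_imp_Bseq by blast
  then show ?thesis using N_nonneg by (auto simp: Bseq_def)
qed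

lemma cauchy_add: 
  assumes "cauchy s" "cauchy t" shows "cauchy (\<lambda>k. s k + t k)"
  unfolding cauchy_def
proof (intro allI impI)
  fix e :: real assume "e > 0"
  then obtain M1 M2 where M: "\<forall>m\<ge>M1. \<forall>k\<ge>M1. N (s m - s k) < e / 2" "\<forall>m\<ge>M2. \<forall>k\<ge>M2. N (t m - t k) < e / 2"
    using cauchyD[OF assms(1), of "e / 2"] cauchyD[OF assms(2), of "e / 2"] by auto
  have "N (s m + t m - (s k + t k)) < e" if "m \<ge> max M1 M2" "k \<ge> max M1 M2" for m k
  proof -
    have "N (s m + t m - (s k + t k)) \<le> N (s m - s k) + N (t m - t k)"
      using N_add[of "s m - s k" "t m - t k"] by (simp add: algebra_simps)
    also have "\<dots> < e / 2 + e / 2" using M that by (intro add_strict_mono) auto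
    finally show ?thesis by simp
  qed
  then show "\<exists>M. \<forall>m\<ge>M. \<forall>k\<ge>M. N (s m + t m - (s k + t k)) < e" by blast
qed

lemma cauchy_mult:
  assumes "cauchy s" "cauchy t" shows "cauchy (\<lambda>k. s k * t k)"
proof -
  obtain B where B: "B > 0" "\<And>k. N (s k) \<le> B" using cauchy_bounded[OF assms(1)] by blast
  obtain C where C: "C > 0" "\<And>k. N (t k) \<le> C" using cauchy_bounded[OF assms(2)] by blast
  show ?thesis unfolding cauchy_def
  proof (intro allI impI)
    fix e :: real assume e: "e > 0"
    obtain M1 where M1: "\<forall>m\<ge>M1. \<forall>k\<ge>M1. N (s m - s k) < e / 2 / C"
      using cauchyD[OF assms(1), of "e / 2 / C"] e C(1) by auto
    obtain M2 where M2: "\<forall>m\<ge>M2. \<forall>k\<ge>M2. N (t m - t k) < e / 2 / B"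
      using cauchyD[OF assms(2), of "e / 2 / B"] e B(1) by auto
    have "N (s m * t m - s k * t k) < e" if "m \<ge> max M1 M2" "k \<ge> max M1 M2" for m k
    proof -
      have "N (s m * t m - s k * t k) \<le> N ((s m - s k) * t m) + N (s k * (t m - t k))"
        using N_add[of "(s m - s k) * t m" "s k * (t m - t k)"] by (simp add: algebra_simps)
      also have "\<dots> \<le> N (s m - s k) * N (t m) + N (s k) * N (t m - t k)"
        by (intro add_mono N_mult)
      also have "\<dots> \<le> N (s m - s k) * C + B * N (t m - t k)"
        using B C N_nonneg by (intro add_mono mult_left_mono mult_right_mono)
      also have "\<dots> < e / 2 / C * C + B * (e / 2 / B)"
        using M1 M2 that B(1) C(1) by (intro add_strict_mono mult_strict_right_mono mult_strict_left_mono) auto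
      also have "\<dots> = e" using B(1) C(1) by simp
      finally show ?thesis .
    qed
    then show "\<exists>M. \<forall>m\<ge>M. \<forall>k\<ge>M. N (s m * t m - s k * t k) < e" by blast
  qed
qed

lemma cauchy_st: "cauchy s \<Longrightarrow> cauchy (\<lambda>k. st (s k))"
  by (simp add: cauchy_def N_st flip: st_diff)

lemma cauchy_cst: "cauchy s \<Longrightarrow> cauchy (\<lambda>k. cst c * s k)"
  by (rule cauchy_mult[OF cauchy_const])

lemma cauchy_diff: "cauchy s \<Longrightarrow> cauchy t \<Longrightarrow> cauchy (\<lambda>k. s k - t k)"
  using cauchy_add[OF _ cauchy_cst[of t "-1"], of s] by (simp add: cst_minus_1)

lemma nul_le:
  assumes "nul s" "\<And>k. N (t k) \<le> C * N (s k)" shows "nul t"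
proof -
  have "(\<lambda>k. C * N (s k)) \<longlonglongrightarrow> C * 0" using assms(1) unfolding nul_def by (intro tendsto_intros)
  then have "(\<lambda>k. C * N (s k)) \<longlonglongrightarrow> 0" by simp
  then show ?thesis unfolding nul_def
    by (rule tendsto_sandwich[OF _ _ tendsto_const, rotated 2]) (use assms(2) N_nonneg in auto)
qed

lemma nul_add: "nul s \<Longrightarrow> nul t \<Longrightarrow> nul (\<lambda>k. s k + t k)"
proof -
  assume "nul s" "nul t"
  then have "(\<lambda>k. N (s k) + N (t k)) \<longlonglongrightarrow> 0" unfolding nul_def using tendsto_add_zero by blast
  then show ?thesis unfolding nul_def
    by (rule tendsto_sandwich[OF _ _ tendsto_const, rotated 2]) (use N_add N_nonneg in auto)
qed

lemma nul_0: "nul (\<lambda>k. 0)"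
  by (simp add: nul_def N_0)

text \<open>The class of a Cauchy sequence is represented by the code of one chosen member. For sequences
  that are not Cauchy the value is arbitrary.\<close>

definition cl :: "(nat \<Rightarrow> 'a) \<Rightarrow> cstar_universe" where
  "cl s = code (SOME t. cauchy t \<and> nul (\<lambda>k. t k - s k))"

definition dec :: "cstar_universe \<Rightarrow> nat \<Rightarrow> 'a" where
  "dec = inv_into UNIV code"

lemma dec_cl:
  assumes "cauchy s"
  shows "cauchy (dec (cl s))" "nul (\<lambda>k. dec (cl s) k - s k)"
proof -
  have "dec (cl s) = (SOME t. cauchy t \<and> nul (\<lambda>k. t k - s k))"
    using inj_code by (simp add: dec_def cl_def)
  moreover have "cauchy s \<and> nul (\<lambda>k. s k - s k)" using assms nul_0 by simp
  ultimately show "cauchy (dec (cl s))" "nul (\<lambda>k. dec (cl s) k - s k)"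
    using someI[of "\<lambda>t. cauchy t \<and> nul (\<lambda>k. t k - s k)" s] by auto
qed

lemma nul_diff_commute: "nul (\<lambda>k. s k - t k) \<longleftrightarrow> nul (\<lambda>k. t k - s k)"
  unfolding nul_def by (simp add: N_minus_commute)

lemma nul_trans: "nul (\<lambda>k. s k - t k) \<Longrightarrow> nul (\<lambda>k. t k - u k) \<Longrightarrow> nul (\<lambda>k. s k - u k)"
  using nul_add[of "\<lambda>k. s k - t k" "\<lambda>k. t k - u k"] by simp

lemma cl_eq_iff:
  assumes "cauchy s" "cauchy t"
  shows "cl s = cl t \<longleftrightarrow> nul (\<lambda>k. s k - t k)"
proof
  assume "cl s = cl t"
  then have "nul (\<lambda>k. s k - dec (cl s) k)" "nul (\<lambda>k. dec (cl s) k - t k)"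
    using dec_cl[OF assms(1)] dec_cl[OF assms(2)] nul_diff_commute by auto
  then show "nul (\<lambda>k. s k - t k)" by (rule nul_trans)
next
  assume n: "nul (\<lambda>k. s k - t k)"
  then have "nul (\<lambda>k. u k - s k) \<longleftrightarrow> nul (\<lambda>k. u k - t k)" for u
    using nul_trans nul_diff_commute by blast
  then show "cl s = cl t" by (simp add: cl_def)
qed

definition completion :: "cstar_universe cstar" where
  "completion = \<lparr>carrier = cl ` {s. cauchy s}, zero = cl (\<lambda>k. 0), one = cl (\<lambda>k. 1),
     add = (\<lambda>X Y. cl (\<lambda>k. dec X k + dec Y k)), smult = (\<lambda>c X. cl (\<lambda>k. cst c * dec X k)),
     mult = (\<lambda>X Y. cl (\<lambda>k. dec X k * dec Y k)), star = (\<lambda>X. cl (\<lambda>k. st (dec X k))),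
     nrm = (\<lambda>X. lim (\<lambda>k. N (dec X k)))\<rparr>"

lemma completion_carrier: "carrier completion = cl ` {s. cauchy s}"
  and completion_zero: "zero completion = cl (\<lambda>k. 0)"
  and completion_one: "one completion = cl (\<lambda>k. 1)"
  by (simp_all add: completion_def)

lemma completion_add:
  assumes "cauchy s" "cauchy t" shows "add completion (cl s) (cl t) = cl (\<lambda>k. s k + t k)"
proof -
  have "nul (\<lambda>k. (dec (cl s) k - s k) + (dec (cl t) k - t k))" using assms by (intro nul_add dec_cl)
  then have "nul (\<lambda>k. dec (cl s) k + dec (cl t) k - (s k + t k))" by (simp add: algebra_simps)
  then show ?thesis using assms by (simp add: completion_def cl_eq_iff cauchy_add dec_cl)
qed

lemma completion_mult:
  assumes "cauchy s" "cauchy t" shows "mult completion (cl s) (cl t) = cl (\<lambda>k. s k * t k)"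
proof -
  obtain B where B: "\<And>k. N (dec (cl t) k) \<le> B" using cauchy_bounded dec_cl(1)[OF assms(2)] by blast
  obtain C where C: "\<And>k. N (s k) \<le> C" using cauchy_bounded[OF assms(1)] by blast
  have "nul (\<lambda>k. (dec (cl s) k - s k) * dec (cl t) k)"
    by (rule nul_le[OF dec_cl(2)[OF assms(1)], of _ B])
      (rule order_trans[OF N_mult], use B N_nonneg in \<open>simp add: mult.commute mult_right_mono\<close>)
  moreover have "nul (\<lambda>k. s k * (dec (cl t) k - t k))"
    by (rule nul_le[OF dec_cl(2)[OF assms(2)], of _ C])
      (rule order_trans[OF N_mult], use C N_nonneg in \<open>simp add: mult_right_mono\<close>)
  ultimately have "nul (\<lambda>k. (dec (cl s) k - s k) * dec (cl t) k + s k * (dec (cl t) k - t k))"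
    by (rule nul_add)
  then have "nul (\<lambda>k. dec (cl s) k * dec (cl t) k - s k * t k)" by (simp add: algebra_simps)
  then show ?thesis using assms by (simp add: completion_def cl_eq_iff cauchy_mult dec_cl)
qed

lemma completion_smult:
  assumes "cauchy s" shows "smult completion c (cl s) = cl (\<lambda>k. cst c * s k)"
proof -
  have "nul (\<lambda>k. cst c * (dec (cl s) k - s k))"
    by (rule nul_le[OF dec_cl(2)[OF assms], of _ "cmod c"]) (simp add: N_cst)
  then have "nul (\<lambda>k. cst c * dec (cl s) k - cst c * s k)" by (simp add: algebra_simps)
  then show ?thesis using assms by (simp add: completion_def cl_eq_iff cauchy_cst dec_cl)
qed

lemma completion_star:
  assumes "cauchy s" shows "star completion (cl s) = cl (\<lambda>k. st (s k))"
proof -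
  have "nul (\<lambda>k. st (dec (cl s) k - s k))"
    by (rule nul_le[OF dec_cl(2)[OF assms], of _ 1]) (simp add: N_st)
  then have "nul (\<lambda>k. st (dec (cl s) k) - st (s k))" by (simp add: st_diff)
  then show ?thesis using assms by (simp add: completion_def cl_eq_iff cauchy_st dec_cl)
qed

lemma lim_N: "cauchy s \<Longrightarrow> (\<lambda>k. N (s k)) \<longlonglongrightarrow> lim (\<lambda>k. N (s k))"
  using cauchy_convergent_N convergent_LIMSEQ_iff by blast

lemma completion_nrm:
  assumes "cauchy s" shows "nrm completion (cl s) = lim (\<lambda>k. N (s k))"
proof -
  have d: "cauchy (dec (cl s))" "nul (\<lambda>k. dec (cl s) k - s k)" using dec_cl[OF assms] .
  have "(\<lambda>k. N (dec (cl s) k) - N (s k)) \<longlonglongrightarrow> 0"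
    by (rule tendsto_rabs_zero_cancel,
        rule tendsto_sandwich[OF _ _ tendsto_const d(2)[unfolded nul_def]]) (use N_diff_le in auto)
  then have "lim (\<lambda>k. N (dec (cl s) k)) - lim (\<lambda>k. N (s k)) = 0"
    using LIMSEQ_unique[OF tendsto_diff[OF lim_N[OF d(1)] lim_N[OF assms]]] by blast
  then show ?thesis by (simp add: completion_def)
qed

lemma completion_csub:
  "cauchy s \<Longrightarrow> cauchy t \<Longrightarrow> csub completion (cl s) (cl t) = cl (\<lambda>k. s k - t k)"
  using completion_add[OF _ cauchy_cst[of t "-1"], of s] by (simp add: csub_def completion_smult cst_minus_1)

text \<open>A diagonal argument: from the k-th representative one member \<open>x k\<close> is
  chosen within 1/(k+1) of its class. These members form a Cauchy sequence whose class is the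
  limit.\<close>

lemma completion_complete:
  fixes f :: "nat \<Rightarrow> cstar_universe"
  assumes f: "\<And>k. f k \<in> carrier completion"
    and C: "\<And>e. e > 0 \<Longrightarrow> \<exists>M. \<forall>m\<ge>M. \<forall>k\<ge>M. nrm completion (csub completion (f m) (f k)) < e"
  shows "\<exists>x\<in>carrier completion. \<forall>e>0. \<exists>M. \<forall>k\<ge>M. nrm completion (csub completion (f k) x) < e"
proof -
  define D where "D s t = lim (\<lambda>k. N (s k - t k))" for s t
  have Dl: "(\<lambda>k. N (s k - t k)) \<longlonglongrightarrow> D s t" if "cauchy s" "cauchy t" for s t
    unfolding D_def using lim_N[OF cauchy_diff[OF that]] .
  have D: "nrm completion (csub completion (cl s) (cl t)) = D s t" if "cauchy s" "cauchy t" for s t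
    using that by (simp add: completion_csub completion_nrm cauchy_diff D_def)
  have Dtri: "D s u \<le> D s t + D t u" if "cauchy s" "cauchy t" "cauchy u" for s t u
    by (rule LIMSEQ_le[OF Dl[OF that(1,3)] tendsto_add[OF Dl[OF that(1,2)] Dl[OF that(2,3)]]])
      (use N_diff_triangle in auto)
  have Dcomm: "D s t = D t s" for s t by (simp add: D_def N_minus_commute)
  have "\<forall>k. \<exists>s. cauchy s \<and> f k = cl s" using f by (auto simp: completion_carrier)
  then obtain s where s: "\<And>k. cauchy (s k)" "\<And>k. f k = cl (s k)" by metis
  have "\<exists>j. D (s k) (\<lambda>_. s k j) \<le> 1 / Suc k" for k
  proof -
    obtain j where j: "\<forall>m\<ge>j. \<forall>i\<ge>j. N (s k m - s k i) < 1 / Suc k"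
      using cauchyD[OF s(1)[of k], of "1 / Suc k"] by auto
    have "D (s k) (\<lambda>_. s k j) \<le> 1 / Suc k"
      by (rule LIMSEQ_le_const2[OF Dl[OF s(1) cauchy_const]]) (use j in \<open>auto intro!: exI[of _ j] less_imp_le\<close>)
    then show ?thesis by blast
  qed
  then obtain j where j: "\<And>k. D (s k) (\<lambda>_. s k (j k)) \<le> 1 / Suc k" by metis
  define x where "x k = s k (j k)" for k
  have Dx: "D (\<lambda>_. x m) (\<lambda>_. x k) = N (x m - x k)" for m k by (simp add: D_def)
  have small: "\<exists>M. \<forall>k\<ge>M. 1 / real (Suc k) < e" if e: "e > 0" for e
  proof -
    obtain M where M: "inverse (real (Suc M)) < e" using reals_Archimedean[OF e] by blast
    have "1 / real (Suc k) < e" if "k \<ge> M" for k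
    proof -
      have "1 / real (Suc k) \<le> 1 / real (Suc M)" using that by (intro divide_left_mono) auto
      then show ?thesis using M by (simp add: inverse_eq_divide)
    qed
    then show ?thesis by blast
  qed
  have cx: "cauchy x" unfolding cauchy_def
  proof (intro allI impI)
    fix e :: real assume e: "e > 0"
    obtain M1 where M1: "\<forall>k\<ge>M1. 1 / real (Suc k) < e / 3" using small[of "e / 3"] e by auto
    obtain M2 where M2: "\<forall>m\<ge>M2. \<forall>k\<ge>M2. nrm completion (csub completion (f m) (f k)) < e / 3"
      using C[of "e / 3"] e by auto
    have "N (x m - x k) < e" if "m \<ge> max M1 M2" "k \<ge> max M1 M2" for m k
    proof -
      have "N (x m - x k) \<le> D (\<lambda>_. x m) (s m) + D (s m) (\<lambda>_. x k)"
        unfolding Dx[symmetric] by (intro Dtri cauchy_const s(1))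
      also have "D (s m) (\<lambda>_. x k) \<le> D (s m) (s k) + D (s k) (\<lambda>_. x k)"
        by (intro Dtri cauchy_const s(1))
      also have "D (\<lambda>_. x m) (s m) < e / 3"
        using le_less_trans[OF j[of m], of "e / 3"] M1 that Dcomm[of "\<lambda>_. x m" "s m"] by (simp add: x_def)
      moreover have "D (s k) (\<lambda>_. x k) < e / 3"
        using le_less_trans[OF j[of k], of "e / 3"] M1 that by (simp add: x_def)
      moreover have "nrm completion (csub completion (f m) (f k)) < e / 3"
        using M2 that by simp
      then have "D (s m) (s k) < e / 3"
        using D[OF s(1) s(1), of m k] by (simp add: s(2))
      ultimately show ?thesis by linarith
    qed
    then show "\<exists>M. \<forall>m\<ge>M. \<forall>k\<ge>M. N (x m - x k) < e" by blast
  qed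
  have "\<exists>M. \<forall>k\<ge>M. nrm completion (csub completion (f k) (cl x)) < e" if e: "e > 0" for e
  proof -
    obtain M1 where M1: "\<forall>k\<ge>M1. 1 / real (Suc k) < e / 2" using small[of "e / 2"] e by auto
    obtain M2 where M2: "\<forall>m\<ge>M2. \<forall>k\<ge>M2. N (x m - x k) < e / 2"
      using cauchyD[OF cx, of "e / 2"] e by auto
    have "nrm completion (csub completion (f k) (cl x)) < e" if "k \<ge> max M1 M2" for k
    proof -
      have "nrm completion (csub completion (f k) (cl x)) = D (s k) x"
        using D[OF s(1) cx, of k] by (simp add: s(2))
      also have "\<dots> \<le> D (s k) (\<lambda>_. x k) + D (\<lambda>_. x k) x"
        by (intro Dtri cauchy_const s(1) cx)
      also have "D (\<lambda>_. x k) x \<le> e / 2"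
        by (rule LIMSEQ_le_const2[OF Dl[OF cauchy_const cx]]) (use M2 that in \<open>auto intro!: exI[of _ M2] less_imp_le\<close>)
      also have "D (s k) (\<lambda>_. x k) < e / 2"
        using le_less_trans[OF j[of k], of "e / 2"] M1 that by (simp add: x_def)
      finally show ?thesis by simp
    qed
    then show ?thesis by blast
  qed
  then show ?thesis using cx by (auto simp: completion_carrier)
qed

lemma completion_nrm_nonneg: "cauchy s \<Longrightarrow> nrm completion (cl s) \<ge> 0"
  using LIMSEQ_le_const[OF lim_N] N_nonneg by (fastforce simp: completion_nrm)

lemma completion_nrm_eq_0:
  assumes "cauchy s" shows "nrm completion (cl s) = 0 \<longleftrightarrow> cl s = cl (\<lambda>k. 0)"
proof -
  have "lim (\<lambda>k. N (s k)) = 0 \<longleftrightarrow> nul s"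
    unfolding nul_def using lim_N[OF assms] limI[of "\<lambda>k. N (s k)" 0] by metis
  then show ?thesis by (simp add: completion_nrm[OF assms] cl_eq_iff[OF assms cauchy_const])
qed

lemma completion_nrm_add:
  assumes "cauchy s" "cauchy t"
  shows "nrm completion (cl (\<lambda>k. s k + t k)) \<le> nrm completion (cl s) + nrm completion (cl t)"
  using LIMSEQ_le[OF lim_N[OF cauchy_add[OF assms]] tendsto_add[OF lim_N[OF assms(1)] lim_N[OF assms(2)]]] N_add
  by (simp add: completion_nrm assms cauchy_add)

lemma completion_nrm_mult:
  assumes "cauchy s" "cauchy t"
  shows "nrm completion (cl (\<lambda>k. s k * t k)) \<le> nrm completion (cl s) * nrm completion (cl t)"
  using LIMSEQ_le[OF lim_N[OF cauchy_mult[OF assms]] tendsto_mult[OF lim_N[OF assms(1)] lim_N[OF assms(2)]]] N_mult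
  by (simp add: completion_nrm assms cauchy_mult)

lemma completion_nrm_cst:
  assumes "cauchy s"
  shows "nrm completion (cl (\<lambda>k. cst c * s k)) = cmod c * nrm completion (cl s)"
  using limI[OF tendsto_mult[OF tendsto_const lim_N[OF assms]], of "cmod c"]
  by (simp add: completion_nrm assms cauchy_cst N_cst)

lemma completion_nrm_C:
  assumes "cauchy s"
  shows "nrm completion (cl (\<lambda>k. st (s k) * s k)) = (nrm completion (cl s))\<^sup>2"
  using limI[OF tendsto_power[OF lim_N[OF assms], of 2]]
  by (simp add: completion_nrm assms cauchy_mult cauchy_st N_C)

lemma completion_one_neq_zero: "one completion \<noteq> zero completion"
proof
  assume "one completion = zero completion"
  then have "nul (\<lambda>k. 1)" by (simp add: completion_one completion_zero cl_eq_iff cauchy_const)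
  then show False using N_1 LIMSEQ_unique[OF tendsto_const] by (fastforce simp: nul_def)
qed

lemmas completion_ops = completion_add completion_mult completion_smult completion_star
  completion_zero completion_one cauchy_add cauchy_mult cauchy_st cauchy_cst cauchy_const

lemma unital_cstar_completion: "unital_cstar_algebra completion"
  unfolding unital_cstar_algebra_def completion_carrier ball_simps(9) mem_Collect_eq
proof (intro conjI allI ballI impI)
  show "one completion \<noteq> zero completion" by (rule completion_one_neq_zero)
next
  fix f :: "nat \<Rightarrow> cstar_universe" assume "\<forall>k. f k \<in> cl ` {s. cauchy s}"
    "\<forall>e>0. \<exists>N. \<forall>m\<ge>N. \<forall>k\<ge>N. nrm completion (csub completion (f m) (f k)) < e"
  then show "\<exists>x\<in>cl ` {s. cauchy s}. \<forall>e>0. \<exists>N. \<forall>k\<ge>N. nrm completion (csub completion (f k) x) < e"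
    using completion_complete[of f] by (simp add: completion_carrier)
next
  fix a s t assume "s \<in> Collect cauchy" "t \<in> Collect cauchy"
  moreover have "x * (cst a * y) = cst a * (x * y)" for x y
    by (simp add: cst_comm flip: mult.assoc)
  ultimately show "mult completion (cl s) (smult completion a (cl t)) = smult completion a (mult completion (cl s) (cl t))"
    by (simp add: completion_ops)
next
  fix s assume "s \<in> Collect cauchy"
  then show "add completion (cl s) (smult completion (- 1) (cl s)) = zero completion"
    using completion_add[OF _ cauchy_cst[of s "-1"], of s]
    by (simp add: completion_smult completion_zero cst_minus_1)
next
  fix a s assume "s \<in> Collect cauchy"
  then show "star completion (smult completion a (cl s)) = smult completion (cnj a) (star completion (cl s))"
    by (simp add: completion_ops st_mult st_cst cst_comm)
qed (simp_all add: completion_ops completion_nrm_nonneg completion_nrm_eq_0 completion_nrm_add completion_nrm_mult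
    completion_nrm_cst completion_nrm_C cst_add cst_mult cst_1 cst_minus_1 st_st st_add st_mult
    add_ac distrib_left distrib_right mult.assoc)

definition emb :: "'a \<Rightarrow> cstar_universe" where
  "emb x = cl (\<lambda>k. x)"

lemma emb_carrier: "emb x \<in> carrier completion"
  by (simp add: emb_def completion_carrier cauchy_const)

lemma emb_simps:
  "add completion (emb x) (emb y) = emb (x + y)" "mult completion (emb x) (emb y) = emb (x * y)"
  "star completion (emb x) = emb (st x)" "zero completion = emb 0" "one completion = emb 1"
  by (simp_all add: emb_def completion_ops)

lemma emb_eqI: "N (x - y) = 0 \<Longrightarrow> emb x = emb y"
  by (simp add: emb_def cl_eq_iff cauchy_const nul_def)

lemma csum_emb: "finite S \<Longrightarrow> csum completion (\<lambda>x. emb (f x)) S = emb (sum f S)"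
  by (induction S rule: finite_induct)
    (simp_all add: emb_simps csum_insert unital_cstar_completion emb_carrier)

end

section \<open>The GNS construction on the free algebra\<close>

text \<open>A wrapper for lists on which concatenation is \<open>+\<close>, so that the convolution
  product of polynomial mappings is the product of the free algebra.\<close>

datatype 'l fword = FWord (letters: "'l list")

instance fword :: (countable) countable
  by countable_datatype

instantiation fword :: (type) monoid_add
begin

definition "0 = FWord []"

definition "u + v = FWord (letters u @ letters v)"

instance
  by standard (simp_all add: zero_fword_def plus_fword_def)

end

type_synonym 'l falg = "'l fword \<Rightarrow>\<^sub>0 complex"

definition scal :: "complex \<Rightarrow> 'l falg" where
  "scal c = Poly_Mapping.single 0 c"

definition mon :: "'l list \<Rightarrow> 'l falg" where
  "mon w = Poly_Mapping.single (FWord w) 1"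

definition frev :: "'l fword \<Rightarrow> 'l fword" where
  "frev u = FWord (rev (letters u))"

definition fstar :: "'l falg \<Rightarrow> 'l falg" where
  "fstar a = (\<Sum>k\<in>Poly_Mapping.keys a. Poly_Mapping.single (frev k) (cnj (Poly_Mapping.lookup a k)))"

definition lin :: "('l list \<Rightarrow> real) \<Rightarrow> 'l falg \<Rightarrow> complex" where
  "lin h a = (\<Sum>k\<in>Poly_Mapping.keys a. Poly_Mapping.lookup a k * of_real (h (letters k)))"

lemma falg_eq_sum: "(\<Sum>k\<in>Poly_Mapping.keys a. Poly_Mapping.single k (Poly_Mapping.lookup a k)) = a"
  by (rule poly_mapping_eqI)
    (simp add: lookup_sum lookup_single when_def in_keys_iff)

lemma falg_induct [case_names single add]:
  assumes s: "\<And>k c. P (Poly_Mapping.single k c)" and a: "\<And>x y. P x \<Longrightarrow> P y \<Longrightarrow> P (x + y)"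
  shows "P (x :: 'l falg)"
proof -
  have "P (\<Sum>k\<in>K. Poly_Mapping.single k (Poly_Mapping.lookup x k))" if "finite K" for K
    \<comment> \<open>The empty sum is covered by a monomial with coefficient 0.\<close>
    using that by induction (use s[of undefined 0] s a in auto)
  then show ?thesis using falg_eq_sum[of x] by (metis finite_keys)
qed

lemma frev_simps [simp]: "frev (frev k) = k" "frev (k + l) = frev l + frev k" "frev 0 = 0"
  by (simp_all add: frev_def plus_fword_def zero_fword_def)

lemma fstar_single: "fstar (Poly_Mapping.single k c) = Poly_Mapping.single (frev k) (cnj c)"
  by (simp add: fstar_def)

lemma fstar_add: "fstar (x + y) = fstar x + fstar y"
  unfolding fstar_def by (rule setsum_keys_plus_distrib) (simp_all add: single_add)

lemma fstar_fstar: "fstar (fstar x) = x"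
  by (induction x rule: falg_induct) (simp_all add: fstar_single fstar_add)

lemma fstar_mult: "fstar (x * y) = fstar y * fstar x"
proof (induction x rule: falg_induct)
  case (single k c)
  show ?case
    by (induction y rule: falg_induct) (simp_all add: fstar_single fstar_add mult_single distrib_left distrib_right mult.commute)
qed (simp add: fstar_add distrib_left distrib_right)

lemma fstar_scal: "fstar (scal c) = scal (cnj c)"
  by (simp add: scal_def fstar_single)

lemma fstar_mon: "fstar (mon w) = mon (rev w)"
  by (simp add: mon_def fstar_single frev_def)

lemma fstar_0: "fstar 0 = 0"
  by (simp add: fstar_def)

lemma fstar_sum: "fstar (sum f S) = (\<Sum>x\<in>S. fstar (f x))"
  by (induction S rule: infinite_finite_induct) (simp_all add: fstar_0 fstar_add)

lemma mon_mult: "mon u * mon v = mon (u @ v)"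
  by (simp add: mon_def mult_single plus_fword_def)

lemma mon_Nil: "mon [] = 1"
  by (simp add: mon_def flip: zero_fword_def)

lemma scal_comm: "x * scal c = scal c * x"
  by (induction x rule: falg_induct) (simp_all add: scal_def mult_single distrib_left distrib_right mult.commute)

lemma scal_simps: "scal (a + b) = scal a + scal b" "scal (a * b) = scal a * scal b" "scal 1 = 1" "scal 0 = 0"
  by (simp_all add: scal_def single_add mult_single)

lemma single_eq: "Poly_Mapping.single k c = scal c * mon (letters k)"
  by (simp add: scal_def mon_def mult_single)

lemma lin_single: "lin h (Poly_Mapping.single k c) = c * of_real (h (letters k))"
  by (simp add: lin_def)

lemma lin_add: "lin h (x + y) = lin h x + lin h y"
  unfolding lin_def by (rule setsum_keys_plus_distrib) (simp_all add: distrib_right)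

lemma lin_0: "lin h 0 = 0"
  by (simp add: lin_def)

lemma lin_sum: "lin h (sum f S) = (\<Sum>x\<in>S. lin h (f x))"
  by (induction S rule: infinite_finite_induct) (simp_all add: lin_0 lin_add)

lemma lin_scal: "lin h (scal c * x) = c * lin h x"
  by (induction x rule: falg_induct) (simp_all add: scal_def mult_single lin_single lin_add distrib_left)

lemma lin_mon: "lin h (mon w) = of_real (h w)"
  by (simp add: mon_def lin_single)

lemma lin_minus: "lin h (- x) = - lin h x"
  using lin_add[of h x "- x"] by (simp add: lin_0 add_eq_0_iff)

lemma lin_diff: "lin h (x - y) = lin h x - lin h y"
  using lin_add[of h x "- y"] by (simp add: lin_minus)

lemma lin_eq_0I:
  assumes "\<And>u v. lin h (mon u * a * mon v) = 0"
  shows "lin h (x * a * y) = 0"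
proof (induction x rule: falg_induct)
  case (single k c)
  show ?case
  proof (induction y rule: falg_induct)
    case (single l d)
    have "Poly_Mapping.single k c * a * Poly_Mapping.single l d =
      scal c * (scal d * (mon (letters k) * a * mon (letters l)))"
    proof -
      have "mon (letters k) * a * (scal d * mon (letters l)) = scal d * (mon (letters k) * a) * mon (letters l)"
        by (simp only: mult.assoc[symmetric] scal_comm[of "mon (letters k) * a"])
      then show ?thesis unfolding single_eq by (simp only: mult.assoc)
    qed
    then show ?case by (simp add: lin_scal assms)
  qed (simp add: distrib_left lin_add)
qed (simp add: distrib_right lin_add)

lemma lin_sandwich:
  "lin h (fstar x * (mon v * y)) = (\<Sum>k\<in>Poly_Mapping.keys x. \<Sum>l\<in>Poly_Mapping.keys y.
     cnj (Poly_Mapping.lookup x k) * Poly_Mapping.lookup y l * of_real (h (rev (letters k) @ v @ letters l)))"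
proof -
  have "fstar x * (mon v * y) = fstar x * (mon v * (\<Sum>l\<in>Poly_Mapping.keys y. Poly_Mapping.single l (Poly_Mapping.lookup y l)))"
    by (simp add: falg_eq_sum)
  also have "\<dots> = (\<Sum>k\<in>Poly_Mapping.keys x. \<Sum>l\<in>Poly_Mapping.keys y.
     Poly_Mapping.single (frev k) (cnj (Poly_Mapping.lookup x k)) * (mon v * Poly_Mapping.single l (Poly_Mapping.lookup y l)))"
    by (simp add: fstar_def sum_distrib_left sum_distrib_right) (rule sum.swap)
  finally show ?thesis
    by (simp add: lin_sum mon_def mult_single lin_single plus_fword_def frev_def)
qed

text \<open>\<open>h_bound\<close> says that the square of a letter is at most 1 in the form, so
  letters will act as contractions. Real coefficients suffice because \<open>h\<close> is
  real.\<close>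

locale word_state =
  fixes h :: "'l::countable list \<Rightarrow> real"
  assumes h_Nil: "h [] = 1" and h_rev: "h (rev w) = h w"
    and h_pos: "finite S \<Longrightarrow> 0 \<le> (\<Sum>w\<in>S. \<Sum>w'\<in>S. c w * c w' * h (rev w @ w'))"
    and h_bound: "finite S \<Longrightarrow> (\<Sum>w\<in>S. \<Sum>w'\<in>S. c w * c w' * h (rev w @ [x, x] @ w')) \<le>
      (\<Sum>w\<in>S. \<Sum>w'\<in>S. c w * c w' * h (rev w @ w'))"
begin

definition sip :: "'l falg \<Rightarrow> 'l falg \<Rightarrow> complex" where
  "sip x y = lin h (fstar x * y)"

definition sq :: "'l falg \<Rightarrow> real" where
  "sq x = Re (sip x x)"

lemma lin_fstar: "lin h (fstar x) = cnj (lin h x)"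
  by (induction x rule: falg_induct) (simp_all add: fstar_single fstar_add lin_single lin_add frev_def h_rev)

lemma sip_cnj: "cnj (sip x y) = sip y x"
  unfolding sip_def lin_fstar[symmetric] by (simp add: fstar_mult fstar_fstar)

lemma sip_add: "sip x (y + z) = sip x y + sip x z" "sip (x + y) z = sip x z + sip y z"
  by (simp_all add: sip_def fstar_add distrib_left distrib_right lin_add)

lemma sip_scal: "sip x (scal c * y) = c * sip x y" "sip (scal c * x) y = cnj c * sip x y"
proof -
  show 1: "sip x (scal c * y) = c * sip x y" for x y
    unfolding sip_def by (metis lin_scal mult.assoc scal_comm)
  show "sip (scal c * x) y = cnj c * sip x y"
    by (metis 1 complex_cnj_mult sip_cnj)
qed

lemma sip_mult_left: "sip (a * x) y = sip x (fstar a * y)"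
  by (simp add: sip_def fstar_mult mult.assoc)

lemma sip_self: "sip x x = of_real (sq x)"
proof -
  have "Im (sip x x) = 0" using sip_cnj[of x x] by (metis cnj.simps(2) neg_equal_zero)
  then show ?thesis by (simp add: sq_def complex_eq_iff)
qed

text \<open>The real part of cnj a times b is Re a Re b + Im a Im b, so the complex form is the sum
  of two real ones.\<close>

lemma Re_quadratic:
  assumes "finite K"
  shows "Re (\<Sum>k\<in>K. \<Sum>l\<in>K. cnj (f k) * f l * of_real (g (letters k) (letters l))) =
    (\<Sum>w\<in>letters ` K. \<Sum>w'\<in>letters ` K. Re (f (FWord w)) * Re (f (FWord w')) * g w w') +
    (\<Sum>w\<in>letters ` K. \<Sum>w'\<in>letters ` K. Im (f (FWord w)) * Im (f (FWord w')) * g w w')"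
proof -
  have "inj_on letters K" by (auto simp: inj_on_def fword.expand)
  then show ?thesis
    by (simp add: sum.reindex sum.distrib[symmetric] algebra_simps)
qed

lemma sq_nonneg: "sq x \<ge> 0"
proof -
  have "sip x x = (\<Sum>k\<in>Poly_Mapping.keys x. \<Sum>l\<in>Poly_Mapping.keys x.
      cnj (Poly_Mapping.lookup x k) * Poly_Mapping.lookup x l * of_real (h (rev (letters k) @ letters l)))"
    using lin_sandwich[of h x "[]" x] by (simp add: sip_def mon_Nil)
  then show ?thesis
    unfolding sq_def using Re_quadratic[OF finite_keys, of "Poly_Mapping.lookup x" "\<lambda>w w'. h (rev w @ w')" x]
    by (simp add: h_pos)
qed

text \<open>Letters are self-adjoint, since \<open>fstar\<close> only reverses words; hence the left
  side is the form with the letter squared in the middle.\<close>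

lemma sq_letter_le: "sq (mon [a] * x) \<le> sq x"
proof -
  have "sip (mon [a] * x) (mon [a] * x) = lin h (fstar x * (mon [a, a] * x))"
  proof -
    have "mon [a] * (mon [a] * x) = mon [a, a] * x"
      by (simp only: mult.assoc[symmetric] mon_mult append.simps)
    then show ?thesis by (simp only: sip_def fstar_mult fstar_mon mult.assoc rev.simps append.simps)
  qed
  then have 1: "sip (mon [a] * x) (mon [a] * x) = (\<Sum>k\<in>Poly_Mapping.keys x. \<Sum>l\<in>Poly_Mapping.keys x.
      cnj (Poly_Mapping.lookup x k) * Poly_Mapping.lookup x l * of_real (h (rev (letters k) @ [a, a] @ letters l)))"
    by (simp add: lin_sandwich)
  have 2: "sip x x = (\<Sum>k\<in>Poly_Mapping.keys x. \<Sum>l\<in>Poly_Mapping.keys x.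
      cnj (Poly_Mapping.lookup x k) * Poly_Mapping.lookup x l * of_real (h (rev (letters k) @ letters l)))"
    using lin_sandwich[of h x "[]" x] by (simp add: sip_def mon_Nil)
  show ?thesis
    unfolding sq_def 1 2
      Re_quadratic[OF finite_keys, of "Poly_Mapping.lookup x" "\<lambda>w w'. h (rev w @ [a, a] @ w')" x]
      Re_quadratic[OF finite_keys, of "Poly_Mapping.lookup x" "\<lambda>w w'. h (rev w @ w')" x]
    by (intro add_mono h_bound) auto
qed

lemma sq_add_scal: "sq (x + scal c * y) = sq x + 2 * Re (c * sip x y) + (cmod c)\<^sup>2 * sq y"
proof -
  have "sip (x + scal c * y) (x + scal c * y) = sip x x + (c * sip x y + cnj (c * sip x y)) + (c * cnj c) * sip y y"
    by (simp add: sip_add sip_scal sip_cnj algebra_simps)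
  then have "of_real (sq (x + scal c * y)) =
      of_real (sq x) + of_real (2 * Re (c * sip x y)) + of_real ((cmod c)\<^sup>2) * (of_real (sq y) :: complex)"
    by (simp only: sip_self complex_add_cnj complex_norm_square)
  then show ?thesis
    by (simp only: of_real_add[symmetric] of_real_mult[symmetric] of_real_eq_iff)
qed

lemma cauchy_schwarz_sq: "(cmod (sip x y))\<^sup>2 \<le> sq x * sq y"
proof -
  let ?s = "sip x y"
  have *: "0 \<le> sq x - 2 * r * (cmod ?s)\<^sup>2 + r\<^sup>2 * (cmod ?s)\<^sup>2 * sq y" for r :: real
  proof -
    have "0 \<le> sq (x + scal (- of_real r * cnj ?s) * y)" by (rule sq_nonneg)
    also have "\<dots> = sq x + 2 * Re (- of_real r * cnj ?s * ?s) + (cmod (- of_real r * cnj ?s))\<^sup>2 * sq y"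
      by (rule sq_add_scal)
    also have "- of_real r * cnj ?s * ?s = of_real (- r * (cmod ?s)\<^sup>2)"
      by (metis (no_types) complex_norm_square mult.assoc mult.commute of_real_minus of_real_mult)
    finally show ?thesis by (simp add: norm_mult power_mult_distrib algebra_simps)
  qed
  show ?thesis
  proof (cases "sq y = 0")
    case True
    have "cmod ?s = 0"
    proof (rule ccontr)
      assume s: "cmod ?s \<noteq> 0"
      \<comment> \<open>The value of \<open>r\<close> is chosen to make the right side equal to
        -1.\<close>
      have "0 \<le> sq x - 2 * ((sq x + 1) / (2 * (cmod ?s)\<^sup>2)) * (cmod ?s)\<^sup>2"
        using *[of "(sq x + 1) / (2 * (cmod ?s)\<^sup>2)"] True by simp
      then show False using s by (simp add: field_simps)
    qed
    then show ?thesis using True by simp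
  next
    case False
    then have "sq y > 0" using sq_nonneg[of y] by simp
    then show ?thesis
      using *[of "1 / sq y"] by (simp add: field_simps power2_eq_square)
  qed
qed

definition nx :: "'l falg \<Rightarrow> real" where
  "nx x = sqrt (sq x)"

lemma nx_nonneg: "nx x \<ge> 0"
  by (simp add: nx_def sq_nonneg)

lemma nx_square: "(nx x)\<^sup>2 = sq x"
  by (simp add: nx_def sq_nonneg)

lemma cauchy_schwarz: "cmod (sip x y) \<le> nx x * nx y"
  by (rule power2_le_imp_le) (simp_all add: power_mult_distrib nx_square cauchy_schwarz_sq nx_nonneg)

lemma nx_add: "nx (x + y) \<le> nx x + nx y"
proof (rule power2_le_imp_le)
  have "(nx (x + y))\<^sup>2 = sq x + 2 * Re (sip x y) + sq y"
    using sq_add_scal[of x 1 y] by (simp add: nx_square scal_simps)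
  also have "Re (sip x y) \<le> nx x * nx y"
    using complex_Re_le_cmod cauchy_schwarz order_trans by blast
  finally show "(nx (x + y))\<^sup>2 \<le> (nx x + nx y)\<^sup>2"
    by (simp add: power2_sum nx_square algebra_simps)
qed (simp add: nx_nonneg)

lemma nx_scal: "nx (scal c * x) = cmod c * nx x"
proof -
  have "sip (scal c * x) (scal c * x) = of_real ((cmod c)\<^sup>2 * sq x)"
    by (simp only: sip_scal sip_self[of x] of_real_mult complex_norm_square mult.assoc)
  then have "sq (scal c * x) = (cmod c)\<^sup>2 * sq x" by (metis Re_complex_of_real sq_def)
  then show ?thesis by (simp add: nx_def real_sqrt_mult)
qed

text \<open>Bounds for left multiplication with respect to the GNS seminorm \<open>nx\<close>. The
  algebra itself serves as the representation space, without passing to a Hilbert space.\<close>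

definition opbound :: "'l falg \<Rightarrow> real \<Rightarrow> bool" where
  "opbound a C \<longleftrightarrow> C \<ge> 0 \<and> (\<forall>x. nx (a * x) \<le> C * nx x)"

lemma opbound_add:
  assumes "opbound a C" "opbound b D" shows "opbound (a + b) (C + D)"
proof -
  have "nx ((a + b) * x) \<le> (C + D) * nx x" for x
  proof -
    have "nx ((a + b) * x) \<le> nx (a * x) + nx (b * x)" by (simp add: distrib_right nx_add)
    also have "\<dots> \<le> C * nx x + D * nx x" using assms by (intro add_mono) (auto simp: opbound_def)
    finally show ?thesis by (simp add: distrib_right)
  qed
  then show ?thesis using assms by (simp add: opbound_def)
qed

lemma opbound_mult: 
  assumes "opbound a C" "opbound b D" shows "opbound (a * b) (C * D)"
proof -
  have "nx (a * b * x) \<le> C * D * nx x" for x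
  proof -
    have "nx (a * b * x) \<le> C * nx (b * x)" using assms(1) by (simp add: opbound_def mult.assoc)
    also have "\<dots> \<le> C * (D * nx x)" using assms by (intro mult_left_mono) (auto simp: opbound_def)
    finally show ?thesis by (simp add: mult.assoc)
  qed
  then show ?thesis using assms by (simp add: opbound_def)
qed

lemma opbound_scal: "opbound (scal c) (cmod c)"
  by (simp add: opbound_def nx_scal)

lemma opbound_mon: "opbound (mon w) 1"
proof (induction w)
  case Nil
  then show ?case by (simp add: opbound_def mon_Nil)
next
  case (Cons a w)
  have "opbound (mon [a]) 1" by (simp add: opbound_def nx_def sq_letter_le)
  from opbound_mult[OF this Cons] show ?case by (simp add: mon_mult)
qed

lemma opbound_exists: "\<exists>C. opbound a C"
proof (induction a rule: falg_induct)
  case (single k c)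
  then show ?case unfolding single_eq using opbound_mult[OF opbound_scal opbound_mon] by blast
next
  case (add x y)
  then show ?case using opbound_add by blast
qed

definition opnorm :: "'l falg \<Rightarrow> real" where
  "opnorm a = Inf {C. opbound a C}"

lemma bdd_below_opbound: "bdd_below {C. opbound a C}"
  by (rule bdd_belowI[of _ 0]) (simp add: opbound_def)

lemma opnorm_le: "opbound a C \<Longrightarrow> opnorm a \<le> C"
  unfolding opnorm_def by (rule cInf_lower) (simp_all add: bdd_below_opbound)

lemma opbound_opnorm: "opbound a (opnorm a)"
proof -
  have ne: "{C. opbound a C} \<noteq> {}" using opbound_exists by blast
  have "0 \<le> opnorm a" unfolding opnorm_def by (rule cInf_greatest[OF ne]) (simp add: opbound_def)
  moreover have "nx (a * x) \<le> opnorm a * nx x" for x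
  proof (cases "nx x = 0")
    case True
    then show ?thesis using opbound_exists[of a] by (metis mult_zero_right opbound_def)
  next
    case False
    then have pos: "nx x > 0" using nx_nonneg[of x] by simp
    have "nx (a * x) / nx x \<le> opnorm a" unfolding opnorm_def
      by (rule cInf_greatest[OF ne]) (use pos in \<open>auto simp: opbound_def field_simps\<close>)
    then show ?thesis using pos by (simp add: field_simps)
  qed
  ultimately show ?thesis by (simp add: opbound_def)
qed

lemma opnorm_nonneg: "opnorm a \<ge> 0"
  using opbound_opnorm by (simp add: opbound_def)

lemma nx_mult_le: "nx (a * x) \<le> opnorm a * nx x"
  using opbound_opnorm by (simp add: opbound_def)

lemma opnorm_add: "opnorm (a + b) \<le> opnorm a + opnorm b"
  by (intro opnorm_le opbound_add opbound_opnorm)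

lemma opnorm_mult: "opnorm (a * b) \<le> opnorm a * opnorm b"
  by (intro opnorm_le opbound_mult opbound_opnorm)

lemma opnorm_scal: "opnorm (scal c * a) = cmod c * opnorm a"
proof (rule antisym)
  show le: "opnorm (scal c * a) \<le> cmod c * opnorm a" for c a
    by (intro opnorm_le opbound_mult opbound_scal opbound_opnorm)
  show "cmod c * opnorm a \<le> opnorm (scal c * a)"
  proof (cases "c = 0")
    case False
    have "opnorm a = opnorm (scal (inverse c) * (scal c * a))"
      by (simp only: mult.assoc[symmetric] scal_simps(2)[symmetric] left_inverse[OF False] scal_simps(3) mult_1)
    also have "\<dots> \<le> cmod (inverse c) * opnorm (scal c * a)" by (rule le)
    finally have "opnorm a \<le> inverse (cmod c) * opnorm (scal c * a)" by (simp only: norm_inverse)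
    then show ?thesis using False by (simp add: field_simps)
  qed (simp add: opnorm_nonneg)
qed

text \<open>\<open>sq (a * x)\<close> is the inner product of \<open>x\<close> with
  \<open>fstar a * a * x\<close>, to which Cauchy-Schwarz applies.\<close>

lemma opnorm_square_le: "(opnorm a)\<^sup>2 \<le> opnorm (fstar a * a)"
proof -
  have "opbound a (sqrt (opnorm (fstar a * a)))"
    unfolding opbound_def
  proof (intro conjI allI)
    fix x
    have "(nx (a * x))\<^sup>2 = Re (sip x (fstar a * a * x))"
      by (simp add: nx_square sq_def sip_mult_left mult.assoc)
    also have "\<dots> \<le> nx x * nx (fstar a * a * x)"
      using complex_Re_le_cmod cauchy_schwarz order_trans by blast
    also have "\<dots> \<le> nx x * (opnorm (fstar a * a) * nx x)"
      by (intro mult_left_mono nx_mult_le nx_nonneg)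
    finally have "(nx (a * x))\<^sup>2 \<le> (sqrt (opnorm (fstar a * a)) * nx x)\<^sup>2"
      by (simp add: power_mult_distrib opnorm_nonneg power2_eq_square[of "nx x"] mult_ac)
    then show "nx (a * x) \<le> sqrt (opnorm (fstar a * a)) * nx x"
      by (rule power2_le_imp_le) (simp add: nx_nonneg opnorm_nonneg)
  qed (simp add: opnorm_nonneg)
  then have "opnorm a \<le> sqrt (opnorm (fstar a * a))" by (rule opnorm_le)
  then show ?thesis using real_le_rsqrt power_mono[OF _ opnorm_nonneg, of a _ 2] opnorm_nonneg by fastforce
qed

text \<open>The previous inequality and submultiplicativity give one estimate after cancelling
  \<open>opnorm b\<close>; applying it to \<open>a\<close> and to \<open>fstar a\<close> gives
  equality.\<close>

lemma opnorm_fstar: "opnorm (fstar a) = opnorm a"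
proof -
  have "opnorm b \<le> opnorm (fstar b)" for b
  proof (cases "opnorm b = 0")
    case False
    have "opnorm b * opnorm b \<le> opnorm (fstar b) * opnorm b"
      using order_trans[OF opnorm_square_le opnorm_mult] by (simp add: power2_eq_square)
    then show ?thesis using False opnorm_nonneg[of b] by simp
  qed (simp add: opnorm_nonneg)
  from this[of a] this[of "fstar a"] show ?thesis by (simp add: fstar_fstar)
qed

lemma opnorm_C: "opnorm (fstar a * a) = (opnorm a)\<^sup>2"
  using opnorm_square_le[of a] opnorm_mult[of "fstar a" a] by (simp add: opnorm_fstar power2_eq_square)

lemma opnorm_1: "opnorm 1 \<noteq> 0"
proof
  assume "opnorm 1 = 0"
  then have "nx 1 = 0" using nx_mult_le[of 1 1] nx_nonneg[of 1] by simp
  moreover have "sq 1 = 1"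
    by (simp add: sq_def sip_def mon_Nil[symmetric] fstar_mon mon_mult lin_mon h_Nil)
  ultimately show False by (simp add: nx_def)
qed

text \<open>There are countably many words, so a sequence of algebra elements is a countable table
  of coefficients. It is stored at the natural numbers on the real axis, the argument being rounded
  down elsewhere.\<close>

definition code :: "(nat \<Rightarrow> 'l falg) \<Rightarrow> cstar_universe" where
  "code s = (\<lambda>z. case prod_decode (nat \<lfloor>Re z\<rfloor>) of (i, k) \<Rightarrow> Poly_Mapping.lookup (s i) (from_nat k))"

lemma inj_code: "inj code"
proof (rule injI)
  fix s t assume eq: "code s = code t"
  have "Poly_Mapping.lookup (s i) w = Poly_Mapping.lookup (t i) w" for i w
    using fun_cong[OF eq, of "of_nat (prod_encode (i, to_nat w))"] by (simp add: code_def)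
  then show "s = t" by (auto intro!: ext poly_mapping_eqI)
qed

sublocale pre_cstar scal fstar opnorm code
  by unfold_locales
    (rule scal_simps scal_comm fstar_fstar fstar_add fstar_mult fstar_scal opnorm_nonneg opnorm_add
      opnorm_mult opnorm_scal opnorm_fstar opnorm_C opnorm_1 inj_code)+

text \<open>If \<open>h\<close> vanishes on the ideal generated by \<open>a\<close>, it vanishes at
  every \<open>fstar (a * x) * (a * x)\<close>, so left multiplication by \<open>a\<close> is zero
  for \<open>nx\<close>.\<close>

lemma opnorm_eq_0I:
  assumes "\<And>u v. lin h (mon u * a * mon v) = 0"
  shows "opnorm a = 0"
proof -
  have "nx (a * x) = 0" for x
    using lin_eq_0I[OF assms, of "fstar (a * x)" x] by (simp add: nx_def sq_def sip_def mult.assoc)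
  then have "opbound a 0" by (simp add: opbound_def)
  then show ?thesis using opnorm_le[of a 0] opnorm_nonneg[of a] by simp
qed

end

section \<open>The quantum isomorphism\<close>

text \<open>Relative to its own basis the projection is diagonal: it fixes e_k tensor e_k and
  annihilates e_k tensor e_m for different k and m.\<close>

lemma (in unbiased_bases) sum_kern:
  assumes "k < n" "m < n"
  shows "(\<Sum>i<n. \<Sum>i'<n. E c k i * E c m i' * kern n (E c) i i' a b) = of_bool (k = m) * (E c k a * E c k b)"
proof -
  have "(\<Sum>i<n. \<Sum>i'<n. E c k i * E c m i' * kern n (E c) i i' a b) =
      (\<Sum>i<n. \<Sum>i'<n. \<Sum>p<n. (E c k i * E c p i) * (E c m i' * E c p i') * (E c p a * E c p b))"
    by (simp add: kern_def sum_distrib_left mult_ac)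
  also have "\<dots> = (\<Sum>i<n. \<Sum>p<n. \<Sum>i'<n. (E c k i * E c p i) * (E c m i' * E c p i') * (E c p a * E c p b))"
    by (rule sum.cong[OF refl]) (rule sum.swap)
  also have "\<dots> = (\<Sum>p<n. \<Sum>i<n. \<Sum>i'<n. (E c k i * E c p i) * (E c m i' * E c p i') * (E c p a * E c p b))"
    by (rule sum.swap)
  also have "\<dots> = (\<Sum>p<n. (\<Sum>i<n. E c k i * E c p i) * (\<Sum>i'<n. E c m i' * E c p i') * (E c p a * E c p b))"
    by (simp only: sum_product) (simp only: sum_distrib_right)
  also have "\<dots> = (\<Sum>p<n. of_bool (p = k) * (of_bool (m = p) * (E c p a * E c p b)))"
    using assms by (intro sum.cong refl) (auto simp: orth)
  also have "\<dots> = of_bool (k = m) * (E c k a * E c k b)"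
    using assms by (auto simp: sum_delta_scale)
  finally show ?thesis .
qed

section \<open>Relations between the generators in the completed algebra\<close>

context unbiased_pair
begin

text \<open>The squares in a row of x add up to 1 and each gives a nonnegative form, so a single
  square is at most 1. Letters with an index out of range contribute 0.\<close>

lemma hw_bound:
  assumes "finite S"
  shows "(\<Sum>w\<in>S. \<Sum>w'\<in>S. c w * c w' * hw (rev w @ [x, x] @ w')) \<le> (\<Sum>w\<in>S. \<Sum>w'\<in>S. c w * c w' * hw (rev w @ w'))"
proof -
  let ?B = "\<lambda>x. \<Sum>w\<in>S. \<Sum>w'\<in>S. c w * c w' * hw (rev w @ [x, x] @ w')"
  obtain i j where x: "x = (i, j)" by (cases x)
  have pos: "0 \<le> ?B y" for y
  proof -
    \<comment> \<open>Prefixing \<open>y\<close> to all words puts \<open>[y, y]\<close> in the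
      middle of \<open>rev w @ w'\<close>.\<close>
    have "0 \<le> (\<Sum>w\<in>Cons y ` S. \<Sum>w'\<in>Cons y ` S. c (tl w) * c (tl w') * hw (rev w @ w'))"
      by (rule hw_pos) (use assms in auto)
    then show ?thesis by (simp add: sum.reindex)
  qed
  show ?thesis
  proof (cases "i < n \<and> j < n")
    case True
    have "?B x \<le> (\<Sum>j<n. ?B (i, j))"
      unfolding x using True pos by (intro member_le_sum) auto
    also have "\<dots> = (\<Sum>w\<in>S. \<Sum>w'\<in>S. c w * c w' * (\<Sum>j<n. hw (rev w @ [(i, j), (i, j)] @ w')))"
      by (simp add: sum.swap[of _ "{..<n}"] sum_distrib_left)
    also have "\<dots> = (\<Sum>w\<in>S. \<Sum>w'\<in>S. c w * c w' * hw (rev w @ w'))"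
      using True hw_orth_row[of i i] by simp
    finally show ?thesis .
  next
    case False
    have "hw (rev w @ [x, x] @ w') = 0" for w w'
      using False by (intro hw_eq_0) (auto simp: words_def tuples_def x)
    then show ?thesis using hw_pos[OF assms, of c] by simp
  qed
qed

sublocale word_state hw
  by unfold_locales (simp_all only: hw_Nil hw_rev hw_pos hw_bound)

text \<open>The matrix x relative to the bases \<open>E c\<close> and \<open>F c\<close>. For
  Hadamard bases the flag \<open>False\<close> returns the letters and \<open>True\<close> gives the
  entries of v = (1/n) H2^T x H1.\<close>

definition Xel :: "bool \<Rightarrow> nat \<Rightarrow> nat \<Rightarrow> (nat \<times> nat) falg" where
  "Xel c k l = (\<Sum>i<n. \<Sum>j<n. scal (of_real (E c k i * F c l j)) * mon [(i, j)])"

text \<open>Vanishing in every context of words makes this a two-sided ideal; its members become 0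
  in the completion.\<close>

definition null :: "(nat \<times> nat) falg \<Rightarrow> bool" where
  "null a \<longleftrightarrow> (\<forall>u v. lin hw (mon u * a * mon v) = 0)"

lemma nullD: "null a \<Longrightarrow> lin hw (x * a * y) = 0"
  unfolding null_def by (rule lin_eq_0I) blast

lemma null_mult: "null a \<Longrightarrow> null (b * a * c)"
  unfolding null_def[of "b * a * c"] using nullD[of a "mon _ * b" "c * mon _"] by (simp add: mult.assoc)

lemma null_mult_left: "null a \<Longrightarrow> null (b * a)"
  using null_mult[of a b 1] by simp

lemma null_mult_right: "null a \<Longrightarrow> null (a * c)"
  using null_mult[of a 1 c] by simp

lemma null_add: "null a \<Longrightarrow> null b \<Longrightarrow> null (a + b)"
  by (simp add: null_def distrib_left distrib_right lin_add)

lemma null_minus: "null a \<Longrightarrow> null (- a)"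
  by (simp add: null_def lin_minus)

lemma null_diff: "null a \<Longrightarrow> null b \<Longrightarrow> null (a - b)"
  using null_add[of a "- b"] null_minus[of b] by simp

lemma null_0: "null 0"
  by (simp add: null_def lin_0)

lemma null_sum: "(\<And>x. x \<in> S \<Longrightarrow> null (f x)) \<Longrightarrow> null (sum f S)"
  by (induction S rule: infinite_finite_induct) (auto simp: null_0 null_add)

lemma emb_eq_null: "null (x - y) \<Longrightarrow> emb x = emb y"
  by (intro emb_eqI opnorm_eq_0I) (simp add: null_def)

lemma fstar_Xel: "fstar (Xel c k l) = Xel c k l"
  by (simp add: Xel_def fstar_sum fstar_mult fstar_mon fstar_scal scal_comm)

lemma lin_Xel_Xel:
  "lin hw (mon u * (Xel c k l * Xel c p m) * mon v) =
    of_real (\<Sum>i<n. \<Sum>j<n. \<Sum>i'<n. \<Sum>j'<n. (E c k i * F c l j) * (E c p i' * F c m j') * hw (u @ (i, j) # (i', j') # v))"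
proof -
  have 1: "mon u * ((scal a * mon [x]) * (scal b * mon [y])) * mon v = scal a * (scal b * mon (u @ x # y # v))"
    for a b :: complex and x y :: "nat \<times> nat"
  proof -
    have left: "x * (scal b * y) = scal b * (x * y)" for x y :: "(nat \<times> nat) falg" and b
      by (metis mult.assoc scal_comm)
    have "mon u * ((scal a * mon [x]) * (scal b * mon [y])) * mon v =
      mon u * (scal a * (mon [x] * (scal b * (mon [y] * mon v))))"
      by (simp only: mult.assoc)
    also have "\<dots> = scal a * (mon u * (mon [x] * (scal b * (mon [y] * mon v))))"
      by (rule left)
    also have "\<dots> = scal a * (scal b * (mon u * (mon [x] * (mon [y] * mon v))))"
      by (simp only: left[of "mon [x]"] left[of "mon u"])
    finally show ?thesis by (simp add: mon_mult)
  qed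
  have "mon u * (Xel c k l * Xel c p m) * mon v = (\<Sum>i<n. \<Sum>j<n. \<Sum>i'<n. \<Sum>j'<n.
     mon u * ((scal (of_real (E c k i * F c l j)) * mon [(i, j)]) * (scal (of_real (E c p i' * F c m j')) * mon [(i', j')])) * mon v)"
    unfolding Xel_def by (simp only: sum_distrib_right) (simp only: sum_distrib_left, simp only: sum_distrib_right)
  then show ?thesis
    unfolding 1 by (simp only: lin_sum lin_scal lin_mon of_real_sum of_real_mult mult.assoc)
qed

text \<open>The projection of \<open>E c\<close> fixes e_k tensor e_k, that of \<open>F c\<close>
  annihilates f_l tensor f_m, and \<open>hw_proj\<close> exchanges one projection for the
  other.\<close>

lemma null_Xel_Xel:
  assumes "k < n" "l < n" "m < n" "l \<noteq> m"
  shows "null (Xel c k l * Xel c k m)"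
  unfolding null_def
proof (intro allI)
  fix u v
  let ?g = "\<lambda>a b j j'. hw (u @ (a, j) # (b, j') # v)"
  let ?E = "E c k" and ?F = "\<lambda>j j'. F c l j * F c m j'"
  \<comment> \<open>The projection is inserted on the side of \<open>E c\<close>, where it acts
    trivially, and moved to the side of \<open>F c\<close>.\<close>
  have key: "(\<Sum>a<n. \<Sum>b<n. ?E a * ?E b * ?g a b j j') =
        (\<Sum>i<n. \<Sum>i'<n. ?E i * ?E i' * (\<Sum>a<n. \<Sum>b<n. kern n (F c) j j' a b * ?g i i' a b))" for j j'
  proof -
    have "(\<Sum>a<n. \<Sum>b<n. ?E a * ?E b * ?g a b j j') =
        (\<Sum>a<n. \<Sum>b<n. \<Sum>i<n. \<Sum>i'<n. ?E i * ?E i' * kern n (E c) i i' a b * ?g a b j j')"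
      using E.sum_kern[OF assms(1) assms(1), of c] by (simp add: sum_distrib_right[symmetric])
    also have "\<dots> = (\<Sum>a<n. \<Sum>i<n. \<Sum>b<n. \<Sum>i'<n. ?E i * ?E i' * kern n (E c) i i' a b * ?g a b j j')"
      by (rule sum.cong[OF refl]) (rule sum.swap)
    also have "\<dots> = (\<Sum>i<n. \<Sum>a<n. \<Sum>b<n. \<Sum>i'<n. ?E i * ?E i' * kern n (E c) i i' a b * ?g a b j j')"
      by (rule sum.swap)
    also have "\<dots> = (\<Sum>i<n. \<Sum>a<n. \<Sum>i'<n. \<Sum>b<n. ?E i * ?E i' * kern n (E c) i i' a b * ?g a b j j')"
      by (rule sum.cong[OF refl], rule sum.cong[OF refl]) (rule sum.swap)
    also have "\<dots> = (\<Sum>i<n. \<Sum>i'<n. \<Sum>a<n. \<Sum>b<n. ?E i * ?E i' * kern n (E c) i i' a b * ?g a b j j')"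
      by (rule sum.cong[OF refl]) (rule sum.swap)
    also have "\<dots> = (\<Sum>i<n. \<Sum>i'<n. ?E i * ?E i' * (\<Sum>a<n. \<Sum>b<n. kern n (E c) i i' a b * ?g a b j j'))"
      by (simp add: sum_distrib_left mult_ac)
    finally show ?thesis
      by (simp only: hw_proj)
  qed
  have "(\<Sum>i<n. \<Sum>j<n. \<Sum>i'<n. \<Sum>j'<n. (E c k i * F c l j) * (E c k i' * F c m j') * ?g i i' j j') =
      (\<Sum>j<n. \<Sum>i<n. \<Sum>i'<n. \<Sum>j'<n. (E c k i * F c l j) * (E c k i' * F c m j') * ?g i i' j j')"
    by (rule sum.swap)
  also have "\<dots> = (\<Sum>j<n. \<Sum>i<n. \<Sum>j'<n. \<Sum>i'<n. (E c k i * F c l j) * (E c k i' * F c m j') * ?g i i' j j')"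
    by (rule sum.cong[OF refl], rule sum.cong[OF refl]) (rule sum.swap)
  also have "\<dots> = (\<Sum>j<n. \<Sum>j'<n. \<Sum>i<n. \<Sum>i'<n. (E c k i * F c l j) * (E c k i' * F c m j') * ?g i i' j j')"
    by (rule sum.cong[OF refl]) (rule sum.swap)
  also have "\<dots> = (\<Sum>j<n. \<Sum>j'<n. ?F j j' * (\<Sum>a<n. \<Sum>b<n. ?E a * ?E b * ?g a b j j'))"
    by (simp add: sum_distrib_left mult_ac)
  also have "\<dots> = (\<Sum>j<n. \<Sum>j'<n. ?F j j' * (\<Sum>i<n. \<Sum>i'<n. ?E i * ?E i' * (\<Sum>a<n. \<Sum>b<n. kern n (F c) j j' a b * ?g i i' a b)))"
    by (simp only: key)
  also have "\<dots> = (\<Sum>i<n. \<Sum>i'<n. \<Sum>a<n. \<Sum>b<n. (\<Sum>j<n. \<Sum>j'<n. ?F j j' * kern n (F c) j j' a b) * (?E i * ?E i' * ?g i i' a b))"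
  proof -
    let ?t = "\<lambda>j j' i i' a b. ?F j j' * kern n (F c) j j' a b * (?E i * ?E i' * ?g i i' a b)"
    have "(\<Sum>j<n. \<Sum>j'<n. ?F j j' * (\<Sum>i<n. \<Sum>i'<n. ?E i * ?E i' * (\<Sum>a<n. \<Sum>b<n. kern n (F c) j j' a b * ?g i i' a b)))
      = (\<Sum>(j, j')\<in>{..<n} \<times> {..<n}. \<Sum>(i, i', a, b)\<in>{..<n} \<times> {..<n} \<times> {..<n} \<times> {..<n}. ?t j j' i i' a b)"
      by (simp add: sum_distrib_left mult_ac flip: sum.cartesian_product)
    also have "\<dots> = (\<Sum>(i, i', a, b)\<in>{..<n} \<times> {..<n} \<times> {..<n} \<times> {..<n}. \<Sum>(j, j')\<in>{..<n} \<times> {..<n}. ?t j j' i i' a b)"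
      unfolding case_prod_unfold by (rule sum.swap)
    also have "\<dots> = (\<Sum>i<n. \<Sum>i'<n. \<Sum>a<n. \<Sum>b<n. (\<Sum>j<n. \<Sum>j'<n. ?F j j' * kern n (F c) j j' a b) * (?E i * ?E i' * ?g i i' a b))"
      by (simp add: sum_distrib_right flip: sum.cartesian_product)
    finally show ?thesis .
  qed
  also have "\<dots> = 0"
    using F.sum_kern[OF assms(2,3), of c] assms(4) by simp
  finally show "lin hw (mon u * (Xel c k l * Xel c k m) * mon v) = 0"
    by (simp only: lin_Xel_Xel of_real_0)
qed

text \<open>Summation over \<open>l\<close> eliminates \<open>F c\<close> by completeness and leaves
  the orthogonality of the rows of x; orthonormality of \<open>E c\<close> does the rest. So the
  relation holds for x and for v alike.\<close>

lemma null_Xel_row: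
  assumes "k < n"
  shows "null ((\<Sum>l<n. Xel c k l * Xel c k l) - 1)"
  unfolding null_def
proof (intro allI)
  fix u v
  let ?g = "\<lambda>a b j j'. hw (u @ (a, j) # (b, j') # v)"
  have "lin hw (mon u * (\<Sum>l<n. Xel c k l * Xel c k l) * mon v) =
    of_real (\<Sum>l<n. \<Sum>i<n. \<Sum>j<n. \<Sum>i'<n. \<Sum>j'<n. (E c k i * F c l j) * (E c k i' * F c l j') * ?g i i' j j')"
    by (simp only: sum_distrib_left sum_distrib_right lin_sum lin_Xel_Xel of_real_sum)
  also have "(\<Sum>l<n. \<Sum>i<n. \<Sum>j<n. \<Sum>i'<n. \<Sum>j'<n. (E c k i * F c l j) * (E c k i' * F c l j') * ?g i i' j j') =
     (\<Sum>l<n. \<Sum>(i, j, i', j')\<in>{..<n} \<times> {..<n} \<times> {..<n} \<times> {..<n}. (F c l j * F c l j') * (E c k i * E c k i' * ?g i i' j j'))"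
    by (simp add: mult_ac flip: sum.cartesian_product)
  also have "\<dots> = (\<Sum>(i, j, i', j')\<in>{..<n} \<times> {..<n} \<times> {..<n} \<times> {..<n}. \<Sum>l<n. (F c l j * F c l j') * (E c k i * E c k i' * ?g i i' j j'))"
    unfolding case_prod_unfold by (rule sum.swap)
  also have "\<dots> = (\<Sum>i<n. \<Sum>j<n. \<Sum>i'<n. \<Sum>j'<n. of_bool (j = j') * (E c k i * E c k i' * ?g i i' j j'))"
    by (simp add: sum_distrib_right[symmetric] F.compl flip: sum.cartesian_product)
  also have "\<dots> = (\<Sum>i<n. \<Sum>j<n. \<Sum>i'<n. E c k i * E c k i' * ?g i i' j j)"
    by (simp add: F.sum_delta_scale)
  also have "\<dots> = (\<Sum>i<n. \<Sum>i'<n. \<Sum>j<n. E c k i * E c k i' * ?g i i' j j)"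
    by (rule sum.cong[OF refl]) (rule sum.swap)
  also have "\<dots> = (\<Sum>i<n. \<Sum>i'<n. of_bool (i = i') * (E c k i * E c k i' * hw (u @ v)))"
    by (rule sum.cong[OF refl], rule sum.cong[OF refl]) (simp add: sum_distrib_left[symmetric] hw_orth_row)
  also have "\<dots> = (\<Sum>i<n. E c k i * E c k i * hw (u @ v))"
    by (rule sum.cong[OF refl]) (simp only: lessThan_iff F.sum_delta_scale(1))
  also have "\<dots> = (\<Sum>i<n. E c k i * E c k i) * hw (u @ v)"
    by (simp only: sum_distrib_right)
  also have "\<dots> = hw (u @ v)"
    using assms by (simp add: E.orth)
  finally show "lin hw (mon u * ((\<Sum>l<n. Xel c k l * Xel c k l) - 1) * mon v) = 0"
    by (simp add: left_diff_distrib right_diff_distrib lin_diff mon_mult lin_mon)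
qed

lemma null_Xel_col:
  assumes "l < n"
  shows "null ((\<Sum>k<n. Xel c k l * Xel c k l) - 1)"
  unfolding null_def
proof (intro allI)
  fix u v
  let ?g = "\<lambda>a b j j'. hw (u @ (a, j) # (b, j') # v)"
  have "lin hw (mon u * (\<Sum>k<n. Xel c k l * Xel c k l) * mon v) =
    of_real (\<Sum>k<n. \<Sum>i<n. \<Sum>j<n. \<Sum>i'<n. \<Sum>j'<n. (E c k i * F c l j) * (E c k i' * F c l j') * ?g i i' j j')"
    by (simp only: sum_distrib_left sum_distrib_right lin_sum lin_Xel_Xel of_real_sum)
  also have "(\<Sum>k<n. \<Sum>i<n. \<Sum>j<n. \<Sum>i'<n. \<Sum>j'<n. (E c k i * F c l j) * (E c k i' * F c l j') * ?g i i' j j') =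
     (\<Sum>k<n. \<Sum>(j, j', i, i')\<in>{..<n} \<times> {..<n} \<times> {..<n} \<times> {..<n}. (E c k i * E c k i') * (F c l j * F c l j' * ?g i i' j j'))"
  proof (rule sum.cong[OF refl])
    fix k
    let ?t = "\<lambda>i j i' j'. (E c k i * F c l j) * (E c k i' * F c l j') * ?g i i' j j'"
    have "(\<Sum>i<n. \<Sum>j<n. \<Sum>i'<n. \<Sum>j'<n. ?t i j i' j') = (\<Sum>j<n. \<Sum>i<n. \<Sum>i'<n. \<Sum>j'<n. ?t i j i' j')"
      by (rule sum.swap)
    also have "\<dots> = (\<Sum>j<n. \<Sum>i<n. \<Sum>j'<n. \<Sum>i'<n. ?t i j i' j')"
      by (rule sum.cong[OF refl], rule sum.cong[OF refl]) (rule sum.swap)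
    also have "\<dots> = (\<Sum>j<n. \<Sum>j'<n. \<Sum>i<n. \<Sum>i'<n. ?t i j i' j')"
      by (rule sum.cong[OF refl]) (rule sum.swap)
    finally show "(\<Sum>i<n. \<Sum>j<n. \<Sum>i'<n. \<Sum>j'<n. ?t i j i' j') =
      (\<Sum>(j, j', i, i')\<in>{..<n} \<times> {..<n} \<times> {..<n} \<times> {..<n}. (E c k i * E c k i') * (F c l j * F c l j' * ?g i i' j j'))"
      by (simp add: mult_ac flip: sum.cartesian_product)
  qed
  also have "\<dots> = (\<Sum>(j, j', i, i')\<in>{..<n} \<times> {..<n} \<times> {..<n} \<times> {..<n}. \<Sum>k<n. (E c k i * E c k i') * (F c l j * F c l j' * ?g i i' j j'))"
    unfolding case_prod_unfold by (rule sum.swap)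
  also have "\<dots> = (\<Sum>j<n. \<Sum>j'<n. \<Sum>i<n. \<Sum>i'<n. of_bool (i = i') * (F c l j * F c l j' * ?g i i' j j'))"
    by (simp add: sum_distrib_right[symmetric] E.compl flip: sum.cartesian_product)
  also have "\<dots> = (\<Sum>j<n. \<Sum>j'<n. \<Sum>i<n. F c l j * F c l j' * ?g i i j j')"
    by (simp add: F.sum_delta_scale)
  also have "\<dots> = (\<Sum>j<n. \<Sum>j'<n. of_bool (j = j') * (F c l j * F c l j' * hw (u @ v)))"
    by (rule sum.cong[OF refl], rule sum.cong[OF refl]) (simp add: sum_distrib_left[symmetric] hw_orth_col)
  also have "\<dots> = (\<Sum>j<n. F c l j * F c l j * hw (u @ v))"
    by (rule sum.cong[OF refl]) (simp only: lessThan_iff F.sum_delta_scale(1))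
  also have "\<dots> = (\<Sum>j<n. F c l j * F c l j) * hw (u @ v)"
    by (simp only: sum_distrib_right)
  also have "\<dots> = hw (u @ v)"
    using assms by (simp add: F.orth)
  finally show "lin hw (mon u * ((\<Sum>k<n. Xel c k l * Xel c k l) - 1) * mon v) = 0"
    by (simp add: left_diff_distrib right_diff_distrib lin_diff mon_mult lin_mon)
qed

text \<open>Multiply the row relation by the entry \<open>l\<close> from the left: all terms with a
  different index vanish.\<close>

lemma null_Xel_cube:
  assumes "k < n" "l < n"
  shows "null (Xel c k l * (Xel c k l * Xel c k l) - Xel c k l)"
proof -
  let ?X = "Xel c k"
  have "null (?X l * ((\<Sum>m<n. ?X m * ?X m) - 1))"
    using null_Xel_row[OF assms(1)] by (rule null_mult_left)
  moreover have "null (\<Sum>m\<in>{..<n} - {l}. ?X l * (?X m * ?X m))"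
  proof (rule null_sum)
    fix m assume "m \<in> {..<n} - {l}"
    then have "null (?X l * ?X m)" using assms by (intro null_Xel_Xel) auto
    then show "null (?X l * (?X m * ?X m))"
      using null_mult_right[of "?X l * ?X m" "?X m"] by (simp add: mult.assoc)
  qed
  ultimately have "null (?X l * ((\<Sum>m<n. ?X m * ?X m) - 1) - (\<Sum>m\<in>{..<n} - {l}. ?X l * (?X m * ?X m)))"
    by (rule null_diff)
  then show ?thesis
    using assms by (simp add: right_diff_distrib sum.remove[of "{..<n}" l] distrib_left sum_distrib_left)
qed

lemma half_double: "scal (1 / 2) * (x + x) = (x :: (nat \<times> nat) falg)"
  by (simp add: distrib_left distrib_right[symmetric] scal_simps(1)[symmetric] scal_simps(3))

definition Pel :: "(nat \<times> nat) falg \<Rightarrow> real \<Rightarrow> (nat \<times> nat) falg" where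
  "Pel Y \<sigma> = scal (1 / 2) * (Y * Y + scal (of_real \<sigma>) * Y)"

lemma fstar_Pel: "fstar Y = Y \<Longrightarrow> fstar (Pel Y \<sigma>) = Pel Y \<sigma>"
  by (simp add: Pel_def fstar_mult fstar_scal fstar_add scal_comm)

lemma null_Pel:
  assumes "null (Y * (Y * Y) - Y)" "\<sigma> * \<sigma> = 1"
  shows "null (Pel Y \<sigma> * Pel Y \<sigma> - Pel Y \<sigma>)"
proof -
  let ?s = "scal (of_real \<sigma>) :: (nat \<times> nat) falg"
  let ?D = "Y * (Y * Y) - Y"
  have ss: "?s * (?s * z) = z" for z
    using assms(2) by (simp add: mult.assoc[symmetric] scal_simps(2)[symmetric] of_real_mult[symmetric] scal_simps(3))
  have sc: "x * (?s * y) = ?s * (x * y)" for x y by (metis mult.assoc scal_comm)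
  have hc: "x * (scal (1 / 2) * y) = scal (1 / 2) * (x * y)" for x y :: "(nat \<times> nat) falg" by (metis mult.assoc scal_comm)
  \<comment> \<open>Modulo \<open>?D\<close> the cube of \<open>Y\<close> is \<open>Y\<close> and
    the fourth power is its square, so the left side is twice \<open>Y * Y + ?s * Y\<close>; the
    terms in \<open>?D\<close> record the error.\<close>
  have "(Y * Y + ?s * Y) * (Y * Y + ?s * Y) = (?D * Y + ?s * (?D + ?D)) + ((Y * Y + ?s * Y) + (Y * Y + ?s * Y))"
    by (simp add: distrib_left distrib_right left_diff_distrib right_diff_distrib mult.assoc sc[of Y] ss)
  then have "Pel Y \<sigma> * Pel Y \<sigma> = scal (1 / 2) * (scal (1 / 2) * (?D * Y + ?s * (?D + ?D))) +
      scal (1 / 2) * (scal (1 / 2) * ((Y * Y + ?s * Y) + (Y * Y + ?s * Y)))"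
    unfolding Pel_def by (simp only: hc[of "Y * Y + ?s * Y"] mult.assoc) (simp only: distrib_left add.assoc)
  then have "Pel Y \<sigma> * Pel Y \<sigma> - Pel Y \<sigma> = scal (1 / 2) * (scal (1 / 2) * (?D * Y + ?s * (?D + ?D)))"
    by (simp only: half_double) (simp add: Pel_def)
  moreover have "null (scal (1 / 2) * (scal (1 / 2) * (?D * Y + ?s * (?D + ?D))))"
    using assms(1) by (intro null_mult_left null_add null_mult_right)
  ultimately show ?thesis by simp
qed

end

section \<open>Hadamard matrices as unbiased bases, and sums over the graph\<close>

lemma hadamard_entry: "is_hadamard n H \<Longrightarrow> i < n \<Longrightarrow> j < n \<Longrightarrow> H i j = 1 \<or> H i j = -1"
  by (simp add: is_hadamard_def)

lemma hadamard_rows: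
  "is_hadamard n H \<Longrightarrow> i < n \<Longrightarrow> j < n \<Longrightarrow> (\<Sum>k<n. H i k * H j k) = (if i = j then int n else 0)"
  by (simp add: is_hadamard_def)

text \<open>With \<open>C = H\<^sup>T H\<close>, the squared entries of \<open>C\<close> sum to \<open>n\<^sup>3\<close>, which the diagonal already exhausts.\<close>

lemma hadamard_columns:
  assumes H: "is_hadamard n H" and "k < n" "l < n"
  shows "(\<Sum>i<n. H i k * H i l) = (if k = l then int n else 0)"
proof -
  define C where "C k l = (\<Sum>i<n. H i k * H i l)" for k l
  have diag: "C k k = int n" if "k < n" for k
  proof -
    have "H i k * H i k = 1" if "i < n" for i
      using hadamard_entry[OF H that \<open>k < n\<close>] by auto
    then show ?thesis by (simp add: C_def)
  qed
  have "(\<Sum>k<n. \<Sum>l<n. C k l * C k l) = (\<Sum>(k, l)\<in>{..<n} \<times> {..<n}. \<Sum>(i, j)\<in>{..<n} \<times> {..<n}. (H i k * H j k) * (H i l * H j l))"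
    by (simp add: C_def sum_product mult_ac flip: sum.cartesian_product)
  also have "\<dots> = (\<Sum>(i, j)\<in>{..<n} \<times> {..<n}. \<Sum>(k, l)\<in>{..<n} \<times> {..<n}. (H i k * H j k) * (H i l * H j l))"
    unfolding case_prod_unfold by (rule sum.swap)
  also have "\<dots> = (\<Sum>i<n. \<Sum>j<n. (\<Sum>k<n. H i k * H j k) * (\<Sum>l<n. H i l * H j l))"
    by (simp add: sum_product flip: sum.cartesian_product)
  also have "\<dots> = (\<Sum>i<n. \<Sum>j<n. if i = j then int n * int n else 0)"
    by (intro sum.cong refl) (simp add: hadamard_rows[OF H])
  also have "\<dots> = (\<Sum>k<n. C k k * C k k)"
    by (simp add: diag)
  finally have "(\<Sum>k<n. (\<Sum>l<n. C k l * C k l) - C k k * C k k) = 0"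
    by (simp add: sum_subtractf)
  moreover have "(\<Sum>l<n. C k l * C k l) - C k k * C k k = (\<Sum>l\<in>{..<n} - {k}. C k l * C k l)" if "k < n" for k
    using that by (simp add: sum.remove[of "{..<n}" k])
  ultimately have "(\<Sum>k<n. \<Sum>l\<in>{..<n} - {k}. C k l * C k l) = 0" by simp
  then have "\<forall>k\<in>{..<n}. (\<Sum>l\<in>{..<n} - {k}. C k l * C k l) = 0"
    by (subst (asm) sum_nonneg_eq_0_iff) (auto intro: sum_nonneg)
  then have "(\<Sum>l\<in>{..<n} - {k}. C k l * C k l) = 0" using assms by simp
  then have "\<forall>l\<in>{..<n} - {k}. C k l * C k l = 0"
    by (subst (asm) sum_nonneg_eq_0_iff) auto
  then show ?thesis using assms diag[of k] by (auto simp: C_def)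
qed

definition hadamard_bases :: "nat \<Rightarrow> (nat \<Rightarrow> nat \<Rightarrow> int) \<Rightarrow> bool \<Rightarrow> nat \<Rightarrow> nat \<Rightarrow> real" where
  "hadamard_bases n H c k i =
     (if k < n \<and> i < n then if c then of_int (H i k) / sqrt n else of_bool (k = i) else 0)"

lemma unbiased_bases_hadamard:
  assumes H: "is_hadamard n H" and n: "n \<ge> 1"
  shows "unbiased_bases n (hadamard_bases n H)"
proof
  have sn: "sqrt (real n) * sqrt (real n) = real n" "sqrt (real n) \<noteq> 0" using n by simp_all
  show "n > 0" using n by simp
  show "hadamard_bases n H c k i = 0" if "k \<ge> n \<or> i \<ge> n" for k i c
    using that by (auto simp: hadamard_bases_def)
  show "(\<Sum>i<n. hadamard_bases n H c k i * hadamard_bases n H c l i) = of_bool (k = l)" if "k < n" "l < n" for k l c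
  proof (cases c)
    case True
    have "(\<Sum>i<n. hadamard_bases n H c k i * hadamard_bases n H c l i) = (\<Sum>i<n. of_int (H i k * H i l)) / real n"
      using that True by (simp add: hadamard_bases_def sum_divide_distrib)
    also have "(\<Sum>i<n. real_of_int (H i k * H i l)) = real_of_int (\<Sum>i<n. H i k * H i l)" by simp
    finally show ?thesis using n by (simp only: hadamard_columns[OF H that]) simp
  next
    case False
    then show ?thesis using that by (auto simp: hadamard_bases_def of_bool_def if_distrib[of "\<lambda>x. x * _"] cong: if_cong)
  qed
  show "(\<Sum>k<n. hadamard_bases n H c k i * hadamard_bases n H c k j) = of_bool (i = j)" if "i < n" "j < n" for i j c
  proof (cases c)
    case True
    have "(\<Sum>k<n. hadamard_bases n H c k i * hadamard_bases n H c k j) = (\<Sum>k<n. of_int (H i k * H j k)) / real n"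
      using that True by (simp add: hadamard_bases_def sum_divide_distrib)
    also have "(\<Sum>k<n. real_of_int (H i k * H j k)) = real_of_int (\<Sum>k<n. H i k * H j k)" by simp
    finally show ?thesis using n by (simp only: hadamard_rows[OF H that]) simp
  next
    case False
    then show ?thesis using that by (auto simp: hadamard_bases_def of_bool_def if_distrib[of "\<lambda>x. x * _"] cong: if_cong)
  qed
  show "(\<Sum>i<n. hadamard_bases n H c k i * hadamard_bases n H (\<not> c) l i)\<^sup>2 = inverse (real n)" if "k < n" "l < n" for k l c
  proof -
    \<comment> \<open>One computation serves both values of \<open>c\<close>, as the inner product
      is symmetric in the two bases.\<close>
    have *: "(\<Sum>i<n. of_bool (k = i) * (real_of_int (H i l) / sqrt (real n)))\<^sup>2 = inverse (real n)" if "k < n" "l < n" for k l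
    proof -
      have "(\<Sum>i<n. of_bool (k = i) * (real_of_int (H i l) / sqrt (real n))) = real_of_int (H k l) / sqrt (real n)"
        using that by (simp add: of_bool_def if_distrib[of "\<lambda>x. x * _"] flip: sum_divide_distrib cong: if_cong)
      moreover have "(real_of_int (H k l))\<^sup>2 = 1" using hadamard_entry[OF H that] by auto
      ultimately show ?thesis by (simp add: power_divide inverse_eq_divide)
    qed
    show ?thesis
      using that *[of k l] *[of l k] by (cases c) (simp_all add: hadamard_bases_def mult.commute)
  qed
qed

lemma hadamard_vertices_eq:
  "hadamard_vertices n = (\<lambda>(i, s). HR i s) ` ({..<n} \<times> UNIV) \<union> (\<lambda>(i, s). HC i s) ` ({..<n} \<times> UNIV)"
  by (auto simp: hadamard_vertices_def)

lemma finite_hadamard_vertices: "finite (hadamard_vertices n)"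
  by (simp add: hadamard_vertices_eq)

lemma sum_hadamard_vertices:
  "(\<Sum>v\<in>hadamard_vertices n. f v) =
    (\<Sum>i<n. f (HR i True) + f (HR i False)) + (\<Sum>i<n. f (HC i True) + f (HC i False))"
proof -
  have i: "inj_on (\<lambda>(i, s). HR i s) ({..<n} \<times> UNIV)" "inj_on (\<lambda>(i, s). HC i s) ({..<n} \<times> UNIV)"
    by (auto simp: inj_on_def)
  have "(\<Sum>v\<in>hadamard_vertices n. f v) = (\<Sum>v\<in>(\<lambda>(i, s). HR i s) ` ({..<n} \<times> UNIV). f v) +
      (\<Sum>v\<in>(\<lambda>(i, s). HC i s) ` ({..<n} \<times> UNIV). f v)"
    unfolding hadamard_vertices_eq by (rule sum.union_disjoint) auto
  also have "\<dots> = (\<Sum>i<n. \<Sum>s\<in>UNIV. f (HR i s)) + (\<Sum>i<n. \<Sum>s\<in>UNIV. f (HC i s))"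
    by (subst sum.reindex[OF i(1)], subst sum.reindex[OF i(2)])
      (simp add: comp_def case_prod_unfold sum.cartesian_product)
  finally show ?thesis by (simp add: UNIV_bool add.commute)
qed

definition sgn_eq :: "bool \<Rightarrow> bool \<Rightarrow> real" where
  "sgn_eq s t = (if s = t then 1 else - 1)"

section \<open>The magic unitary and its commutation with the adjacency matrices\<close>

context unbiased_pair
begin

text \<open>Block diagonal: row vertices are matched with row vertices through x, column vertices
  with column vertices through v. The product of the two signs selects the eigenvalue. The first
  argument belongs to the graph of the bases \<open>E\<close>.\<close>

definition magic :: "hvert \<Rightarrow> hvert \<Rightarrow> (nat \<times> nat) falg" where
  "magic v w = (case (v, w) of (HR i s, HR j t) \<Rightarrow> Pel (Xel False i j) (sgn_eq s t)
     | (HC i s, HC j t) \<Rightarrow> Pel (Xel True i j) (sgn_eq s t) | _ \<Rightarrow> 0)"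

lemma magic_simps [simp]:
  "magic (HR i s) (HR j t) = Pel (Xel False i j) (sgn_eq s t)"
  "magic (HC i s) (HC j t) = Pel (Xel True i j) (sgn_eq s t)"
  "magic (HR i s) (HC j t) = 0" "magic (HC i s) (HR j t) = 0"
  by (simp_all add: magic_def)

lemma projection_magic:
  assumes "v \<in> hadamard_vertices n" "w \<in> hadamard_vertices n"
  shows "is_projection completion (emb (magic v w))"
proof -
  have z: "is_projection completion (emb 0)"
    by (simp add: is_projection_def emb_carrier emb_simps st_0)
  have p: "is_projection completion (emb (Pel (Xel c i j) (sgn_eq s t)))" if "i < n" "j < n" for c i j s t
  proof -
    have "null (Pel (Xel c i j) (sgn_eq s t) * Pel (Xel c i j) (sgn_eq s t) - Pel (Xel c i j) (sgn_eq s t))"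
      using that by (intro null_Pel null_Xel_cube) (auto simp: sgn_eq_def)
    then show ?thesis
      by (simp add: is_projection_def emb_carrier emb_simps fstar_Pel fstar_Xel emb_eq_null)
  qed
  show ?thesis
    using assms z p by (auto simp: hadamard_vertices_def)
qed

lemma Pel_pair: "Pel Y 1 + Pel Y (- 1) = Y * Y"
proof -
  have "scal (- 1) * Y = - Y" by (simp add: cst_minus_1)
  then show ?thesis
    unfolding Pel_def distrib_left[symmetric] using half_double[of "Y * Y"] by (simp add: scal_simps)
qed

lemma Pel_pair_sgn: "Pel Y (sgn_eq s True) + Pel Y (sgn_eq s False) = Y * Y"
  "Pel Y (sgn_eq True s) + Pel Y (sgn_eq False s) = Y * Y"
  using Pel_pair[of Y] by (cases s; simp add: sgn_eq_def add.commute)+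

lemma csum_magic_row:
  assumes "v \<in> hadamard_vertices n"
  shows "csum completion (\<lambda>w. emb (magic v w)) (hadamard_vertices n) = one completion"
proof -
  have "null ((\<Sum>w\<in>hadamard_vertices n. magic v w) - 1)"
  proof -
    have "(\<exists>i s. v = HR i s \<and> i < n) \<or> (\<exists>i s. v = HC i s \<and> i < n)"
      using assms by (auto simp: hadamard_vertices_def)
    then show ?thesis by (auto simp: sum_hadamard_vertices Pel_pair_sgn null_Xel_row)
  qed
  then show ?thesis
    by (simp add: csum_emb finite_hadamard_vertices emb_simps emb_eq_null)
qed

lemma csum_magic_col:
  assumes "w \<in> hadamard_vertices n"
  shows "csum completion (\<lambda>v. emb (magic v w)) (hadamard_vertices n) = one completion"
proof -
  have "null ((\<Sum>v\<in>hadamard_vertices n. magic v w) - 1)"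
  proof -
    have "(\<exists>i s. w = HR i s \<and> i < n) \<or> (\<exists>i s. w = HC i s \<and> i < n)"
      using assms by (auto simp: hadamard_vertices_def)
    then show ?thesis by (auto simp: sum_hadamard_vertices Pel_pair_sgn null_Xel_col)
  qed
  then show ?thesis
    by (simp add: csum_emb finite_hadamard_vertices emb_simps emb_eq_null)
qed

lemma sum_Pel:
  "(\<Sum>k<n. Pel (X k) (\<sigma> * g k)) =
    scal (1 / 2) * ((\<Sum>k<n. X k * X k) + scal (of_real \<sigma>) * (\<Sum>k<n. scal (of_real (g k)) * X k))"
  by (simp add: Pel_def sum_distrib_left sum.distrib distrib_left scal_simps mult.assoc)

lemma sum_scal_Xel:
  "(\<Sum>l<n. scal (of_real (g l)) * Xel c (p l) (q l)) =
    (\<Sum>i<n. \<Sum>j<n. scal (of_real (\<Sum>l<n. g l * (E c (p l) i * F c (q l) j))) * mon [(i, j)])"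
proof -
  have scal_sum: "scal (of_real (\<Sum>l<n. f l)) = (\<Sum>l<n. scal (of_real (f l)) :: (nat \<times> nat) falg)" for f
    by (induction n) (simp_all add: scal_simps)
  have "(\<Sum>l<n. scal (of_real (g l)) * Xel c (p l) (q l)) =
    (\<Sum>l<n. \<Sum>i<n. \<Sum>j<n. scal (of_real (g l * (E c (p l) i * F c (q l) j))) * mon [(i, j)])"
    by (simp add: Xel_def sum_distrib_left scal_simps mult.assoc)
  also have "\<dots> = (\<Sum>i<n. \<Sum>l<n. \<Sum>j<n. scal (of_real (g l * (E c (p l) i * F c (q l) j))) * mon [(i, j)])"
    by (rule sum.swap)
  also have "\<dots> = (\<Sum>i<n. \<Sum>j<n. \<Sum>l<n. scal (of_real (g l * (E c (p l) i * F c (q l) j))) * mon [(i, j)])"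
    by (rule sum.cong[OF refl]) (rule sum.swap)
  finally show ?thesis by (simp only: scal_sum sum_distrib_right)
qed

text \<open>The even parts of both sums are half a sum of squares and hence 1/2 in the completion;
  the odd parts agree already in the free algebra by the third hypothesis.\<close>

lemma emb_sum_Pel_eq:
  assumes "null ((\<Sum>k<n. X k * X k) - 1)" "null ((\<Sum>k<n. Y k * Y k) - 1)"
    and "(\<Sum>k<n. scal (of_real (g k)) * X k) = (\<Sum>k<n. scal (of_real (g' k)) * Y k)"
  shows "emb (\<Sum>k<n. Pel (X k) (\<sigma> * g k)) = emb (\<Sum>k<n. Pel (Y k) (\<sigma> * g' k))"
proof (rule emb_eq_null)
  have "(\<Sum>k<n. Pel (X k) (\<sigma> * g k)) - (\<Sum>k<n. Pel (Y k) (\<sigma> * g' k)) =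
     scal (1 / 2) * (((\<Sum>k<n. X k * X k) - 1) - ((\<Sum>k<n. Y k * Y k) - 1))"
    unfolding sum_Pel assms(3) by (simp add: right_diff_distrib[symmetric])
  then show "null ((\<Sum>k<n. Pel (X k) (\<sigma> * g k)) - (\<Sum>k<n. Pel (Y k) (\<sigma> * g' k)))"
    using null_mult_left[OF null_diff[OF assms(1,2)], of "scal (1 / 2)"] by (simp only:)
qed

end

text \<open>Of the two signed vertices with a given index exactly one is adjacent, and passing to it
  multiplies the sign by the matrix entry.\<close>

lemma sgn_select:
  fixes f :: "real \<Rightarrow> 'a::comm_monoid_add" and a :: int
  assumes "a = 1 \<or> a = -1"
  shows "(if a = 1 \<and> t \<or> a = -1 \<and> \<not> t then f (sgn_eq s True) else 0) +
      (if a = 1 \<and> \<not> t \<or> a = -1 \<and> t then f (sgn_eq s False) else 0) = f (sgn_eq s t * of_int a)"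
    and "(if a = 1 \<and> s \<or> a = -1 \<and> \<not> s then f (sgn_eq True t) else 0) +
      (if a = 1 \<and> \<not> s \<or> a = -1 \<and> s then f (sgn_eq False t) else 0) = f (sgn_eq s t * of_int a)"
  using assms by (cases s; cases t; auto simp: sgn_eq_def)+

theorem mainTheorem3:
  fixes n :: nat and H1 H2 :: "nat \<Rightarrow> nat \<Rightarrow> int"
  assumes "n \<ge> 1" and "is_hadamard n H1" and "is_hadamard n H2"
  shows "quantum_isomorphic (hadamard_vertices n) (hadamard_adj n H1)
                            (hadamard_vertices n) (hadamard_adj n H2)"
proof -
  \<comment> \<open>\<open>E\<close> is built from \<open>H2\<close> because the rows of the magic
    unitary are indexed by the second graph.\<close>
  let ?V = "hadamard_vertices n" and ?E = "hadamard_bases n H2" and ?F = "hadamard_bases n H1"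
  interpret unbiased_pair n ?E ?F
    unfolding unbiased_pair_def using assms unbiased_bases_hadamard by blast
  have sn: "sqrt (real n) * sqrt (real n) = real n" "sqrt (real n) \<noteq> 0" using assms(1) by simp_all
  \<comment> \<open>In matrix form x H1 = H2 v, from the orthogonality of the rows of
    \<open>H2\<close>.\<close>
  have rc: "(\<Sum>k<n. scal (of_real (of_int (H1 k b))) * Xel False a k) = (\<Sum>l<n. scal (of_real (of_int (H2 a l))) * Xel True l b)"
    if "a < n" "b < n" for a b
  proof -
    have "(\<Sum>l<n. of_int (H1 l b) * (?E False a i * ?F False l j)) = (\<Sum>l<n. of_int (H2 a l) * (?E True l i * ?F True b j))"
      if ij: "i < n" "j < n" for i j
    proof -
      have "(\<Sum>l<n. of_int (H1 l b) * (?E False a i * ?F False l j)) = of_bool (a = i) * real_of_int (H1 j b)"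
        using that \<open>a < n\<close> by (simp add: hadamard_bases_def of_bool_def if_distrib[of "\<lambda>x. _ * x"] cong: if_cong)
      moreover have "(\<Sum>l<n. of_int (H2 a l) * (?E True l i * ?F True b j)) =
          real_of_int (\<Sum>l<n. H2 a l * H2 i l) * (real_of_int (H1 j b) / real n)"
        using that \<open>b < n\<close> sn by (simp add: hadamard_bases_def sum_distrib_left sum_divide_distrib mult_ac)
      ultimately show ?thesis
        using assms(1) by (simp only: hadamard_rows[OF assms(3) \<open>a < n\<close> ij(1)]) simp
    qed
    then show ?thesis unfolding sum_scal_Xel by simp
  qed
  \<comment> \<open>In matrix form v H1^T = H2^T x, from the orthogonality of the rows of
    \<open>H1\<close>.\<close>
  have cr: "(\<Sum>l<n. scal (of_real (of_int (H1 b l))) * Xel True a l) = (\<Sum>m<n. scal (of_real (of_int (H2 m a))) * Xel False m b)"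
    if "a < n" "b < n" for a b
  proof -
    have "(\<Sum>l<n. of_int (H1 b l) * (?E True a i * ?F True l j)) = (\<Sum>m<n. of_int (H2 m a) * (?E False m i * ?F False b j))"
      if ij: "i < n" "j < n" for i j
    proof -
      have "(\<Sum>m<n. of_int (H2 m a) * (?E False m i * ?F False b j)) = of_bool (b = j) * real_of_int (H2 i a)"
        using that \<open>b < n\<close> by (simp add: hadamard_bases_def of_bool_def if_distrib[of "\<lambda>x. _ * x"] cong: if_cong)
      moreover have "(\<Sum>l<n. of_int (H1 b l) * (?E True a i * ?F True l j)) =
          real_of_int (\<Sum>l<n. H1 b l * H1 j l) * (real_of_int (H2 i a) / real n)"
        using that \<open>a < n\<close> sn by (simp add: hadamard_bases_def sum_distrib_left sum_divide_distrib mult_ac)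
      ultimately show ?thesis
        using assms(1) by (simp only: hadamard_rows[OF assms(2) \<open>b < n\<close> ij(2)]) simp
    qed
    then show ?thesis unfolding sum_scal_Xel by simp
  qed
  have edges: "emb (\<Sum>k\<in>{k \<in> ?V. hadamard_adj n H1 k w}. magic v k) =
      emb (\<Sum>k\<in>{k \<in> ?V. hadamard_adj n H2 v k}. magic k w)" if vw: "v \<in> ?V" "w \<in> ?V" for v w
  proof -
    have flt: "(\<Sum>k\<in>{k \<in> ?V. P k}. f k) = (\<Sum>k\<in>?V. if P k then f k else 0)"
      for P and f :: "hvert \<Rightarrow> (nat \<times> nat) falg"
      by (simp add: sum.inter_filter finite_hadamard_vertices)
    consider a s b t where "v = HR a s" "w = HR b t" | a s b t where "v = HC a s" "w = HC b t"
      | a s b t where "v = HR a s" "w = HC b t" "a < n" "b < n"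
      | a s b t where "v = HC a s" "w = HR b t" "a < n" "b < n"
      using vw by (auto simp: hadamard_vertices_def)
    then show ?thesis
    proof cases
      \<comment> \<open>The graphs are bipartite and \<open>magic\<close> vanishes between the two
        vertex types, so both sums are 0 when \<open>v\<close> and \<open>w\<close> are of the same
        type.\<close>
      case 1
      then show ?thesis unfolding flt sum_hadamard_vertices by (simp cong: if_cong)
    next
      case 2
      then show ?thesis unfolding flt sum_hadamard_vertices by (simp cong: if_cong)
    next
      case 3
      have "(\<Sum>k\<in>?V. if hadamard_adj n H1 k w then magic v k else 0) =
          (\<Sum>k<n. Pel (Xel False a k) (sgn_eq s t * of_int (H1 k b)))"
        unfolding sum_hadamard_vertices using 3 hadamard_entry[OF assms(2)]
        by (simp add: sgn_select(1) cong: if_cong)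
      moreover have "(\<Sum>k\<in>?V. if hadamard_adj n H2 v k then magic k w else 0) =
          (\<Sum>k<n. Pel (Xel True k b) (sgn_eq s t * of_int (H2 a k)))"
        unfolding sum_hadamard_vertices using 3 hadamard_entry[OF assms(3)]
        by (simp add: sgn_select(2) cong: if_cong)
      ultimately show ?thesis
        unfolding flt using 3 rc by (simp add: emb_sum_Pel_eq null_Xel_row null_Xel_col)
    next
      case 4
      have "(\<Sum>k\<in>?V. if hadamard_adj n H1 k w then magic v k else 0) =
          (\<Sum>k<n. Pel (Xel True a k) (sgn_eq s t * of_int (H1 b k)))"
        unfolding sum_hadamard_vertices using 4 hadamard_entry[OF assms(2)]
        by (simp add: sgn_select(1) cong: if_cong)
      moreover have "(\<Sum>k\<in>?V. if hadamard_adj n H2 v k then magic k w else 0) =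
          (\<Sum>k<n. Pel (Xel False k b) (sgn_eq s t * of_int (H2 k a)))"
        unfolding sum_hadamard_vertices using 4 hadamard_entry[OF assms(3)]
        by (simp add: sgn_select(2) cong: if_cong)
      ultimately show ?thesis
        unfolding flt using 4 cr by (simp add: emb_sum_Pel_eq null_Xel_row null_Xel_col)
    qed
  qed
  have "finite {k \<in> ?V. P k}" for P using finite_hadamard_vertices by simp
  then show ?thesis
    unfolding quantum_isomorphic_def
    using finite_hadamard_vertices unital_cstar_completion projection_magic csum_magic_row csum_magic_col edges
    by (intro conjI refl exI[of _ completion] exI[of _ "\<lambda>v w. emb (magic v w)"])
      (auto simp: csum_emb)
qed

end
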